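(* Let $d$ be a positive integer and let $\Delta$ be a $d$-dimensional color-shifted complex on $V=V_1\cup\cdots\cup V_{d+1}$, where $V_q=\{v_{q,1},\dots,v_{q,n_q}\}$. Let $\Gamma=\{\rho\in\Delta : v_{q,1}\notin\rho \text{ for all } q\in\{1,\dots,d+1\}\}$, and let $\Gamma_{d-1}$ be the set of $(d-1)$-dimensional faces in $\Gamma$. For each $(d-1)$-face $\rho$ of $\Delta$, let $m(\rho)$ be the unique color missing from $\rho$ and let $k(\rho)=\max\{j : \rho\cup\{v_{m(\rho),j}\}\in\Delta\}$. Then $$\hat{k}_d(\Delta)=\prod_{q=1}^{d+1}\prod_{i=1}^{n_q}x_{q,i}^{e(q,i)}\ \prod_{\rho\in\Gamma_{d-1}}D_{m(\rho),k(\rho)},$$ where $D_{q,j}=\sum_{i=1}^{j}x_{q,i}$ and $$e(q,i)=\#\{\sigma\in\Delta_d : v_{q,i}\in\sigma \text{ and } v_{r,1}\in\sigma\text{ for some } r\neq q\}.$$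
   Context: Color-shifted complexes: Fix a positive integer $d$. For each color $q\in\{1,\dots,d+1\}$ let $V_q=\{v_{q,j} : j=1,\dots,n_q\}$ be a set of vertices of color $q$ (the sets $V_q$ are pairwise disjoint). A color-shifted complex on $V=V_1\cup\cdots\cup V_{d+1}$ is an abstract simplicial complex $\Delta$ on $V$ such that (1) each facet $\sigma$ of $\Delta$ has exactly one vertex of each color, i.e. $|\sigma\cap V_q|=1$ for each $q$ (so $\Delta$ is pure of dimension $d$); and (2) if $\sigma\in\Delta$ and $v_{q,j}\in\sigma$, then $(\sigma\setminus\{v_{q,j}\})\cup\{v_{q,j'}\}\in\Delta$ for every $j'<j$. Every $(d-1)$-face of such a complex has at most one vertex of each color and so misses exactly one color. Weights: each vertex $v_{q,j}$ has an indeterminate weight $x_{q,j}$, and a $d$-face $\tau=\{v_{1,j_1},\dots,v_{d+1,j_{d+1}}\}$ has weight $x_\tau=x_{1,j_1}\cdots x_{d+1,j_{d+1}}$. Spanning trees and weighted tree-number: For a $d$-dimensional simplicial complex $\Sigma$, let $\Sigma_d$ be its set of $d$-dimensional faces, $\Sigma^{(d-1)}$ its $(d-1)$-skeleton, and $b_i(\Sigma)=\operatorname{rank}\tilde H_i(\Sigma;\mathbb{Z})$ (reduced homology). A $d$-dimensional spanning tree of $\Sigma$ is a $d$-dimensional subcomplex $\Upsilon\subseteq\Sigma$ with $\Upsilon^{(d-1)}=\Sigma^{(d-1)}$, $b_{d-1}(\Upsilon)=b_{d-1}(\Sigma)$ and $b_d(\Upsilon)=0$; $\mathcal{T}_d(\Sigma)$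 is the set of these. Let $\mathbf{t}_{d-1}(\Upsilon)$ be the order of the torsion subgroup of $\tilde H_{d-1}(\Upsilon;\mathbb{Z})$. The weighted tree-number is $$\hat k_d(\Sigma)=\sum_{\Upsilon\in\mathcal{T}_d(\Sigma)}\Big(\prod_{\tau\in\Upsilon_d}x_\tau\Big)\,\mathbf{t}_{d-1}(\Upsilon)^2.$$ *)

theory Defs
  imports "HOL-Algebra.Free_Abelian_Groups"
begin

section \<open>Simplicial complexes and reduced simplicial homology over the integers\<close>

definition simplicial_complex :: "'v set set \<Rightarrow> bool" where
  "simplicial_complex K \<longleftrightarrow>
     {} \<in> K \<and> (\<forall>\<sigma>\<in>K. finite \<sigma>) \<and> (\<forall>\<sigma>\<in>K. \<forall>\<tau>. \<tau> \<subseteq> \<sigma> \<longrightarrow> \<tau> \<in> K)"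

text \<open>Dimensions are integers, since the empty face has dimension \<open>-1\<close>.\<close>

definition face_dim :: "'v set \<Rightarrow> int" where
  "face_dim \<sigma> = int (card \<sigma>) - 1"

definition faces :: "'v set set \<Rightarrow> int \<Rightarrow> 'v set set" where
  "faces K i = {\<sigma> \<in> K. face_dim \<sigma> = i}"

definition has_dimension :: "'v set set \<Rightarrow> int \<Rightarrow> bool" where
  "has_dimension K d \<longleftrightarrow> (\<forall>\<sigma>\<in>K. face_dim \<sigma> \<le> d) \<and> (\<exists>\<sigma>\<in>K. face_dim \<sigma> = d)"

definition facets :: "'v set set \<Rightarrow> 'v set set" where
  "facets K = {\<sigma> \<in> K. \<forall>\<tau>\<in>K. \<sigma> \<subseteq> \<tau> \<longrightarrow> \<tau> = \<sigma>}"

definition skeleton :: "'v set set \<Rightarrow> int \<Rightarrow> 'v set set" where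
  "skeleton K i = {\<sigma> \<in> K. face_dim \<sigma> \<le> i}"

definition chain_group :: "'v set set \<Rightarrow> int \<Rightarrow> ('v set \<Rightarrow>\<^sub>0 int) monoid" where
  "chain_group K i = free_Abelian_group (faces K i)"

text \<open>Faces are oriented by the linear order on the vertices. The boundary of a
  single vertex is the empty face (so the homology below is reduced), and the
  boundary of the empty face is \<open>0\<close>.\<close>

definition boundary :: "('v::linorder set \<Rightarrow>\<^sub>0 int) \<Rightarrow> ('v set \<Rightarrow>\<^sub>0 int)" where
  "boundary = frag_extend
     (\<lambda>\<sigma>. \<Sum>v\<in>\<sigma>. frag_cmul ((-1) ^ card {u \<in> \<sigma>. u < v}) (frag_of (\<sigma> - {v})))"

definition cycles :: "'v::linorder set set \<Rightarrow> int \<Rightarrow> ('v set \<Rightarrow>\<^sub>0 int) set" where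
  "cycles K i = {c \<in> carrier (chain_group K i). boundary c = 0}"

definition boundaries :: "'v::linorder set set \<Rightarrow> int \<Rightarrow> ('v set \<Rightarrow>\<^sub>0 int) set" where
  "boundaries K i = boundary ` carrier (chain_group K (i + 1))"

definition reduced_homology :: "'v::linorder set set \<Rightarrow> int \<Rightarrow> ('v set \<Rightarrow>\<^sub>0 int) set monoid" where
  "reduced_homology K i =
     subgroup_generated (chain_group K i) (cycles K i) Mod boundaries K i"


section \<open>Rank and torsion of an abelian group\<close>

definition int_independent :: "('a, 'b) monoid_scheme \<Rightarrow> 'a set \<Rightarrow> bool" where
  "int_independent G S \<longleftrightarrow> finite S \<and> S \<subseteq> carrier G \<and>
     (\<forall>c :: 'a \<Rightarrow> int. finprod G (\<lambda>s. s [^]\<^bsub>G\<^esub> c s) S = \<one>\<^bsub>G\<^esub> \<longrightarrow> (\<forall>s\<in>S. c s = 0))"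

text \<open>The rank is the largest size of an independent set; it is only meaningful for groups
  of finite rank, such as the homology groups of finite complexes.\<close>

definition group_rank :: "('a, 'b) monoid_scheme \<Rightarrow> nat" where
  "group_rank G = Sup (card ` {S. int_independent G S})"

definition torsion_elements :: "('a, 'b) monoid_scheme \<Rightarrow> 'a set" where
  "torsion_elements G = {g \<in> carrier G. \<exists>m::nat. m > 0 \<and> g [^]\<^bsub>G\<^esub> m = \<one>\<^bsub>G\<^esub>}"

definition betti :: "'v::linorder set set \<Rightarrow> int \<Rightarrow> nat" where
  "betti K i = group_rank (reduced_homology K i)"

definition torsion_order :: "'v::linorder set set \<Rightarrow> int \<Rightarrow> nat" where
  "torsion_order K i = card (torsion_elements (reduced_homology K i))"


section \<open>Spanning trees and the weighted tree-number\<close>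

definition spanning_trees :: "int \<Rightarrow> 'v::linorder set set \<Rightarrow> 'v set set set" where
  "spanning_trees d K = {\<Upsilon>. simplicial_complex \<Upsilon> \<and> \<Upsilon> \<subseteq> K \<and> has_dimension \<Upsilon> d \<and>
     skeleton \<Upsilon> (d - 1) = skeleton K (d - 1) \<and>
     betti \<Upsilon> (d - 1) = betti K (d - 1) \<and> betti \<Upsilon> d = 0}"

text \<open>Integer polynomials in indeterminates indexed by \<open>'v\<close>: finitely supported maps from
  exponent vectors to coefficients, multiplied by convolution.\<close>

type_synonym 'v int_mpoly = "('v \<Rightarrow>\<^sub>0 nat) \<Rightarrow>\<^sub>0 int"

definition indet :: "'v \<Rightarrow> 'v int_mpoly" where
  "indet v = Poly_Mapping.single (Poly_Mapping.single v 1) 1"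

definition face_weight :: "'v set \<Rightarrow> 'v int_mpoly" where
  "face_weight \<tau> = (\<Prod>v\<in>\<tau>. indet v)"

definition weighted_tree_number :: "int \<Rightarrow> 'v::linorder set set \<Rightarrow> 'v int_mpoly" where
  "weighted_tree_number d K =
     (\<Sum>\<Upsilon>\<in>spanning_trees d K.
        (\<Prod>\<tau>\<in>faces \<Upsilon> d. face_weight \<tau>) * of_nat (torsion_order \<Upsilon> (d - 1)) ^ 2)"


section \<open>Color-shifted complexes\<close>

text \<open>\<open>Vtx q j\<close> is the vertex $v_{q,j}$: the \<open>j\<close>-th vertex of color \<open>q\<close>, both counted from 1.
  The lexicographic order serves only to orient faces.\<close>

datatype vertex = Vtx (color: nat) (index: nat)

instantiation vertex :: linorder
begin

definition less_eq_vertex :: "vertex \<Rightarrow> vertex \<Rightarrow> bool" where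
  "u \<le> v \<longleftrightarrow> color u < color v \<or> color u = color v \<and> index u \<le> index v"

definition less_vertex :: "vertex \<Rightarrow> vertex \<Rightarrow> bool" where
  "u < v \<longleftrightarrow> color u < color v \<or> color u = color v \<and> index u < index v"

instance
  by standard (auto simp: less_eq_vertex_def less_vertex_def intro: vertex.expand)

end

definition color_class :: "(nat \<Rightarrow> nat) \<Rightarrow> nat \<Rightarrow> vertex set" where
  "color_class n q = {Vtx q j | j. 1 \<le> j \<and> j \<le> n q}"

definition color_shifted :: "nat \<Rightarrow> (nat \<Rightarrow> nat) \<Rightarrow> vertex set set \<Rightarrow> bool" where
  "color_shifted d n \<Delta> \<longleftrightarrow>
     simplicial_complex \<Delta> \<and>
     \<Delta> \<subseteq> Pow (\<Union>q\<in>{1..d+1}. color_class n q) \<and>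
     (\<forall>\<sigma>\<in>facets \<Delta>. \<forall>q\<in>{1..d+1}. card (\<sigma> \<inter> color_class n q) = 1) \<and>
     (\<forall>\<sigma>\<in>\<Delta>. \<forall>q j j'. Vtx q j \<in> \<sigma> \<and> 1 \<le> j' \<and> j' < j \<longrightarrow>
        insert (Vtx q j') (\<sigma> - {Vtx q j}) \<in> \<Delta>)"

definition missing_color :: "nat \<Rightarrow> vertex set \<Rightarrow> nat" where
  "missing_color d \<rho> = (THE q. q \<in> {1..d+1} \<and> (\<forall>v\<in>\<rho>. color v \<noteq> q))"

definition max_extension :: "nat \<Rightarrow> vertex set set \<Rightarrow> vertex set \<Rightarrow> nat" where
  "max_extension d \<Delta> \<rho> = Max {j. insert (Vtx (missing_color d \<rho>) j) \<rho> \<in> \<Delta>}"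

definition Gamma_complex :: "nat \<Rightarrow> vertex set set \<Rightarrow> vertex set set" where
  "Gamma_complex d \<Delta> = {\<rho> \<in> \<Delta>. \<forall>q\<in>{1..d+1}. Vtx q 1 \<notin> \<rho>}"

definition D_poly :: "nat \<Rightarrow> nat \<Rightarrow> vertex int_mpoly" where
  "D_poly q j = (\<Sum>i=1..j. indet (Vtx q i))"

definition e_exponent :: "nat \<Rightarrow> vertex set set \<Rightarrow> nat \<Rightarrow> nat \<Rightarrow> nat" where
  "e_exponent d \<Delta> q i =
     card {\<sigma> \<in> faces \<Delta> (int d). Vtx q i \<in> \<sigma> \<and> (\<exists>r\<in>{1..d+1}. r \<noteq> q \<and> Vtx r 1 \<in> \<sigma>)}"

end

theory Submission
  imports Defs "Jordan_Normal_Form.Determinant"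
begin

text \<open>Write \<open>N\<close> for a set of \<open>(d-1)\<close>-faces on which every \<open>(d-1)\<close>-cycle of the complex is
determined by its coefficients, each integer vector on \<open>N\<close> occurring.  A choice \<open>T\<close> of \<open>d\<close>-faces then
spans a tree exactly if the minor of the boundary matrix with rows \<open>N\<close> and columns \<open>T\<close> is square and
nonsingular, and the torsion group of the tree is the cokernel of that minor, so its order is the
absolute value of the determinant (\<open>weighted_tree_number_eq_sum_minors\<close>).  By the Cauchy--Binet
formula the weighted tree-number is \<open>det (M X M\<^sup>T)\<close>, where \<open>M\<close> consists of the rows \<open>N\<close> of the boundary
matrix and \<open>X\<close> is the diagonal matrix of the weights of the \<open>d\<close>-faces.

For a color-shifted complex such an \<open>N\<close> comes from an acyclic matching: a face is matched by
adding or removing the first vertex of color \<open>q\<close>, where \<open>q\<close> is the least color that is missing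
from the face or represented by its first vertex.  Only the facets without any first
vertex, here called core facets, stay unmatched.  The boundary matrix is triangular with respect to
the matching, so the remaining facets form a tree with trivial torsion
(\<open>cycle_coordinates_down_facets\<close>), and the core facets index a basis of the \<open>d\<close>-cycles.

This basis can be made orthogonal for the inner product with weights \<open>1 / x\<^sub>\<tau>\<close>.  The cycle of a core
facet is a tensor product of reduced \<open>0\<close>-cycles, one for each color: in color \<open>q\<close> it is the
difference between the vertex of the facet and the weighted mean of all earlier vertices of that
color.  Its support is the box below the facet, which lies in the complex because the complex is
shifted (\<open>fund_cycle_boundary\<close>, \<open>fund_cycle_orthogonal\<close>).  Comparing \<open>M X M\<^sup>T\<close> with the Gram matrix of
this basis (\<open>det_weighted_gram\<close>) shows that the tree-number is the product of all facet weights and of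
the norms of the cycles.  The norm of the cycle of a core facet \<open>\<sigma>\<close> is \<open>1 / x\<^sub>\<sigma>\<close> times a product over the
colors of ratios \<open>D\<^sub>q\<^sub>,\<^sub>j / D\<^sub>q\<^sub>,\<^sub>j\<^sub>-\<^sub>1\<close>.  Grouped by the \<open>(d-1)\<close>-faces of \<open>\<Gamma>\<close> these ratios telescope to
\<open>D\<^sub>m\<^sub>,\<^sub>k / x\<^sub>m\<^sub>,\<^sub>1\<close>, and the denominators cancel against weights of facets with a single first
vertex (\<open>product_formula\<close>).  The computation takes place in the field of
fractions of the polynomial ring.\<close>

section \<open>Squared minors and weighted Gram determinants\<close>

text \<open>The left-hand determinant is expanded over all maps from the rows to \<open>S\<close>.  Maps that are not
injective contribute a determinant with two equal rows; the injective maps with image \<open>T\<close> are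
the permutations of the enumeration \<open>g T\<close>, and they add up to the product of the two minors.\<close>

lemma cauchy_binet:
  fixes A :: "nat \<Rightarrow> 'b \<Rightarrow> 'a::comm_ring_1" and B :: "'b \<Rightarrow> nat \<Rightarrow> 'a"
  assumes "finite S"
    and g: "\<And>T. T \<subseteq> S \<Longrightarrow> card T = m \<Longrightarrow> bij_betw (g T) {0..<m} T"
  shows "det (mat m m (\<lambda>(i,j). \<Sum>\<tau>\<in>S. A i \<tau> * B \<tau> j)) =
    (\<Sum>T | T \<subseteq> S \<and> card T = m.
       det (mat m m (\<lambda>(i,j). A i (g T j))) * det (mat m m (\<lambda>(i,j). B (g T i) j)))"
proof -
  let ?I = "{0..<m}" and ?P = "{p. p permutes {0..<m}}"
  let ?F = "?I \<rightarrow>\<^sub>E S"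
  define \<B> where "\<B> f = mat m m (\<lambda>(i,j). B (f i) j)" for f
  have \<B>: "\<B> f \<in> carrier_mat m m" for f by (simp add: \<B>_def)
  have det\<B>: "det (\<B> f) = (\<Sum>p\<in>?P. signof p * (\<Prod>i\<in>?I. B (f i) (p i)))" for f
    by (subst det_def'[OF \<B>]) (auto simp: \<B>_def intro!: sum.cong prod.cong arg_cong2[where f="(*)"])
  have "det (mat m m (\<lambda>(i,j). \<Sum>\<tau>\<in>S. A i \<tau> * B \<tau> j)) =
      (\<Sum>p\<in>?P. signof p * (\<Prod>i\<in>?I. \<Sum>\<tau>\<in>S. A i \<tau> * B \<tau> (p i)))"
    by (subst det_def'[where n=m]) (auto intro!: sum.cong prod.cong arg_cong2[where f="(*)"])
  also have "\<dots> = (\<Sum>p\<in>?P. \<Sum>f\<in>?F. (\<Prod>i\<in>?I. A i (f i)) * (signof p * (\<Prod>i\<in>?I. B (f i) (p i))))"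
    using assms(1) by (subst prod_sum_PiE) (auto simp: sum_distrib_left prod.distrib mult_ac)
  also have "\<dots> = (\<Sum>f\<in>?F. (\<Prod>i\<in>?I. A i (f i)) * det (\<B> f))"
    unfolding det\<B> sum_distrib_left by (rule sum.swap)
  also have "\<dots> = (\<Sum>f\<in>{f\<in>?F. inj_on f ?I}. (\<Prod>i\<in>?I. A i (f i)) * det (\<B> f))"
  proof (rule sum.mono_neutral_right)
    show "\<forall>f\<in>?F - {f\<in>?F. inj_on f ?I}. (\<Prod>i\<in>?I. A i (f i)) * det (\<B> f) = 0"
    proof
      fix f assume "f \<in> ?F - {f\<in>?F. inj_on f ?I}"
      then obtain i j where ij: "i < m" "j < m" "i \<noteq> j" "f i = f j"
        by (auto simp: inj_on_def)
      have "det (\<B> f) = 0"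
        by (rule det_identical_rows[OF \<B> ij(3,1,2)]) (use ij in \<open>auto simp: \<B>_def intro!: eq_vecI\<close>)
      then show "(\<Prod>i\<in>?I. A i (f i)) * det (\<B> f) = 0" by simp
    qed
  qed (auto intro: finite_PiE assms(1))
  also have "\<dots> = (\<Sum>T | T \<subseteq> S \<and> card T = m.
      \<Sum>f\<in>{f\<in>{f\<in>?F. inj_on f ?I}. f ` ?I = T}. (\<Prod>i\<in>?I. A i (f i)) * det (\<B> f))"
    by (rule sum.group[symmetric])
      (auto simp: card_image assms(1) finite_PiE)
  also have "\<dots> = (\<Sum>T | T \<subseteq> S \<and> card T = m.
       det (mat m m (\<lambda>(i,j). A i (g T j))) * det (mat m m (\<lambda>(i,j). B (g T i) j)))"
  proof (rule sum.cong[OF refl])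
    fix T assume "T \<in> {T. T \<subseteq> S \<and> card T = m}"
    then have T: "T \<subseteq> S" "card T = m" by auto
    let ?r = "\<lambda>p. restrict (g T \<circ> p) ?I"
    note bij = g[OF T(1) T(2)]
    have "bij_betw ?r ?P {f\<in>{f\<in>?F. inj_on f ?I}. f ` ?I = T}"
    proof (rule bij_betw_byWitness[where f'="\<lambda>f i. if i \<in> ?I then inv_into ?I (g T) (f i) else i"])
      show "\<forall>p\<in>?P. (\<lambda>i. if i \<in> ?I then inv_into ?I (g T) (?r p i) else i) = p"
      proof
        fix p assume p: "p \<in> ?P"
        then have "i \<in> ?I \<Longrightarrow> p i \<in> ?I" for i using permutes_in_image[of p ?I i] by auto
        then show "(\<lambda>i. if i \<in> ?I then inv_into ?I (g T) (?r p i) else i) = p"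
          using bij p by (auto simp: fun_eq_iff bij_betw_def permutes_def)
      qed
      show "\<forall>f\<in>{f\<in>{f\<in>?F. inj_on f ?I}. f ` ?I = T}.
          ?r (\<lambda>i. if i \<in> ?I then inv_into ?I (g T) (f i) else i) = f"
        using bij by (auto simp: fun_eq_iff bij_betw_def f_inv_into_f PiE_def extensional_def)
      show "?r ` ?P \<subseteq> {f\<in>{f\<in>?F. inj_on f ?I}. f ` ?I = T}"
      proof
        fix h assume "h \<in> ?r ` ?P"
        then obtain p where p: "p permutes ?I" and h: "h = ?r p" by auto
        then have pi: "p ` ?I = ?I" "inj_on p ?I" by (auto simp: permutes_image permutes_inj_on)
        have "inj_on (g T \<circ> p) ?I" using bij pi by (auto simp: bij_betw_def intro: comp_inj_on)
        moreover have "(g T \<circ> p) ` ?I = T" using bij pi by (metis bij_betw_imp_surj_on image_comp)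
        ultimately show "h \<in> {f\<in>{f\<in>?F. inj_on f ?I}. f ` ?I = T}"
          using T(1) unfolding h by (auto simp: inj_on_def)
      qed
      show "(\<lambda>f i. if i \<in> ?I then inv_into ?I (g T) (f i) else i) ` {f\<in>{f\<in>?F. inj_on f ?I}. f ` ?I = T} \<subseteq> ?P"
      proof
        fix p assume "p \<in> (\<lambda>f i. if i \<in> ?I then inv_into ?I (g T) (f i) else i) ` {f\<in>{f\<in>?F. inj_on f ?I}. f ` ?I = T}"
        then obtain f where f: "f \<in> ?F" "inj_on f ?I" and T': "T = f ` ?I"
          and p: "p = (\<lambda>i. if i \<in> ?I then inv_into ?I (g T) (f i) else i)" by auto
        have "bij_betw f ?I T" using f T' by (simp add: bij_betw_def)
        then have "bij_betw (inv_into ?I (g T) \<circ> f) ?I ?I"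
          using bij_betw_trans bij_betw_inv_into[OF bij] by blast
        then have "bij_betw (\<lambda>i. if i \<in> ?I then inv_into ?I (g T) (f i) else i) ?I ?I"
          by (rule iffD1[OF bij_betw_cong, rotated]) auto
        then show "p \<in> ?P"
          unfolding p by (auto intro!: bij_imp_permutes)
      qed
    qed
    then have "(\<Sum>f\<in>{f\<in>{f\<in>?F. inj_on f ?I}. f ` ?I = T}. (\<Prod>i\<in>?I. A i (f i)) * det (\<B> f)) =
        (\<Sum>p\<in>?P. (\<Prod>i\<in>?I. A i (?r p i)) * det (\<B> (?r p)))"
      by (rule sum.reindex_bij_betw[symmetric])
    also have "\<dots> = (\<Sum>p\<in>?P. (\<Prod>i\<in>?I. A i (g T (p i))) * (signof p * det (\<B> (g T))))"
    proof (rule sum.cong[OF refl])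
      fix p assume "p \<in> ?P"
      then have p: "p permutes ?I" by simp
      then have pi: "i < m \<Longrightarrow> p i < m" for i using permutes_in_image[OF p, of i] by auto
      have "\<B> (?r p) = mat m m (\<lambda>(i,j). \<B> (g T) $$ (p i, j))"
        by (rule eq_matI) (auto simp: \<B>_def pi)
      then show "(\<Prod>i\<in>?I. A i (?r p i)) * det (\<B> (?r p)) =
          (\<Prod>i\<in>?I. A i (g T (p i))) * (signof p * det (\<B> (g T)))"
        using det_permute_rows[OF \<B> p, of "g T"] by simp
    qed
    also have "\<dots> = (\<Sum>p\<in>?P. signof p * (\<Prod>i\<in>?I. A i (g T (p i)))) * det (\<B> (g T))"
      unfolding sum_distrib_right by (simp add: mult_ac)
    also have "(\<Sum>p\<in>?P. signof p * (\<Prod>i\<in>?I. A i (g T (p i)))) = det (mat m m (\<lambda>(i,j). A i (g T j)))"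
      by (subst det_def'[where n=m])
        (auto intro!: sum.cong prod.cong arg_cong2[where f="(*)"])
    finally show "(\<Sum>f\<in>{f\<in>{f\<in>?I \<rightarrow>\<^sub>E S. inj_on f ?I}. f ` ?I = T}. (\<Prod>i\<in>?I. A i (f i)) * det (\<B> f)) =
       det (mat m m (\<lambda>(i,j). A i (g T j))) * det (mat m m (\<lambda>(i,j). B (g T i) j))"
      by (simp add: \<B>_def)
  qed
  finally show ?thesis .
qed

lemma det_scale_rows:
  fixes a :: "nat \<Rightarrow> nat \<Rightarrow> 'a::comm_ring_1"
  shows "det (mat m m (\<lambda>(i,j). w i * a i j)) = (\<Prod>i = 0..<m. w i) * det (mat m m (\<lambda>(i,j). a i j))"
proof -
  have "det (mat m m (\<lambda>(i,j). w i * a i j)) =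
      (\<Sum>p\<in>{p. p permutes {0..<m}}. signof p * (\<Prod>i = 0..<m. w i * a i (p i)))"
    by (subst det_def'[where n=m]) (auto intro!: sum.cong prod.cong arg_cong2[where f="(*)"])
  also have "\<dots> = (\<Prod>i = 0..<m. w i) *
      (\<Sum>p\<in>{p. p permutes {0..<m}}. signof p * (\<Prod>i = 0..<m. a i (p i)))"
    by (simp add: sum_distrib_left prod.distrib mult_ac)
  also have "(\<Sum>p\<in>{p. p permutes {0..<m}}. signof p * (\<Prod>i = 0..<m. a i (p i))) =
      det (mat m m (\<lambda>(i,j). a i j))"
    by (subst det_def'[where n=m]) (auto intro!: sum.cong prod.cong arg_cong2[where f="(*)"])
  finally show ?thesis .
qed

lemma det_transposed: "det (mat m m (\<lambda>(i,j). a j i)) = det (mat m m (\<lambda>(i,j). a i j))"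
proof -
  have "mat m m (\<lambda>(i,j). a j i) = transpose_mat (mat m m (\<lambda>(i,j). a i j))"
    by (rule eq_matI) auto
  then show ?thesis using det_transpose[of "mat m m (\<lambda>(i,j). a i j)" m] by simp
qed

lemma det_of_int: "det (mat m m (\<lambda>(i,j). of_int (a i j))) = of_int (det (mat m m (\<lambda>(i,j). a i j)))"
proof -
  have "mat m m (\<lambda>(i,j). of_int (a i j)) = map_mat of_int (mat m m (\<lambda>(i,j). a i j))"
    by (rule eq_matI) auto
  then show ?thesis using of_int_hom.hom_det[of "mat m m (\<lambda>(i,j). a i j)"] by (rule trans[OF arg_cong[of _ _ det]])
qed

text \<open>The Cauchy--Binet formula for \<open>A W A\<^sup>T\<close> with a diagonal matrix \<open>W\<close>: the weights come out of the
rows of the second minor, which is the transpose of the first one.\<close>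

lemma squared_minor_expansion:
  fixes a :: "nat \<Rightarrow> 'b \<Rightarrow> int" and w :: "'b \<Rightarrow> 'a::comm_ring_1"
  assumes "finite S" and g: "\<And>T. T \<subseteq> S \<Longrightarrow> card T = m \<Longrightarrow> bij_betw (g T) {0..<m} T"
  shows "det (mat m m (\<lambda>(i,i'). \<Sum>\<tau>\<in>S. of_int (a i \<tau>) * w \<tau> * of_int (a i' \<tau>))) =
    (\<Sum>T | T \<subseteq> S \<and> card T = m. (\<Prod>\<tau>\<in>T. w \<tau>) * of_int (det (mat m m (\<lambda>(i,j). a i (g T j))) ^ 2))"
proof -
  have "det (mat m m (\<lambda>(i,i'). \<Sum>\<tau>\<in>S. of_int (a i \<tau>) * w \<tau> * of_int (a i' \<tau>))) =
      det (mat m m (\<lambda>(i,i'). \<Sum>\<tau>\<in>S. of_int (a i \<tau>) * (w \<tau> * of_int (a i' \<tau>))))"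
    by (simp add: mult.assoc)
  also have "\<dots> = (\<Sum>T | T \<subseteq> S \<and> card T = m. det (mat m m (\<lambda>(i,j). of_int (a i (g T j)))) *
      det (mat m m (\<lambda>(i,j). w (g T i) * of_int (a j (g T i)))))"
    using assms by (rule cauchy_binet)
  also have "\<dots> = (\<Sum>T | T \<subseteq> S \<and> card T = m.
      (\<Prod>\<tau>\<in>T. w \<tau>) * of_int (det (mat m m (\<lambda>(i,j). a i (g T j))) ^ 2))"
  proof (rule sum.cong[OF refl])
    fix T assume "T \<in> {T. T \<subseteq> S \<and> card T = m}"
    then have bij: "bij_betw (g T) {0..<m} T" using g by simp
    have "det (mat m m (\<lambda>(i,j). w (g T i) * of_int (a j (g T i)))) =
        (\<Prod>i = 0..<m. w (g T i)) * of_int (det (mat m m (\<lambda>(i,j). a i (g T j))))"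
      unfolding det_scale_rows det_of_int det_transposed[of m "\<lambda>i j. a i (g T j)"] ..
    also have "(\<Prod>i = 0..<m. w (g T i)) = (\<Prod>\<tau>\<in>T. w \<tau>)"
      by (rule prod.reindex_bij_betw[OF bij])
    finally show "det (mat m m (\<lambda>(i,j). of_int (a i (g T j)))) *
        det (mat m m (\<lambda>(i,j). w (g T i) * of_int (a j (g T i)))) =
        (\<Prod>\<tau>\<in>T. w \<tau>) * of_int (det (mat m m (\<lambda>(i,j). a i (g T j))) ^ 2)"
      by (simp add: det_of_int power2_eq_square mult_ac)
  qed
  finally show ?thesis .
qed

lemma sum_only_term:
  fixes f :: "nat \<Rightarrow> 'a::comm_monoid_add"
  assumes "i < n" "\<And>l. l < n \<Longrightarrow> l \<noteq> i \<Longrightarrow> f l = 0"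
  shows "(\<Sum>l = 0..<n. f l) = f i"
proof -
  have "(\<Sum>l = 0..<n. f l) = (\<Sum>l = 0..<n. if l = i then f i else 0)"
    using assms(2) by (intro sum.cong) auto
  then show ?thesis using assms(1) by simp
qed

text \<open>Intended for rows of a boundary matrix as \<open>M\<close> and cycles as the rows of \<open>W\<close>.  Let \<open>A\<close> have the rows of \<open>M\<close> followed by those of \<open>W X\<^sup>-\<^sup>1\<close>, where \<open>X\<close> is the diagonal matrix of the
weights.  Then \<open>A X A\<^sup>T\<close> is block diagonal with blocks
\<open>M X M\<^sup>T\<close> and the Gram matrix of \<open>W\<close>, while multiplying \<open>A\<close> by a unitriangular matrix with the rows
of \<open>W\<close> as its last columns makes it block triangular.  The two evaluations of \<open>det A\<close> give the claim.\<close>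

lemma det_weighted_gram:
  fixes M W :: "nat \<Rightarrow> nat \<Rightarrow> 'a::field" and x \<nu> :: "nat \<Rightarrow> 'a"
  assumes x: "\<And>j. j < m + k \<Longrightarrow> x j \<noteq> 0" and \<nu>: "\<And>r. r < k \<Longrightarrow> \<nu> r \<noteq> 0"
    and MW: "\<And>i r. i < m \<Longrightarrow> r < k \<Longrightarrow> (\<Sum>j = 0..<m+k. M i j * W r j) = 0"
    and WW: "\<And>r s. r < k \<Longrightarrow> s < k \<Longrightarrow>
      (\<Sum>j = 0..<m+k. W r j * W s j / x j) = (if r = s then \<nu> r else 0)"
    and W_diag: "\<And>r. r < k \<Longrightarrow> W r (m + r) = 1"
    and W_tri: "\<And>r s. r < s \<Longrightarrow> s < k \<Longrightarrow> W r (m + s) = 0"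
  shows "det (mat m m (\<lambda>(i,i'). \<Sum>j = 0..<m+k. M i j * x j * M i' j)) =
    det (mat m m (\<lambda>(i,j). M i j)) ^ 2 * (\<Prod>j = 0..<m+k. x j) * (\<Prod>r = 0..<k. \<nu> r)"
proof -
  let ?n = "m + k"
  define L where "L = mat m m (\<lambda>(i,i'). \<Sum>j = 0..<?n. M i j * x j * M i' j)"
  define A where "A = mat ?n ?n (\<lambda>(i,j). if i < m then M i j else W (i - m) j / x j)"
  define C where "C = mat ?n ?n (\<lambda>(i,j). if j < m then x i * M j i else W (j - m) i)"
  define E where "E = mat ?n ?n (\<lambda>(i,j). if j < m then (if i = j then 1 else 0) else W (j - m) i)"
  define X where "X = mat ?n ?n (\<lambda>(i,j). if i = j then x i else 0)"
  define D where "D = mat k k (\<lambda>(r,s). if r = s then \<nu> r else 0)"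
  define MB where "MB = mat m m (\<lambda>(i,j). M i j)"
  define Y where "Y = mat k m (\<lambda>(r,j). W r j / x j)"
  have carrier: "A \<in> carrier_mat ?n ?n" "C \<in> carrier_mat ?n ?n" "E \<in> carrier_mat ?n ?n"
      "X \<in> carrier_mat ?n ?n" "L \<in> carrier_mat m m" "D \<in> carrier_mat k k" "MB \<in> carrier_mat m m"
      "Y \<in> carrier_mat k m"
    by (simp_all add: A_def C_def E_def X_def L_def D_def MB_def Y_def)
  have WM: "(\<Sum>j = 0..<?n. W r j * M i j) = 0" if "i < m" "r < k" for i r
    using MW[OF that] by (simp add: mult.commute)
  have AC: "A * C = four_block_mat L (0\<^sub>m m k) (0\<^sub>m k m) D"
  proof (rule eq_matI)
    fix i j assume "i < dim_row (four_block_mat L (0\<^sub>m m k) (0\<^sub>m k m) D)"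
      "j < dim_col (four_block_mat L (0\<^sub>m m k) (0\<^sub>m k m) D)"
    then have ij: "i < ?n" "j < ?n" by (simp_all add: L_def D_def)
    then have "(A * C) $$ (i, j) = (\<Sum>l = 0..<?n. A $$ (i, l) * C $$ (l, j))"
      using carrier by (auto simp: scalar_prod_def)
    also have "\<dots> = four_block_mat L (0\<^sub>m m k) (0\<^sub>m k m) D $$ (i, j)"
    proof (cases "i < m"; cases "j < m")
      assume "i < m" "j < m"
      then show ?thesis using ij by (simp add: A_def C_def L_def D_def mult.assoc)
    next
      assume "i < m" "\<not> j < m"
      then show ?thesis using ij MW[of i "j - m"] by (simp add: A_def C_def L_def D_def)
    next
      assume ni: "\<not> i < m" and j: "j < m"
      have "(\<Sum>l = 0..<?n. A $$ (i, l) * C $$ (l, j)) = (\<Sum>l = 0..<?n. W (i - m) l * M j l)"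
        using ni j ij x by (intro sum.cong) (simp_all add: A_def C_def)
      then show ?thesis using ni j ij WM[of j "i - m"] by (simp add: L_def D_def)
    next
      assume ni: "\<not> i < m" and nj: "\<not> j < m"
      have "(\<Sum>l = 0..<?n. A $$ (i, l) * C $$ (l, j)) = (\<Sum>l = 0..<?n. W (i - m) l * W (j - m) l / x l)"
        using ni nj ij by (intro sum.cong) (simp_all add: A_def C_def)
      then show ?thesis using ni nj ij WW[of "i - m" "j - m"] by (auto simp: L_def D_def)
    qed
    finally show "(A * C) $$ (i, j) = four_block_mat L (0\<^sub>m m k) (0\<^sub>m k m) D $$ (i, j)" .
  qed (simp_all add: A_def C_def L_def D_def)
  have AE: "A * E = four_block_mat MB (0\<^sub>m m k) Y D"
  proof (rule eq_matI)
    fix i j assume "i < dim_row (four_block_mat MB (0\<^sub>m m k) Y D)"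
      "j < dim_col (four_block_mat MB (0\<^sub>m m k) Y D)"
    then have ij: "i < ?n" "j < ?n" by (simp_all add: MB_def D_def)
    then have eq: "(A * E) $$ (i, j) = (\<Sum>l = 0..<?n. A $$ (i, l) * E $$ (l, j))"
      using carrier by (auto simp: scalar_prod_def)
    also have "\<dots> = four_block_mat MB (0\<^sub>m m k) Y D $$ (i, j)"
    proof (cases "j < m")
      case True
      have "(\<Sum>l = 0..<?n. A $$ (i, l) * E $$ (l, j)) = A $$ (i, j) * E $$ (j, j)"
        using True ij by (intro sum_only_term) (auto simp: E_def)
      then show ?thesis using True ij by (auto simp: A_def E_def MB_def D_def Y_def)
    next
      case nj: False
      show ?thesis
      proof (cases "i < m")
        case True
        then show ?thesis using nj ij MW[of i "j - m"] by (simp add: A_def E_def MB_def D_def)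
      next
        case False
        have "(\<Sum>l = 0..<?n. A $$ (i, l) * E $$ (l, j)) = (\<Sum>l = 0..<?n. W (i - m) l * W (j - m) l / x l)"
          using False nj ij by (intro sum.cong) (simp_all add: A_def E_def)
        then show ?thesis using False nj ij WW[of "i - m" "j - m"] by (auto simp: MB_def D_def)
      qed
    qed
    finally show "(A * E) $$ (i, j) = four_block_mat MB (0\<^sub>m m k) Y D $$ (i, j)" .
  qed (simp_all add: A_def E_def MB_def D_def)
  have CX: "C = X * transpose_mat A"
  proof (rule eq_matI)
    fix i j assume "i < dim_row (X * transpose_mat A)" "j < dim_col (X * transpose_mat A)"
    then have ij: "i < ?n" "j < ?n" using carrier by simp_all
    then have "(X * transpose_mat A) $$ (i, j) = (\<Sum>l = 0..<?n. X $$ (i, l) * A $$ (j, l))"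
      using carrier by (auto simp: scalar_prod_def)
    also have "\<dots> = X $$ (i, i) * A $$ (j, i)"
      using ij by (intro sum_only_term) (auto simp: X_def)
    also have "\<dots> = C $$ (i, j)" using ij x by (simp add: X_def A_def C_def)
    finally show "C $$ (i, j) = (X * transpose_mat A) $$ (i, j)" ..
  qed (use carrier in auto)
  have detX: "det X = (\<Prod>j = 0..<?n. x j)"
  proof -
    have "det X = prod_list (diag_mat X)"
      by (rule det_upper_triangular[OF _ carrier(4)]) (auto simp: X_def)
    then show ?thesis by (simp add: prod_list_diag_prod X_def)
  qed
  have detD: "det D = (\<Prod>r = 0..<k. \<nu> r)"
  proof -
    have "det D = prod_list (diag_mat D)"
      by (rule det_upper_triangular[OF _ carrier(6)]) (auto simp: D_def)
    then show ?thesis by (simp add: prod_list_diag_prod D_def)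
  qed
  have detE: "det E = 1"
  proof -
    have "upper_triangular E"
    proof
      fix i j assume ij: "j < i" "i < dim_row E"
      show "E $$ (i, j) = 0"
      proof (cases "j < m")
        case False
        then have "W (j - m) (m + (i - m)) = 0" using ij by (intro W_tri) (auto simp: E_def)
        then show ?thesis using False ij by (simp add: E_def)
      qed (use ij in \<open>auto simp: E_def\<close>)
    qed
    then have "det E = prod_list (diag_mat E)" by (rule det_upper_triangular[OF _ carrier(3)])
    also have "\<dots> = (\<Prod>i = 0..<?n. E $$ (i, i))" by (simp add: prod_list_diag_prod E_def)
    also have "\<dots> = 1"
    proof (rule prod.neutral, rule ballI)
      fix i assume "i \<in> {0..<?n}"
      then show "E $$ (i, i) = 1" using W_diag[of "i - m"] by (cases "i < m") (auto simp: E_def)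
    qed
    finally show ?thesis .
  qed
  have AC_det: "det A * det C = det L * det D"
    unfolding det_mult[OF carrier(1,2), symmetric] AC
    by (rule det_four_block_mat_upper_right_zero[OF carrier(5) refl _ carrier(6)]) simp
  have C_det: "det C = det X * det A"
    unfolding CX using det_mult[OF carrier(4), of "transpose_mat A"] carrier(1) det_transpose[OF carrier(1)] by simp
  have A_det: "det A = det MB * det D"
    using det_mult[OF carrier(1,3)] detE
      det_four_block_mat_upper_right_zero[OF carrier(7) refl carrier(8,6)] by (simp add: AE)
  have "det L * det D = (det MB * det D) * (det X * (det MB * det D))"
    unfolding AC_det[symmetric] C_det A_det ..
  also have "\<dots> = det MB ^ 2 * det X * det D * det D"
    by (simp only: power2_eq_square ac_simps)
  finally have "det L = det MB ^ 2 * det X * det D"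
    using \<nu> by (simp add: detD)
  then show ?thesis by (simp only: detX detD L_def MB_def)
qed

section \<open>The index of a sublattice\<close>

definition column_lattice :: "int mat \<Rightarrow> int vec set" where
  "column_lattice A = (\<lambda>w. A *\<^sub>v w) ` carrier_vec (dim_col A)"

lemma column_lattice_mult_subset:
  assumes "A \<in> carrier_mat n m" "E \<in> carrier_mat m k"
  shows "column_lattice (A * E) \<subseteq> column_lattice A"
  using assms by (auto simp: column_lattice_def)

lemma column_lattice_addcol:
  assumes A: "A \<in> carrier_mat n m" and kl: "k < m" "l < m" "k \<noteq> l"
  shows "column_lattice (addcol a k l A) = column_lattice A"
proof
  show "column_lattice (addcol a k l A) \<subseteq> column_lattice A"
    unfolding addcol_mat[OF A kl(2)] by (rule column_lattice_mult_subset[OF A, of _ m]) simp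
  have 1: "addcol a k l A \<in> carrier_mat n m" using A by auto
  have "addcol (- a) k l (addcol a k l A) = A"
    by (rule eq_matI) (use A kl in auto)
  then show "column_lattice A \<subseteq> column_lattice (addcol a k l A)"
    using column_lattice_mult_subset[OF 1, of "addrow_mat m (- a) l k" m] addcol_mat[OF 1 kl(2), of "-a" k]
    by simp
qed

lemma column_lattice_swapcols:
  assumes A: "A \<in> carrier_mat n m" and kl: "k < m" "l < m"
  shows "column_lattice (swapcols k l A) = column_lattice A"
proof
  show "column_lattice (swapcols k l A) \<subseteq> column_lattice A"
    unfolding swapcols_mat[OF A kl] by (rule column_lattice_mult_subset[OF A, of _ m]) simp
  have 1: "swapcols k l A \<in> carrier_mat n m" using A by auto
  have "swapcols k l (swapcols k l A) = A"
    by (rule eq_matI) (use A kl in auto)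
  then show "column_lattice A \<subseteq> column_lattice (swapcols k l A)"
    using column_lattice_mult_subset[OF 1, of "swaprows_mat m k l" m] swapcols_mat[OF 1 kl]
    by simp
qed

text \<open>The Euclidean algorithm on the first row: as long as two of its entries are nonzero,
reducing the larger one modulo the smaller one decreases the sum of absolute values.  Column
operations change neither the lattice nor the absolute value of the determinant.\<close>

lemma column_lattice_clear_first_row:
  fixes A :: "int mat"
  assumes "A \<in> carrier_mat (Suc n) (Suc n)"
  shows "\<exists>A'. A' \<in> carrier_mat (Suc n) (Suc n) \<and> column_lattice A' = column_lattice A \<and>
    \<bar>det A'\<bar> = \<bar>det A\<bar> \<and> (\<forall>j. 0 < j \<and> j < Suc n \<longrightarrow> A' $$ (0,j) = 0)"
  using assms
proof (induction "nat (\<Sum>j<Suc n. \<bar>A $$ (0,j)\<bar>)" arbitrary: A rule: less_induct)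
  case (less A)
  note A = less.prems
  show ?case
  proof (cases "\<exists>i j. i < Suc n \<and> j < Suc n \<and> i \<noteq> j \<and> A $$ (0,i) \<noteq> 0 \<and> A $$ (0,j) \<noteq> 0")
    case True
    then obtain i j where ij: "i < Suc n" "j < Suc n" "i \<noteq> j" "A $$ (0,i) \<noteq> 0" "A $$ (0,j) \<noteq> 0"
      and le: "\<bar>A $$ (0,i)\<bar> \<le> \<bar>A $$ (0,j)\<bar>"
    proof (elim exE conjE)
      fix i j assume *: "i < Suc n" "j < Suc n" "i \<noteq> j" "A $$ (0,i) \<noteq> 0" "A $$ (0,j) \<noteq> 0"
      show thesis
      proof (cases "\<bar>A $$ (0,i)\<bar> \<le> \<bar>A $$ (0,j)\<bar>")
        case True
        show thesis by (rule that[OF *(1-5) True])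
      next
        case False
        show thesis by (rule that[OF *(2,1) *(3)[symmetric] *(5,4)]) (use False in simp)
      qed
    qed
    \<comment> \<open>Column \<open>i\<close> has the smaller entry and is used to reduce column \<open>j\<close>.\<close>
    define B where "B = addcol (- (A $$ (0,j) div A $$ (0,i))) j i A"
    have B: "B \<in> carrier_mat (Suc n) (Suc n)" using A by (auto simp: B_def)
    have Bj: "B $$ (0,j) = A $$ (0,j) mod A $$ (0,i)"
      using A ij by (simp add: B_def minus_div_mult_eq_mod algebra_simps)
    have Bk: "B $$ (0,k) = A $$ (0,k)" if "k < Suc n" "k \<noteq> j" for k
      using A that by (simp add: B_def)
    have lt: "\<bar>B $$ (0,j)\<bar> < \<bar>A $$ (0,j)\<bar>"
      unfolding Bj using abs_mod_less[OF ij(4), of "A $$ (0,j)"] le by linarith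
    have "(\<Sum>k<Suc n. \<bar>B $$ (0,k)\<bar>) < (\<Sum>k<Suc n. \<bar>A $$ (0,k)\<bar>)"
    proof (rule sum_strict_mono_ex1)
      show "\<forall>k\<in>{..<Suc n}. \<bar>B $$ (0,k)\<bar> \<le> \<bar>A $$ (0,k)\<bar>"
      proof
        fix k assume "k \<in> {..<Suc n}"
        then show "\<bar>B $$ (0,k)\<bar> \<le> \<bar>A $$ (0,k)\<bar>" using lt Bk[of k] by (cases "k = j") auto
      qed
      show "\<exists>k\<in>{..<Suc n}. \<bar>B $$ (0,k)\<bar> < \<bar>A $$ (0,k)\<bar>" using lt ij(2) by blast
    qed simp
    moreover have "0 \<le> (\<Sum>k<Suc n. \<bar>B $$ (0,k)\<bar>)" by (simp add: sum_nonneg)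
    ultimately have "nat (\<Sum>k<Suc n. \<bar>B $$ (0,k)\<bar>) < nat (\<Sum>k<Suc n. \<bar>A $$ (0,k)\<bar>)" by linarith
    from less.hyps[OF this B] obtain A' where A': "A' \<in> carrier_mat (Suc n) (Suc n)"
      "column_lattice A' = column_lattice B" "\<bar>det A'\<bar> = \<bar>det B\<bar>"
      "\<forall>j. 0 < j \<and> j < Suc n \<longrightarrow> A' $$ (0,j) = 0" by blast
    have "column_lattice B = column_lattice A" "det B = det A"
      unfolding B_def using column_lattice_addcol[OF A ij(2,1)] ij A by auto
    then show ?thesis using A' by (intro exI[of _ A']) simp
  next
    case False
    show ?thesis
    proof (cases "\<exists>k. 0 < k \<and> k < Suc n \<and> A $$ (0,k) \<noteq> 0")
      case True
      then obtain k where k: "0 < k" "k < Suc n" "A $$ (0,k) \<noteq> 0" by blast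
      then have z: "A $$ (0,i) = 0" if "i < Suc n" "i \<noteq> k" for i using False that by blast
      show ?thesis
      proof (intro exI[of _ "swapcols 0 k A"] conjI allI impI)
        show "column_lattice (swapcols 0 k A) = column_lattice A"
          using k by (intro column_lattice_swapcols[OF A]) auto
        show "\<bar>det (swapcols 0 k A)\<bar> = \<bar>det A\<bar>"
          using k A by (subst det_swapcols[of _ "Suc n"]) auto
        show "swapcols 0 k A $$ (0, j) = 0" if "0 < j \<and> j < Suc n" for j
          using that A k z by auto
      qed (use A in auto)
    next
      case False
      then show ?thesis using A by (intro exI[of _ A]) auto
    qed
  qed
qed

text \<open>The index of the lattice generated by the columns of a nonsingular integer matrix is the absolute
value of the determinant.  Once the first row is \<open>(a, 0, \<dots>, 0)\<close>, the first coordinate of a representative can be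
chosen uniquely in \<open>{0..<\<bar>a\<bar>}\<close>, and the others are representatives for the remaining
minor.\<close>

lemma ex_transversal_column_lattice:
  assumes "A \<in> carrier_mat n n" "det A \<noteq> 0"
  shows "\<exists>R. R \<subseteq> carrier_vec n \<and> finite R \<and> int (card R) = \<bar>det A\<bar> \<and>
    (\<forall>v\<in>carrier_vec n. \<exists>!r. r \<in> R \<and> v - r \<in> column_lattice A)"
  using assms
proof (induction n arbitrary: A)
  case 0
  then have "column_lattice A = {0\<^sub>v 0}" "det A = 1"
    by (auto simp: column_lattice_def intro!: image_eqI[of _ _ "0\<^sub>v 0"]) 
  then show ?case by (intro exI[of _ "{0\<^sub>v 0}"]) (auto intro!: eq_vecI)
next
  case (Suc n)
  obtain A' where A': "A' \<in> carrier_mat (Suc n) (Suc n)"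
      "column_lattice A' = column_lattice A" "\<bar>det A'\<bar> = \<bar>det A\<bar>"
      and z: "\<And>j. 0 < j \<and> j < Suc n \<Longrightarrow> A' $$ (0,j) = 0"
    using column_lattice_clear_first_row[OF Suc.prems(1)] by blast
  define a where "a = A' $$ (0,0)"
  define c where "c = vec n (\<lambda>i. A' $$ (Suc i, 0))"
  define B where "B = mat n n (\<lambda>(i,j). A' $$ (Suc i, Suc j))"
  have B: "B \<in> carrier_mat n n" and c: "c \<in> carrier_vec n" by (auto simp: B_def c_def)
  have "A' = four_block_mat (mat 1 1 (\<lambda>_. a)) (0\<^sub>m 1 n) (mat n 1 (\<lambda>(i,_). c $ i)) B"
    by (rule eq_matI) (use A'(1) z in \<open>auto simp: a_def c_def B_def\<close>)
  then have detA': "det A' = a * det B"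
    using det_four_block_mat_upper_right_zero[of "mat 1 1 (\<lambda>_. a)" 1 "0\<^sub>m 1 n" n "mat n 1 (\<lambda>(i,_). c $ i)" B] B
    by (simp add: det_single)
  then have nz: "a \<noteq> 0" "det B \<noteq> 0" using A'(3) Suc.prems(2) by auto
  have mult: "A' *\<^sub>v vCons t w = vCons (a * t) (t \<cdot>\<^sub>v c + B *\<^sub>v w)" if w: "w \<in> carrier_vec n" for t w
  proof (rule eq_vecI)
    fix i assume i: "i < dim_vec (vCons (a * t) (t \<cdot>\<^sub>v c + B *\<^sub>v w))"
    then have i: "i < Suc n" using B by simp
    have row: "row A' i = vCons (A' $$ (i,0)) (vec n (\<lambda>j. A' $$ (i, Suc j)))"
      using i A'(1) by (auto simp: row_def vec_Suc o_def)
    show "(A' *\<^sub>v vCons t w) $ i = vCons (a * t) (t \<cdot>\<^sub>v c + B *\<^sub>v w) $ i"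
    proof (cases i)
      case 0
      have "vec n (\<lambda>j. A' $$ (0, Suc j)) = 0\<^sub>v n" using z by (intro eq_vecI) auto
      then show ?thesis using 0 A'(1) w row by (simp add: a_def)
    next
      case (Suc i')
      then have i': "i' < n" using i by simp
      then have "row B i' = vec n (\<lambda>j. A' $$ (i, Suc j))" by (auto simp: B_def Suc row_def intro!: eq_vecI)
      then show ?thesis using Suc i' A'(1) row B c by (simp add: c_def mult.commute)
    qed
  qed (use A'(1) B in auto)
  have mem: "x \<in> column_lattice A \<longleftrightarrow> (\<exists>w\<in>carrier_vec (Suc n). x = A' *\<^sub>v w)" for x
    unfolding A'(2)[symmetric] using A'(1) by (auto simp: column_lattice_def)
  have lat: "vCons s u \<in> column_lattice A \<longleftrightarrow> (\<exists>t. s = a * t \<and> u - t \<cdot>\<^sub>v c \<in> column_lattice B)"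
    if u: "u \<in> carrier_vec n" for s u
  proof
    assume "vCons s u \<in> column_lattice A"
    then obtain w where w: "w \<in> carrier_vec (Suc n)" "vCons s u = A' *\<^sub>v w"
      unfolding mem by blast
    then obtain t w' where w': "w = vCons t w'" "w' \<in> carrier_vec n" by (cases w) auto
    then have "s = a * t" "u = t \<cdot>\<^sub>v c + B *\<^sub>v w'" using mult[OF w'(2), of t] w by simp_all
    moreover have "t \<cdot>\<^sub>v c + B *\<^sub>v w' - t \<cdot>\<^sub>v c = B *\<^sub>v w'"
      using B c w' by (intro eq_vecI) auto
    ultimately show "\<exists>t. s = a * t \<and> u - t \<cdot>\<^sub>v c \<in> column_lattice B"
      using B w' by (auto simp: column_lattice_def)
  next
    assume "\<exists>t. s = a * t \<and> u - t \<cdot>\<^sub>v c \<in> column_lattice B"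
    then obtain t w where *: "s = a * t" "u - t \<cdot>\<^sub>v c = B *\<^sub>v w" "w \<in> carrier_vec n"
      using B by (auto simp: column_lattice_def)
    have "u = t \<cdot>\<^sub>v c + (u - t \<cdot>\<^sub>v c)" using c u by (intro eq_vecI) auto
    then have "vCons s u = A' *\<^sub>v vCons t w" using mult[OF *(3), of t] * by simp
    then show "vCons s u \<in> column_lattice A"
      unfolding mem using *(3) by (intro bexI[of _ "vCons t w"]) simp_all
  qed
  from Suc.IH[OF B nz(2)] obtain R
    where "R \<subseteq> carrier_vec n \<and> finite R \<and> int (card R) = \<bar>det B\<bar> \<and>
      (\<forall>v\<in>carrier_vec n. \<exists>!r. r \<in> R \<and> v - r \<in> column_lattice B)" by (rule exE)
  then have R: "R \<subseteq> carrier_vec n" "finite R" "int (card R) = \<bar>det B\<bar>"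
    and ex1: "\<And>v. v \<in> carrier_vec n \<Longrightarrow> \<exists>!r. r \<in> R \<and> v - r \<in> column_lattice B" by simp_all
  let ?R = "(\<lambda>(s,u). vCons s u) ` ({0..<\<bar>a\<bar>} \<times> R)"
  have sub: "vCons s v - vCons r u = vCons (s - r) (v - u)" if "v \<in> carrier_vec n" "u \<in> carrier_vec n" for s r :: int and v u
    using that by (intro eq_vecI) (auto simp: vec_index_vCons)
  show ?case
  proof (intro exI[of _ ?R] conjI ballI)
    show "?R \<subseteq> carrier_vec (Suc n)" using R(1) by auto
    show "finite ?R" using R(2) by auto
    have "card ?R = card ({0..<\<bar>a\<bar>} \<times> R)" by (rule card_image) (auto simp: inj_on_def)
    then show "int (card ?R) = \<bar>det A\<bar>"
      using R(3) by (simp add: card_cartesian_product A'(3)[symmetric] detA' abs_mult)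
    fix v :: "int vec" assume "v \<in> carrier_vec (Suc n)"
    then obtain s u where v: "v = vCons s u" and u: "u \<in> carrier_vec n" by (cases v) auto
    define s0 where "s0 = s mod \<bar>a\<bar>"
    have "\<bar>a\<bar> dvd s - s0" unfolding s0_def by (simp add: mod_eq_dvd_iff[symmetric])
    then obtain t where t: "s - s0 = a * t" by auto
    obtain r where r: "r \<in> R" "u - t \<cdot>\<^sub>v c - r \<in> column_lattice B"
      using ex1[of "u - t \<cdot>\<^sub>v c"] u c by (meson minus_carrier_vec smult_carrier_vec)
    have swap: "u - t \<cdot>\<^sub>v c - r = u - r - t \<cdot>\<^sub>v c" if "r \<in> R" for r t
    proof -
      have "r \<in> carrier_vec n" using that R(1) by blast
      then show ?thesis using u c by (intro eq_vecI) auto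
    qed
    show "\<exists>!r. r \<in> ?R \<and> v - r \<in> column_lattice A"
    proof (rule ex1I[of _ "vCons s0 r"], safe)
      have "0 \<le> s0" "s0 < \<bar>a\<bar>" using nz(1) by (auto simp: s0_def)
      then show "vCons s0 r \<in> ?R" using r by auto
      show "v - vCons s0 r \<in> column_lattice A"
      proof -
        have rc: "r \<in> carrier_vec n" using r(1) R(1) by blast
        have "vCons (s - s0) (u - r) \<in> column_lattice A"
          using t r swap[OF r(1)] by (subst lat) (auto intro: minus_carrier_vec[OF u rc])
        then show ?thesis by (simp add: v sub[OF u rc])
      qed
    next
      fix x s1 r1 assume 1: "v - vCons s1 r1 \<in> column_lattice A" "s1 \<in> {0..<\<bar>a\<bar>}" "r1 \<in> R"
      have r1: "r1 \<in> carrier_vec n" using 1(3) R(1) by blast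
      obtain t1 where t1: "s - s1 = a * t1" "u - r1 - t1 \<cdot>\<^sub>v c \<in> column_lattice B"
        using 1(1) lat[OF minus_carrier_vec[OF u r1]] unfolding v sub[OF u r1] by blast
      have "s mod \<bar>a\<bar> = s1 mod \<bar>a\<bar>" using t1(1) by (simp add: mod_eq_dvd_iff)
      then have s1: "s1 = s0" using 1(2) by (simp add: s0_def)
      then have "t1 = t" using t t1(1) nz(1) by simp
      then have "u - t \<cdot>\<^sub>v c - r1 \<in> column_lattice B" using t1(2) swap[OF 1(3)] by simp
      moreover have "u - t \<cdot>\<^sub>v c \<in> carrier_vec n" using u c by simp
      ultimately have "r1 = r" using ex1[of "u - t \<cdot>\<^sub>v c"] r 1(3) by blast
      then show "vCons s1 r1 = vCons s0 r" using s1 by simp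
    qed
  qed
qed

section \<open>Rank and torsion of quotients of chain groups\<close>

text \<open>Fraction-free Gaussian elimination: the equation \<open>j\<close> is used to eliminate an unknown \<open>s0\<close> with
nonzero coefficient in it, after scaling the other unknowns by that coefficient.\<close>

lemma overdetermined_int_solution:
  fixes f :: "'s \<Rightarrow> 'j \<Rightarrow> int"
  assumes "finite J" "finite S" "card J < card S"
  shows "\<exists>c. (\<exists>s\<in>S. c s \<noteq> 0) \<and> (\<forall>j\<in>J. (\<Sum>s\<in>S. c s * f s j) = 0)"
  using assms
proof (induction J arbitrary: S f rule: finite_induct)
  case empty
  then have "S \<noteq> {}" by auto
  then show ?case by (intro exI[of _ "\<lambda>_. 1"]) auto
next
  case (insert j J)
  show ?case
  proof (cases "\<forall>s\<in>S. f s j = 0")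
    case True
    obtain c where "\<exists>s\<in>S. c s \<noteq> 0" "\<forall>k\<in>J. (\<Sum>s\<in>S. c s * f s k) = 0"
      using insert.IH[OF insert.prems(1), of f] insert.prems insert.hyps by auto
    then show ?thesis using True by (intro exI[of _ c]) auto
  next
    case False
    then obtain s0 where s0: "s0 \<in> S" "f s0 j \<noteq> 0" by auto
    \<comment> \<open>The system after eliminating \<open>s0\<close>; its equation \<open>j\<close> is trivial.\<close>
    define g where "g s k = f s0 j * f s k - f s j * f s0 k" for s k
    have "card J < card (S - {s0})" using insert.prems insert.hyps s0 by simp
    then obtain c where c: "\<exists>s\<in>S - {s0}. c s \<noteq> 0" "\<forall>k\<in>J. (\<Sum>s\<in>S - {s0}. c s * g s k) = 0"
      using insert.IH[of "S - {s0}" g] insert.prems by auto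
    define c' where "c' s = (if s = s0 then - (\<Sum>t\<in>S - {s0}. c t * f t j) else c s * f s0 j)" for s
    have "(\<Sum>s\<in>S. c' s * f s k) = (\<Sum>s\<in>S - {s0}. c s * g s k)" for k
    proof -
      have "(\<Sum>s\<in>S. c' s * f s k) = c' s0 * f s0 k + (\<Sum>s\<in>S - {s0}. c' s * f s k)"
        using insert.prems(1) s0(1) by (rule sum.remove)
      also have "(\<Sum>s\<in>S - {s0}. c' s * f s k) = (\<Sum>s\<in>S - {s0}. c s * f s0 j * f s k)"
        by (rule sum.cong) (auto simp: c'_def)
      also have "c' s0 * f s0 k = (\<Sum>s\<in>S - {s0}. - (c s * f s j * f s0 k))"
        by (simp add: c'_def sum_distrib_right sum_negf)
      finally show ?thesis by (simp add: g_def sum.distrib[symmetric] algebra_simps)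
    qed
    moreover have "g s j = 0" for s by (simp add: g_def)
    ultimately have "\<forall>k\<in>insert j J. (\<Sum>s\<in>S. c' s * f s k) = 0" using c(2) by simp
    moreover have "\<exists>s\<in>S. c' s \<noteq> 0" using c(1) s0 by (auto simp: c'_def)
    ultimately show ?thesis by (intro exI[of _ c']) blast
  qed
qed

text \<open>The rank is a supremum of natural numbers, which is meaningful only when the sizes of the independent
sets are bounded; an element of infinite order is an independent set of size one.\<close>

lemma group_rank_eq_0_iff:
  assumes "comm_group Q" and bound: "\<And>S. int_independent Q S \<Longrightarrow> card S \<le> N"
  shows "group_rank Q = 0 \<longleftrightarrow> torsion_elements Q = carrier Q"
proof -
  interpret comm_group Q by fact
  have empty: "int_independent Q {}" by (simp add: int_independent_def)
  have fin: "finite (card ` {S. int_independent Q S})"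
    by (rule finite_subset[of _ "{..N}"]) (use bound in auto)
  have rank: "group_rank Q = Max (card ` {S. int_independent Q S})"
    unfolding group_rank_def using empty by (auto simp: Sup_nat_def)
  have "group_rank Q = 0 \<longleftrightarrow> (\<forall>S. int_independent Q S \<longrightarrow> S = {})"
  proof
    assume "group_rank Q = 0"
    then have "card S = 0" if "int_independent Q S" for S
      using Max_ge[OF fin, of "card S"] that rank by auto
    then show "\<forall>S. int_independent Q S \<longrightarrow> S = {}" by (auto simp: int_independent_def)
  next
    assume "\<forall>S. int_independent Q S \<longrightarrow> S = {}"
    then have "{S. int_independent Q S} = {{}}" using empty by auto
    then show "group_rank Q = 0" by (simp add: rank)
  qed
  also have "\<dots> \<longleftrightarrow> torsion_elements Q = carrier Q"
  proof
    assume *: "\<forall>S. int_independent Q S \<longrightarrow> S = {}"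
    show "torsion_elements Q = carrier Q"
    proof
      show "carrier Q \<subseteq> torsion_elements Q"
      proof
        fix g assume g: "g \<in> carrier Q"
        have "\<not> int_independent Q {g}" using * by auto
        then obtain c :: "'a \<Rightarrow> int" where "finprod Q (\<lambda>s. s [^]\<^bsub>Q\<^esub> c s) {g} = \<one>\<^bsub>Q\<^esub>" "c g \<noteq> 0"
          using g by (auto simp: int_independent_def)
        then have c: "g [^]\<^bsub>Q\<^esub> c g = \<one>\<^bsub>Q\<^esub>" "c g \<noteq> 0" using g by auto
        have "g [^]\<^bsub>Q\<^esub> int (nat \<bar>c g\<bar>) = \<one>\<^bsub>Q\<^esub>"
          using c g int_pow_neg[OF g, of "c g"] by (cases "c g \<ge> 0") simp_all
        then have "g [^]\<^bsub>Q\<^esub> nat \<bar>c g\<bar> = \<one>\<^bsub>Q\<^esub>" by (simp only: int_pow_int)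
        moreover have "nat \<bar>c g\<bar> > 0" using c(2) by simp
        ultimately show "g \<in> torsion_elements Q" using g unfolding torsion_elements_def by blast
      qed
    qed (auto simp: torsion_elements_def)
  next
    assume *: "torsion_elements Q = carrier Q"
    show "\<forall>S. int_independent Q S \<longrightarrow> S = {}"
    proof (intro allI impI, rule ccontr)
      fix S assume S: "int_independent Q S" "S \<noteq> {}"
      then obtain s where s: "s \<in> S" "s \<in> carrier Q" by (auto simp: int_independent_def)
      then obtain m :: nat where m: "m > 0" "s [^]\<^bsub>Q\<^esub> m = \<one>\<^bsub>Q\<^esub>"
        using * by (auto simp: torsion_elements_def)
      define c where "c t = (if t = s then int m else 0)" for t
      have "finprod Q (\<lambda>t. t [^]\<^bsub>Q\<^esub> c t) S = \<one>\<^bsub>Q\<^esub>"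
        using m(2) by (intro finprod_one_eqI) (auto simp: c_def int_pow_int)
      then have "c s = 0" using S(1) s(1) by (auto simp: int_independent_def)
      then show False using m(1) by (simp add: c_def)
    qed
  qed
  finally show ?thesis .
qed

text \<open>The common shape of all homology groups below: a subgroup \<open>Z\<close> of a finitely generated free abelian
group, modulo a subgroup \<open>H\<close>.\<close>

locale chain_quotient =
  fixes X :: "'a set" and Z H :: "('a \<Rightarrow>\<^sub>0 int) set"
  assumes finite_X: "finite X"
    and subgroup_Z: "subgroup Z (free_Abelian_group X)"
    and subgroup_H: "subgroup H (free_Abelian_group X)"
    and H_sub: "H \<subseteq> Z"
begin

abbreviation G where "G \<equiv> subgroup_generated (free_Abelian_group X) Z"
abbreviation Q where "Q \<equiv> G Mod H"
abbreviation cls where "cls \<equiv> r_coset G H"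

lemma carrier_G [simp]: "carrier G = Z"
  using subgroup.carrier_subgroup_generated_subgroup[OF subgroup_Z] .

lemma mult_G [simp]: "x \<otimes>\<^bsub>G\<^esub> y = x + y"
  by (simp add: subgroup_generated_def)

lemma one_G [simp]: "\<one>\<^bsub>G\<^esub> = 0"
  by (simp add: subgroup_generated_def)

lemma keys_Z: "z \<in> Z \<Longrightarrow> Poly_Mapping.keys z \<subseteq> X"
  using subgroup.mem_carrier[OF subgroup_Z, of z] by simp

lemma Z_closed: "0 \<in> Z" "x \<in> Z \<Longrightarrow> y \<in> Z \<Longrightarrow> x + y \<in> Z" "x \<in> Z \<Longrightarrow> - x \<in> Z"
  using subgroup.one_closed[OF subgroup_Z] subgroup.m_closed[OF subgroup_Z, of x y]
    subgroup.m_inv_closed[OF subgroup_Z, of x] keys_Z[of x] by auto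

lemma H_closed: "0 \<in> H" "x \<in> H \<Longrightarrow> y \<in> H \<Longrightarrow> x + y \<in> H" "x \<in> H \<Longrightarrow> - x \<in> H"
  using subgroup.one_closed[OF subgroup_H] subgroup.m_closed[OF subgroup_H, of x y]
    subgroup.m_inv_closed[OF subgroup_H, of x] keys_Z[of x] H_sub by auto

lemma Z_cmul: "x \<in> Z \<Longrightarrow> frag_cmul k x \<in> Z"
  by (rule frag_closure_minus_cmul[where P="\<lambda>x. x \<in> Z"])
    (use Z_closed in \<open>metis diff_conv_add_uminus\<close>)+

lemma Z_sum: "(\<And>i. i \<in> I \<Longrightarrow> f i \<in> Z) \<Longrightarrow> sum f I \<in> Z"
  by (induction I rule: infinite_finite_induct) (auto intro: Z_closed)

lemma comm_group_G: "comm_group G"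
  by (intro group.abelian_subgroup_generated abelian_free_Abelian_group group_free_Abelian_group)

lemma normal_H: "H \<lhd> G"
proof -
  interpret comm_group G by (rule comm_group_G)
  have "subgroup H G"
    using subgroup_H H_sub group.subgroup_subgroup_generated_iff[OF group_free_Abelian_group]
    by (metis carrier_G)
  then show ?thesis by (rule subgroup_imp_normal)
qed

lemma comm_group_Q: "comm_group Q"
  using comm_group.abelian_FactGroup[OF comm_group_G] normal_H normal_imp_subgroup by blast

lemma carrier_Q: "carrier Q = cls ` Z"
  by (simp add: carrier_FactGroup)

lemma cls_eq: "cls z = (\<lambda>h. h + z) ` H"
  by (auto simp: r_coset_def)

lemma cls_eq_iff: "cls z = cls z' \<longleftrightarrow> z - z' \<in> H"
proof
  assume "cls z = cls z'"
  moreover have "z \<in> cls z" using H_closed(1) by (force simp: cls_eq)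
  ultimately show "z - z' \<in> H" by (auto simp: cls_eq)
next
  assume *: "z - z' \<in> H"
  have "h + z = (h + (z - z')) + z'" "h + z' = (h + - (z - z')) + z" for h by auto
  then show "cls z = cls z'" unfolding cls_eq using * H_closed by blast
qed

lemma cls_one_iff: "cls z = \<one>\<^bsub>Q\<^esub> \<longleftrightarrow> z \<in> H"
  using cls_eq_iff[of z 0] by (simp add: cls_eq)

lemma cls_hom: "cls \<in> hom G Q"
  using normal.r_coset_hom_Mod[OF normal_H] .

lemma cls_add: "x \<in> Z \<Longrightarrow> y \<in> Z \<Longrightarrow> cls x \<otimes>\<^bsub>Q\<^esub> cls y = cls (x + y)"
  using hom_mult[OF cls_hom, of x y] by simp

lemma cls_pow_nat: "x \<in> Z \<Longrightarrow> cls x [^]\<^bsub>Q\<^esub> (n::nat) = cls (frag_cmul (int n) x)"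
proof (induction n)
  case 0
  then show ?case using cls_eq[of 0] by simp
next
  case (Suc n)
  then show ?case
    by (simp only: nat_pow_Suc Suc.IH cls_add Z_cmul)
      (simp add: frag_cmul_distrib add.commute del: mult_FactGroup)
qed

lemma cls_pow: "x \<in> Z \<Longrightarrow> cls x [^]\<^bsub>Q\<^esub> (k::int) = cls (frag_cmul k x)"
proof (cases k)
  case (nonneg n)
  then show "x \<in> Z \<Longrightarrow> ?thesis" using cls_pow_nat[of x n] by (simp only: int_pow_int)
next
  case (neg n)
  interpret Q: comm_group Q by (rule comm_group_Q)
  assume x: "x \<in> Z"
  then have c: "cls x \<in> carrier Q" by (simp add: carrier_Q)
  have "cls (frag_cmul (- int (Suc n)) x) = inv\<^bsub>Q\<^esub> (cls (frag_cmul (int (Suc n)) x))"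
  proof (rule Q.inv_equality[symmetric])
    show "cls (frag_cmul (- int (Suc n)) x) \<otimes>\<^bsub>Q\<^esub> cls (frag_cmul (int (Suc n)) x) = \<one>\<^bsub>Q\<^esub>"
      using x H_closed(1) by (simp only: cls_add Z_cmul cls_one_iff flip: frag_cmul_distrib) simp
  qed (use x in \<open>auto simp: carrier_Q Z_cmul\<close>)
  then show ?thesis
    unfolding neg using Q.int_pow_neg[OF c, of "int (Suc n)"] cls_pow_nat[OF x, of "Suc n"]
    by (simp only: int_pow_int)
qed

lemma cls_finprod:
  assumes "finite I" "\<And>i. i \<in> I \<Longrightarrow> f i \<in> Z"
  shows "finprod Q (\<lambda>i. cls (f i)) I = cls (sum f I)"
proof -
  interpret Q: comm_group Q by (rule comm_group_Q)
  from assms show ?thesis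
  proof (induction I rule: finite_induct)
    case empty
    then show ?case using H_closed(1) cls_one_iff[of 0] by simp
  next
    case (insert i I)
    then have "(\<lambda>i. cls (f i)) \<in> I \<rightarrow> carrier Q" "cls (f i) \<in> carrier Q" by (auto simp: carrier_Q)
    then show ?case using insert cls_add[of "f i" "sum f I"] Z_sum[of I f]
      by (simp del: mult_FactGroup)
  qed
qed

text \<open>Representatives of more than \<open>card X\<close> classes satisfy a nontrivial integer relation in the free
group, and the relation descends to the quotient.\<close>

lemma card_int_independent_le:
  assumes "int_independent Q S"
  shows "card S \<le> card X"
proof (rule ccontr)
  interpret Q: comm_group Q by (rule comm_group_Q)
  assume "\<not> card S \<le> card X"
  then have "card X < card S" by simp
  have S: "finite S" "S \<subseteq> cls ` Z" using assms by (auto simp: int_independent_def carrier_Q)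
  have "\<forall>s\<in>S. \<exists>z. z \<in> Z \<and> s = cls z" using S(2) by blast
  from bchoice[OF this] obtain r where r: "\<And>s. s \<in> S \<Longrightarrow> r s \<in> Z \<and> s = cls (r s)"
    by blast
  from overdetermined_int_solution[OF finite_X S(1) \<open>card X < card S\<close>, of "\<lambda>s. Poly_Mapping.lookup (r s)"]
  obtain c where c: "\<exists>s\<in>S. c s \<noteq> 0" "\<forall>x\<in>X. (\<Sum>s\<in>S. c s * Poly_Mapping.lookup (r s) x) = 0" by blast
  have "(\<Sum>s\<in>S. frag_cmul (c s) (r s)) = 0"
  proof (rule poly_mapping_eqI)
    fix x
    have "(\<Sum>s\<in>S. c s * Poly_Mapping.lookup (r s) x) = 0"
    proof (cases "x \<in> X")
      case False
      then have "s \<in> S \<Longrightarrow> Poly_Mapping.lookup (r s) x = 0" for s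
        using r[of s] keys_Z[of "r s"] by (auto simp: in_keys_iff)
      then show ?thesis by simp
    qed (use c in auto)
    then show "Poly_Mapping.lookup (\<Sum>s\<in>S. frag_cmul (c s) (r s)) x = Poly_Mapping.lookup 0 x" by (simp add: lookup_sum)
  qed
  moreover have "finprod Q (\<lambda>s. s [^]\<^bsub>Q\<^esub> c s) S = finprod Q (\<lambda>s. cls (frag_cmul (c s) (r s))) S"
    using r by (intro Q.finprod_cong') (auto simp: carrier_Q Z_cmul simp flip: cls_pow)
  ultimately have "finprod Q (\<lambda>s. s [^]\<^bsub>Q\<^esub> c s) S = \<one>\<^bsub>Q\<^esub>"
    using cls_finprod[OF S(1), of "\<lambda>s. frag_cmul (c s) (r s)"] r Z_cmul cls_one_iff[of 0] H_closed(1)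
    by simp
  then show False using assms c(1) by (auto simp: int_independent_def)
qed

lemma cls_in_torsion_elements_iff:
  assumes "z \<in> Z"
  shows "cls z \<in> torsion_elements Q \<longleftrightarrow> (\<exists>k::nat. k > 0 \<and> frag_cmul (int k) z \<in> H)"
proof -
  have "cls z \<in> carrier Q" using assms by (simp add: carrier_Q)
  then show ?thesis
    unfolding torsion_elements_def mem_Collect_eq cls_pow_nat[OF assms] cls_one_iff by blast
qed

lemma group_rank_Q_eq_0_iff:
  "group_rank Q = 0 \<longleftrightarrow> (\<forall>z\<in>Z. \<exists>k::nat. k > 0 \<and> frag_cmul (int k) z \<in> H)"
proof -
  have "torsion_elements Q \<subseteq> carrier Q" unfolding torsion_elements_def by blast
  then have "torsion_elements Q = carrier Q \<longleftrightarrow> (\<forall>z\<in>Z. cls z \<in> torsion_elements Q)"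
    unfolding carrier_Q by blast
  then show ?thesis
    using group_rank_eq_0_iff[OF comm_group_Q card_int_independent_le] cls_in_torsion_elements_iff
    by simp
qed

lemma card_carrier_Q:
  assumes R: "R \<subseteq> Z" and ex1: "\<And>z. z \<in> Z \<Longrightarrow> \<exists>!r. r \<in> R \<and> z - r \<in> H"
  shows "card (carrier Q) = card R"
proof -
  have "bij_betw cls R (carrier Q)"
  proof (rule bij_betwI')
    show "cls x = cls y \<longleftrightarrow> x = y" if "x \<in> R" "y \<in> R" for x y
    proof
      assume "cls x = cls y"
      then have "x - y \<in> H" by (simp only: cls_eq_iff)
      moreover have "x - x \<in> H" using H_closed(1) by simp
      ultimately show "x = y" using ex1[of x] that R by blast
    qed simp
    show "cls x \<in> carrier Q" if "x \<in> R" for x using that R by (auto simp: carrier_Q)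
    fix y assume "y \<in> carrier Q"
    then obtain z where z: "z \<in> Z" "y = cls z" unfolding carrier_Q by (rule imageE)
    from ex1_implies_ex[OF ex1[OF z(1)]] obtain r where "r \<in> R" "z - r \<in> H" by (elim exE conjE)
    then show "\<exists>x\<in>R. y = cls x" using cls_eq_iff[of z r] z(2) by (intro bexI[of _ r]) simp_all
  qed
  then show ?thesis using bij_betw_same_card by fastforce
qed

end

section \<open>Boundary maps and reduced homology\<close>

definition incidence :: "'v::linorder set \<Rightarrow> 'v set \<Rightarrow> int" where
  "incidence \<rho> \<sigma> = (\<Sum>v\<in>\<sigma>. if \<sigma> - {v} = \<rho> then (-1) ^ card {u \<in> \<sigma>. u < v} else 0)"

lemma incidence_remove:
  assumes "finite \<sigma>" "v \<in> \<sigma>"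
  shows "incidence (\<sigma> - {v}) \<sigma> = (-1) ^ card {u \<in> \<sigma>. u < v}"
proof -
  have "incidence (\<sigma> - {v}) \<sigma> = (\<Sum>w\<in>\<sigma>. if w = v then (-1) ^ card {u \<in> \<sigma>. u < v} else 0)"
    unfolding incidence_def by (rule sum.cong) (use assms in auto)
  then show ?thesis using assms by simp
qed

lemma incidence_nonzeroE:
  assumes "incidence \<rho> \<sigma> \<noteq> 0"
  obtains v where "v \<in> \<sigma>" "\<rho> = \<sigma> - {v}"
proof -
  obtain v where "v \<in> \<sigma>" "(if \<sigma> - {v} = \<rho> then (-1) ^ card {u \<in> \<sigma>. u < v} else 0) \<noteq> (0::int)"
    using assms unfolding incidence_def by (rule sum.not_neutral_contains_not_neutral)
  then show thesis using that[of v] by (simp split: if_splits)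
qed

lemma boundary_zero [simp]: "boundary 0 = 0"
  by (simp add: boundary_def)

lemma boundary_add: "boundary (a + b) = boundary a + boundary b"
  by (simp add: boundary_def frag_extend_add)

lemma boundary_minus: "boundary (- a) = - boundary a"
  by (simp add: boundary_def frag_extend_minus)

lemma boundary_diff: "boundary (a - b) = boundary a - boundary b"
  by (simp add: boundary_def frag_extend_diff)

lemma boundary_cmul: "boundary (frag_cmul k a) = frag_cmul k (boundary a)"
  by (simp add: boundary_def frag_extend_cmul)

lemma boundary_sum: "boundary (sum f I) = (\<Sum>i\<in>I. boundary (f i))"
  by (induction I rule: infinite_finite_induct) (simp_all add: boundary_add)

lemma lookup_boundary_frag_of:
  "Poly_Mapping.lookup (boundary (frag_of \<sigma>)) \<rho> = incidence \<rho> \<sigma>"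
  unfolding boundary_def incidence_def frag_extend_of lookup_sum
  by (rule sum.cong) auto

lemma lookup_boundary:
  assumes "finite X" "Poly_Mapping.keys c \<subseteq> X"
  shows "Poly_Mapping.lookup (boundary c) \<rho> = (\<Sum>\<sigma>\<in>X. Poly_Mapping.lookup c \<sigma> * incidence \<rho> \<sigma>)"
proof -
  have "c = (\<Sum>\<sigma>\<in>Poly_Mapping.keys c. frag_cmul (Poly_Mapping.lookup c \<sigma>) (frag_of \<sigma>))"
    using frag_expansion[of c] by (simp add: frag_extend_def)
  then have "boundary c = (\<Sum>\<sigma>\<in>Poly_Mapping.keys c. frag_cmul (Poly_Mapping.lookup c \<sigma>) (boundary (frag_of \<sigma>)))"
    by (metis (no_types, lifting) boundary_cmul boundary_sum sum.cong)
  then have "Poly_Mapping.lookup (boundary c) \<rho> =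
      (\<Sum>\<sigma>\<in>Poly_Mapping.keys c. Poly_Mapping.lookup c \<sigma> * incidence \<rho> \<sigma>)"
    by (simp add: lookup_sum lookup_boundary_frag_of)
  also have "\<dots> = (\<Sum>\<sigma>\<in>X. Poly_Mapping.lookup c \<sigma> * incidence \<rho> \<sigma>)"
    by (rule sum.mono_neutral_left) (use assms in \<open>auto simp: in_keys_iff\<close>)
  finally show ?thesis .
qed

text \<open>The coefficient of a face is a sum over ordered pairs \<open>(v, u)\<close> of removed vertices, and
exchanging \<open>v\<close> and \<open>u\<close> changes the sign of the summand: the removal of the smaller vertex first
shifts the position of the larger one by one.\<close>

lemma boundary_boundary_frag_of:
  assumes fin: "finite \<sigma>"
  shows "boundary (boundary (frag_of \<sigma>)) = 0"
proof (rule poly_mapping_eqI)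
  fix \<pi>
  define s where "s v \<tau> = (-1 :: int) ^ card {u \<in> \<tau>. u < v}" for v :: 'a and \<tau>
  \<comment> \<open>The contribution of removing first \<open>v\<close> and then \<open>u\<close>.\<close>
  define h where "h v u = (if \<sigma> - {v} - {u} = \<pi> then s v \<sigma> * s u (\<sigma> - {v}) else 0)" for v u
  have anti_less: "h v u = - h u v" if uv: "u \<in> \<sigma>" "v \<in> \<sigma>" "u < v" for u v
  proof -
    have "{w \<in> \<sigma>. w < v} = insert u {w \<in> \<sigma> - {u}. w < v}" using uv by auto
    then have "s v \<sigma> = - s v (\<sigma> - {u})"
      using fin by (simp add: s_def)
    moreover have "{w \<in> \<sigma> - {v}. w < u} = {w \<in> \<sigma>. w < u}" using uv by auto
    then have "s u (\<sigma> - {v}) = s u \<sigma>" by (simp add: s_def)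
    moreover have "\<sigma> - {v} - {u} = \<sigma> - {u} - {v}" by auto
    ultimately show ?thesis by (simp add: h_def)
  qed
  have anti: "h v u = - h u v" if "u \<in> \<sigma>" "v \<in> \<sigma>" "u \<noteq> v" for u v
    using anti_less[of u v] anti_less[of v u] that by (cases "u < v") auto
  have "Poly_Mapping.lookup (boundary (boundary (frag_of \<sigma>))) \<pi> = (\<Sum>v\<in>\<sigma>. s v \<sigma> * incidence \<pi> (\<sigma> - {v}))"
  proof -
    have "boundary (boundary (frag_of \<sigma>)) = (\<Sum>v\<in>\<sigma>. frag_cmul (s v \<sigma>) (boundary (frag_of (\<sigma> - {v}))))"
      by (subst (2) boundary_def) (simp add: boundary_sum boundary_cmul s_def)
    then show ?thesis by (simp add: lookup_sum lookup_boundary_frag_of)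
  qed
  also have "\<dots> = (\<Sum>v\<in>\<sigma>. \<Sum>u\<in>\<sigma> - {v}. h v u)"
    unfolding incidence_def sum_distrib_left by (intro sum.cong refl) (auto simp: h_def s_def)
  also have "\<dots> = (\<Sum>v\<in>\<sigma>. \<Sum>u\<in>\<sigma>. if u = v then 0 else h v u)"
    using fin by (intro sum.cong refl sum.mono_neutral_cong_left) auto
  finally have *: "Poly_Mapping.lookup (boundary (boundary (frag_of \<sigma>))) \<pi> =
      (\<Sum>v\<in>\<sigma>. \<Sum>u\<in>\<sigma>. if u = v then 0 else h v u)" .
  also have "\<dots> = (\<Sum>u\<in>\<sigma>. \<Sum>v\<in>\<sigma>. if u = v then 0 else h v u)" by (rule sum.swap)
  also have "\<dots> = - (\<Sum>u\<in>\<sigma>. \<Sum>v\<in>\<sigma>. if v = u then 0 else h u v)"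
    unfolding sum_negf[symmetric]
  proof (intro sum.cong refl)
    fix u v assume "u \<in> \<sigma>" "v \<in> \<sigma>"
    then show "(if u = v then 0 else h v u) = - (if v = u then 0 else h u v)"
      by (cases "u = v") (simp_all add: anti[of u v])
  qed
  finally show "Poly_Mapping.lookup (boundary (boundary (frag_of \<sigma>))) \<pi> = Poly_Mapping.lookup 0 \<pi>"
    using * by simp
qed

lemma boundary_boundary:
  assumes "\<And>\<sigma>. \<sigma> \<in> Poly_Mapping.keys c \<Longrightarrow> finite \<sigma>"
  shows "boundary (boundary c) = 0"
proof -
  have "Poly_Mapping.keys c \<subseteq> Collect finite" using assms by auto
  then show ?thesis
    by (induction c rule: frag_induction) (auto simp: boundary_boundary_frag_of boundary_diff)
qed

lemma finite_faces: "finite K \<Longrightarrow> finite (faces K i)"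
  by (simp add: faces_def)

lemma keys_boundary_subset:
  assumes "simplicial_complex K" "Poly_Mapping.keys c \<subseteq> faces K (i + 1)"
  shows "Poly_Mapping.keys (boundary c) \<subseteq> faces K i"
proof
  fix \<rho> assume "\<rho> \<in> Poly_Mapping.keys (boundary c)"
  then have "(\<Sum>\<sigma>\<in>Poly_Mapping.keys c. Poly_Mapping.lookup c \<sigma> * incidence \<rho> \<sigma>) \<noteq> 0"
    using lookup_boundary[of "Poly_Mapping.keys c" c] by (simp add: in_keys_iff)
  then obtain \<sigma> where "\<sigma> \<in> Poly_Mapping.keys c" "Poly_Mapping.lookup c \<sigma> * incidence \<rho> \<sigma> \<noteq> 0"
    by (rule sum.not_neutral_contains_not_neutral)
  then have \<sigma>: "\<sigma> \<in> Poly_Mapping.keys c" "incidence \<rho> \<sigma> \<noteq> 0" by simp_all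
  then obtain v where v: "v \<in> \<sigma>" "\<rho> = \<sigma> - {v}" by (elim incidence_nonzeroE)
  have "\<sigma> \<in> K" "face_dim \<sigma> = i + 1" using \<sigma>(1) assms(2) by (auto simp: faces_def)
  moreover from this have "finite \<sigma>" using assms(1) by (auto simp: simplicial_complex_def)
  ultimately show "\<rho> \<in> faces K i"
    using v assms(1) card_Suc_Diff1[of \<sigma> v] unfolding faces_def face_dim_def simplicial_complex_def
    by (simp add: card_Diff_singleton) 
qed

lemma cycles_subgroup: "subgroup (cycles K i) (free_Abelian_group (faces K i))"
proof
  show "cycles K i \<subseteq> carrier (free_Abelian_group (faces K i))"
    by (auto simp: cycles_def chain_group_def)
  fix x y assume "x \<in> cycles K i" "y \<in> cycles K i"
  then show "x \<otimes>\<^bsub>free_Abelian_group (faces K i)\<^esub> y \<in> cycles K i"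
    using keys_add[of x y] by (auto simp: cycles_def chain_group_def boundary_add)
next
  fix x assume "x \<in> cycles K i"
  then show "inv\<^bsub>free_Abelian_group (faces K i)\<^esub> x \<in> cycles K i"
    by (auto simp: cycles_def chain_group_def boundary_minus)
qed (auto simp: cycles_def chain_group_def)

lemma boundaries_eq: "boundaries K i = boundary ` {c. Poly_Mapping.keys c \<subseteq> faces K (i + 1)}"
  by (auto simp: boundaries_def chain_group_def)

lemma boundaries_subset_cycles:
  assumes "simplicial_complex K"
  shows "boundaries K i \<subseteq> cycles K i"
proof
  fix z assume "z \<in> boundaries K i"
  then obtain c where c: "Poly_Mapping.keys c \<subseteq> faces K (i + 1)" "z = boundary c"
    by (auto simp: boundaries_eq)
  then have "boundary z = 0"
    using assms by (auto intro!: boundary_boundary simp: faces_def simplicial_complex_def)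
  then show "z \<in> cycles K i"
    using keys_boundary_subset[OF assms c(1)] c(2) by (auto simp: cycles_def chain_group_def)
qed

lemma boundaries_subgroup:
  assumes "simplicial_complex K"
  shows "subgroup (boundaries K i) (free_Abelian_group (faces K i))"
proof
  show sub: "boundaries K i \<subseteq> carrier (free_Abelian_group (faces K i))"
    using boundaries_subset_cycles[OF assms, of i] subgroup.subset[OF cycles_subgroup, of K i] by blast
  fix x y assume "x \<in> boundaries K i" "y \<in> boundaries K i"
  then obtain a b where "Poly_Mapping.keys a \<subseteq> faces K (i + 1)" "x = boundary a"
      "Poly_Mapping.keys b \<subseteq> faces K (i + 1)" "y = boundary b"
    by (auto simp: boundaries_eq)
  then have "Poly_Mapping.keys (a + b) \<subseteq> faces K (i + 1)" "x + y = boundary (a + b)"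
    using keys_add[of a b] by (auto simp: boundary_add)
  then show "x \<otimes>\<^bsub>free_Abelian_group (faces K i)\<^esub> y \<in> boundaries K i"
    by (auto simp: boundaries_eq)
next
  show "\<one>\<^bsub>free_Abelian_group (faces K i)\<^esub> \<in> boundaries K i"
    by (auto simp: boundaries_eq intro!: image_eqI[of _ _ 0])
next
  fix x assume x: "x \<in> boundaries K i"
  then have "inv\<^bsub>free_Abelian_group (faces K i)\<^esub> x = - x"
    using boundaries_subset_cycles[OF assms, of i] by (auto simp: cycles_def chain_group_def)
  moreover obtain c where "Poly_Mapping.keys c \<subseteq> faces K (i + 1)" "x = boundary c"
    using x by (auto simp: boundaries_eq)
  then have "- x \<in> boundaries K i"
    by (auto simp: boundaries_eq simp flip: boundary_minus)
  ultimately show "inv\<^bsub>free_Abelian_group (faces K i)\<^esub> x \<in> boundaries K i" by simp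
qed

lemma chain_quotient_homology:
  assumes "simplicial_complex K" "finite K"
  shows "chain_quotient (faces K i) (cycles K i) (boundaries K i)"
  using finite_faces[OF assms(2)] cycles_subgroup boundaries_subgroup[OF assms(1)]
    boundaries_subset_cycles[OF assms(1)] by (rule chain_quotient.intro)

section \<open>Tree numbers as sums of squared minors\<close>

lemma faces_eq_of_skeleton_eq:
  assumes "skeleton \<Upsilon> i = skeleton K i"
  shows "faces \<Upsilon> i = faces K i"
proof -
  have "faces L i = {\<sigma> \<in> skeleton L i. face_dim \<sigma> = i}" for L :: "'a set set"
    by (auto simp: faces_def skeleton_def)
  then show ?thesis using assms by simp
qed

lemma frag_expand_bij:
  fixes m :: nat
  assumes "bij_betw g {0..<m} T" "Poly_Mapping.keys c \<subseteq> T"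
  shows "c = (\<Sum>j = 0..<m. frag_cmul (Poly_Mapping.lookup c (g j)) (frag_of (g j)))"
proof -
  have T: "finite T" using bij_betw_finite[OF assms(1)] by simp
  have "c = (\<Sum>\<sigma>\<in>Poly_Mapping.keys c. frag_cmul (Poly_Mapping.lookup c \<sigma>) (frag_of \<sigma>))"
    using frag_expansion[of c] by (simp add: frag_extend_def)
  also have "\<dots> = (\<Sum>\<sigma>\<in>T. frag_cmul (Poly_Mapping.lookup c \<sigma>) (frag_of \<sigma>))"
    by (rule sum.mono_neutral_left) (use assms(2) T in \<open>auto simp: in_keys_iff\<close>)
  also have "\<dots> = (\<Sum>j = 0..<m. frag_cmul (Poly_Mapping.lookup c (g j)) (frag_of (g j)))"
    by (rule sum.reindex_bij_betw[OF assms(1), symmetric])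
  finally show ?thesis .
qed

lemma det_nonzero_iff_trivial_kernel:
  fixes A :: "int mat"
  assumes "A \<in> carrier_mat m m"
  shows "det A \<noteq> 0 \<longleftrightarrow> (\<forall>v\<in>carrier_vec m. A *\<^sub>v v = 0\<^sub>v m \<longrightarrow> v = 0\<^sub>v m)"
  using det_0_iff_vec_prod_zero[OF assms] by blast

text \<open>The faces \<open>e 0, \<dots>, e (m-1)\<close> give coordinates on the \<open>(d-1)\<close>-cycles: a cycle is
determined by its coefficients there, and the boundaries of the \<open>d\<close>-faces \<open>b 0, \<dots>, b (m-1)\<close> have a
unimodular coordinate matrix.  Together these say that the coordinates identify the
\<open>(d-1)\<close>-cycles with \<open>\<int>\<^sup>m\<close>, and that the \<open>b j\<close> form a spanning tree without torsion.\<close>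

locale cycle_coordinates =
  fixes K :: "'v::linorder set set" and d :: int and m :: nat and e b :: "nat \<Rightarrow> 'v set"
  assumes complex: "simplicial_complex K" and finite_K: "finite K"
    and d_nonneg: "d \<ge> 0" and m_pos: "m > 0"
    and b_face: "\<And>j. j < m \<Longrightarrow> b j \<in> faces K d"
    and unimodular: "\<bar>det (mat m m (\<lambda>(i,j). incidence (e i) (b j)))\<bar> = 1"
    and coordinates_inj: "\<And>z. z \<in> cycles K (d - 1) \<Longrightarrow>
          (\<And>i. i < m \<Longrightarrow> Poly_Mapping.lookup z (e i) = 0) \<Longrightarrow> z = 0"
begin

definition coords :: "('v set \<Rightarrow>\<^sub>0 int) \<Rightarrow> int vec" where
  "coords z = vec m (\<lambda>i. Poly_Mapping.lookup z (e i))"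

definition minor :: "(nat \<Rightarrow> 'v set) \<Rightarrow> int mat" where
  "minor g = mat m m (\<lambda>(i,j). incidence (e i) (g j))"

definition chain :: "(nat \<Rightarrow> 'v set) \<Rightarrow> int vec \<Rightarrow> 'v set \<Rightarrow>\<^sub>0 int" where
  "chain g w = (\<Sum>j = 0..<m. frag_cmul (w $ j) (frag_of (g j)))"

lemma coords_carrier [simp]: "coords z \<in> carrier_vec m"
  by (simp add: coords_def)

lemma minor_carrier [simp]: "minor g \<in> carrier_mat m m"
  by (simp add: minor_def)

lemma dim_minor [simp]: "dim_row (minor g) = m" "dim_col (minor g) = m"
  by (simp_all add: minor_def)

lemma minor_mult_adj:
  assumes "v \<in> carrier_vec m"
  shows "minor g *\<^sub>v (adj_mat (minor g) *\<^sub>v v) = det (minor g) \<cdot>\<^sub>v v"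
proof -
  note adj = adj_mat[OF minor_carrier, of g]
  have "minor g *\<^sub>v (adj_mat (minor g) *\<^sub>v v) = (minor g * adj_mat (minor g)) *\<^sub>v v"
    by (rule assoc_mult_mat_vec[OF minor_carrier adj(1) assms, symmetric])
  then show ?thesis unfolding adj(2) using assms by (intro eq_vecI) auto
qed

lemma adj_carrier: "v \<in> carrier_vec m \<Longrightarrow> adj_mat (minor g) *\<^sub>v v \<in> carrier_vec m"
  by (rule mult_mat_vec_carrier[OF adj_mat(1)[OF minor_carrier]])

lemma coords_cmul: "coords (frag_cmul k z) = k \<cdot>\<^sub>v coords z"
  by (rule eq_vecI) (auto simp: coords_def)

lemma coords_diff: "coords (x - y) = coords x - coords y"
  by (rule eq_vecI) (auto simp: coords_def lookup_minus)

lemma coords_boundary_chain: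
  assumes "w \<in> carrier_vec m"
  shows "coords (boundary (chain g w)) = minor g *\<^sub>v w"
  using assms by (intro eq_vecI)
    (auto simp: coords_def minor_def chain_def boundary_sum boundary_cmul lookup_sum
      lookup_boundary_frag_of scalar_prod_def mult.commute intro!: sum.cong)

lemma keys_chain:
  assumes "\<And>j. j < m \<Longrightarrow> g j \<in> T"
  shows "Poly_Mapping.keys (chain g w) \<subseteq> T"
proof -
  have "Poly_Mapping.keys (chain g w) \<subseteq>
      (\<Union>j\<in>{0..<m}. Poly_Mapping.keys (frag_cmul (w $ j) (frag_of (g j))))"
    unfolding chain_def by (rule keys_sum)
  also have "\<dots> \<subseteq> T" using assms by (auto split: if_splits)
  finally show ?thesis .
qed

lemma chain_of_lookup:
  assumes "bij_betw g {0..<m} T" "Poly_Mapping.keys c \<subseteq> T"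
  shows "chain g (vec m (\<lambda>j. Poly_Mapping.lookup c (g j))) = c"
  using frag_expand_bij[OF assms] by (simp add: chain_def)

lemma lookup_chain:
  assumes "bij_betw g {0..<m} T" "j < m"
  shows "Poly_Mapping.lookup (chain g w) (g j) = w $ j"
proof -
  have "Poly_Mapping.lookup (chain g w) (g j) = (\<Sum>i = 0..<m. if i = j then w $ j else 0)"
    unfolding chain_def lookup_sum
    using assms by (intro sum.cong) (auto simp: bij_betw_def inj_on_def)
  then show ?thesis using assms(2) by simp
qed

lemma diff_in_cycles: "x \<in> cycles K i \<Longrightarrow> y \<in> cycles K i \<Longrightarrow> x - y \<in> cycles K i"
  using keys_diff[of x y] by (auto simp: cycles_def chain_group_def boundary_diff)

lemma coords_eqD:
  assumes "x \<in> cycles K (d - 1)" "y \<in> cycles K (d - 1)" "coords x = coords y"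
  shows "x = y"
proof -
  have "x - y = 0"
  proof (rule coordinates_inj)
    show "x - y \<in> cycles K (d - 1)" using assms(1,2) by (rule diff_in_cycles)
    fix i assume "i < m"
    then show "Poly_Mapping.lookup (x - y) (e i) = 0"
      using arg_cong[OF assms(3), of "\<lambda>v. v $ i"] by (simp add: coords_def lookup_minus)
  qed
  then show ?thesis by simp
qed

lemma boundary_in_cycles:
  assumes "Poly_Mapping.keys c \<subseteq> faces K d"
  shows "boundary c \<in> cycles K (d - 1)"
proof -
  have "boundary c \<in> boundaries K (d - 1)" using assms by (auto simp: boundaries_eq)
  then show ?thesis using boundaries_subset_cycles[OF complex] by blast
qed

text \<open>The adjugate matrix inverts the unimodular matrix of the faces \<open>b j\<close> over the integers.\<close>

lemma ex_boundary_coords: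
  assumes v: "v \<in> carrier_vec m"
  shows "\<exists>z\<in>boundaries K (d - 1). coords z = v"
proof -
  let ?A = "minor b"
  \<comment> \<open>As \<open>det A = \<plusminus>1\<close>, the matrix \<open>det A\<close> times the adjugate is the inverse of \<open>A\<close>.\<close>
  let ?w = "adj_mat ?A *\<^sub>v (det ?A \<cdot>\<^sub>v v)"
  have det: "det ?A * det ?A = 1"
    using unimodular by (simp add: minor_def abs_if split: if_splits)
  have w: "?w \<in> carrier_vec m" using v by (intro adj_carrier) simp
  have "?A *\<^sub>v ?w = det ?A \<cdot>\<^sub>v (det ?A \<cdot>\<^sub>v v)" using v by (intro minor_mult_adj) simp
  also have "\<dots> = v" using det by (simp add: smult_smult_assoc)
  finally have "coords (boundary (chain b ?w)) = v"
    using coords_boundary_chain[OF w] by simp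
  moreover have "Poly_Mapping.keys (chain b ?w) \<subseteq> faces K d"
    by (rule keys_chain) (rule b_face)
  then have "boundary (chain b ?w) \<in> boundaries K (d - 1)" by (auto simp: boundaries_eq)
  ultimately show ?thesis by blast
qed

lemma cycles_eq_boundaries: "cycles K (d - 1) = boundaries K (d - 1)"
proof
  show "cycles K (d - 1) \<subseteq> boundaries K (d - 1)"
  proof
    fix z assume z: "z \<in> cycles K (d - 1)"
    obtain y where y: "y \<in> boundaries K (d - 1)" "coords y = coords z"
      using ex_boundary_coords[OF coords_carrier, of z] by (elim bexE)
    have "y \<in> cycles K (d - 1)" using y(1) boundaries_subset_cycles[OF complex] by blast
    then have "y = z" using z y(2) by (rule coords_eqD)
    then show "z \<in> boundaries K (d - 1)" using y(1) by simp
  qed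
qed (rule boundaries_subset_cycles[OF complex])

lemma betti_K: "betti K (d - 1) = 0"
proof -
  interpret chain_quotient "faces K (d - 1)" "cycles K (d - 1)" "boundaries K (d - 1)"
    by (rule chain_quotient_homology[OF complex finite_K])
  have "\<exists>k::nat. k > 0 \<and> frag_cmul (int k) z \<in> boundaries K (d - 1)" if "z \<in> cycles K (d - 1)" for z
    using that cycles_eq_boundaries by (intro exI[of _ 1]) simp
  then show ?thesis
    unfolding betti_def reduced_homology_def chain_group_def using group_rank_Q_eq_0_iff by simp
qed

end

text \<open>The candidates for spanning trees.  Such a subcomplex has the same \<open>(d-1)\<close>-cycles as \<open>K\<close>, so only the
boundaries vary.\<close>

locale full_skeleton_subcomplex = cycle_coordinates +
  fixes \<Upsilon> :: "'a set set"
  assumes sub_complex: "simplicial_complex \<Upsilon>" and sub: "\<Upsilon> \<subseteq> K"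
    and dim: "\<And>\<sigma>. \<sigma> \<in> \<Upsilon> \<Longrightarrow> face_dim \<sigma> \<le> d"
    and skel: "skeleton \<Upsilon> (d - 1) = skeleton K (d - 1)"
begin

abbreviation T where "T \<equiv> faces \<Upsilon> d"

lemma T_sub: "T \<subseteq> faces K d"
  using sub by (auto simp: faces_def)

lemma finite_T: "finite T"
  using T_sub finite_faces[OF finite_K] by (rule finite_subset)

lemma cycles_sub: "cycles \<Upsilon> (d - 1) = cycles K (d - 1)"
  using faces_eq_of_skeleton_eq[OF skel] by (simp add: cycles_def chain_group_def)

lemma boundaries_sub: "boundaries \<Upsilon> (d - 1) = boundary ` {c. Poly_Mapping.keys c \<subseteq> T}"
  by (simp add: boundaries_eq)

sublocale H: chain_quotient "faces K (d - 1)" "cycles K (d - 1)" "boundaries \<Upsilon> (d - 1)"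
  using chain_quotient_homology[OF sub_complex finite_subset[OF sub finite_K], of "d - 1"]
  unfolding cycles_sub faces_eq_of_skeleton_eq[OF skel] .

lemma homology_sub: "reduced_homology \<Upsilon> (d - 1) = H.Q"
  by (simp add: reduced_homology_def chain_group_def cycles_sub faces_eq_of_skeleton_eq[OF skel])

lemma betti_codim_1_eq_0_iff:
  "betti \<Upsilon> (d - 1) = 0 \<longleftrightarrow>
    (\<forall>z\<in>cycles K (d - 1). \<exists>k::nat. k > 0 \<and> frag_cmul (int k) z \<in> boundaries \<Upsilon> (d - 1))"
  unfolding betti_def homology_sub by (rule H.group_rank_Q_eq_0_iff)

lemma betti_top_eq_0_iff:
  "betti \<Upsilon> d = 0 \<longleftrightarrow> (\<forall>c. Poly_Mapping.keys c \<subseteq> T \<and> boundary c = 0 \<longrightarrow> c = 0)"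
proof -
  interpret chain_quotient T "cycles \<Upsilon> d" "boundaries \<Upsilon> d"
    by (rule chain_quotient_homology[OF sub_complex finite_subset[OF sub finite_K]])
  have "faces \<Upsilon> (d + 1) = {}" using dim by (force simp: faces_def)
  then have B: "boundaries \<Upsilon> d = {0}" by (auto simp: boundaries_eq)
  have "(\<exists>k::nat. k > 0 \<and> frag_cmul (int k) z \<in> boundaries \<Upsilon> d) \<longleftrightarrow> z = 0" for z
    unfolding B by (auto intro: exI[of _ 1])
  then show ?thesis
    unfolding betti_def reduced_homology_def chain_group_def
    using group_rank_Q_eq_0_iff by (auto simp: cycles_def chain_group_def)
qed

lemma chain_injective_iff_det:
  assumes g: "bij_betw g {0..<m} T"
  shows "(\<forall>c. Poly_Mapping.keys c \<subseteq> T \<and> boundary c = 0 \<longrightarrow> c = 0) \<longleftrightarrow> det (minor g) \<noteq> 0"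
  unfolding det_nonzero_iff_trivial_kernel[OF minor_carrier]
proof (intro iffI ballI allI impI)
  fix v assume inj: "\<forall>c. Poly_Mapping.keys c \<subseteq> T \<and> boundary c = 0 \<longrightarrow> c = 0"
    and v: "v \<in> carrier_vec m" "minor g *\<^sub>v v = 0\<^sub>v m"
  have keys: "Poly_Mapping.keys (chain g v) \<subseteq> T"
    by (rule keys_chain) (use g in \<open>auto simp: bij_betw_def\<close>)
  then have "boundary (chain g v) \<in> cycles K (d - 1)"
    using T_sub by (intro boundary_in_cycles) blast
  then have "boundary (chain g v) = 0"
  proof (rule coordinates_inj)
    fix i assume "i < m"
    then show "Poly_Mapping.lookup (boundary (chain g v)) (e i) = 0"
      using arg_cong[OF coords_boundary_chain[OF v(1), of g], of "\<lambda>u. u $ i"] v(2)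
      by (simp add: coords_def)
  qed
  then have "chain g v = 0" using inj keys by blast
  then show "v = 0\<^sub>v m"
    using lookup_chain[OF g, of _ v] v(1) by (intro eq_vecI) auto
next
  fix c assume ker: "\<forall>v\<in>carrier_vec m. minor g *\<^sub>v v = 0\<^sub>v m \<longrightarrow> v = 0\<^sub>v m"
    and c: "Poly_Mapping.keys c \<subseteq> T \<and> boundary c = 0"
  define v where "v = vec m (\<lambda>j. Poly_Mapping.lookup c (g j))"
  have v: "v \<in> carrier_vec m" by (simp add: v_def)
  have chain: "chain g v = c" unfolding v_def using g c by (intro chain_of_lookup) auto
  have "minor g *\<^sub>v v = coords (boundary c)"
    using coords_boundary_chain[OF v, of g] chain by simp
  also have "\<dots> = 0\<^sub>v m" using c by (auto simp: coords_def)
  finally have "v = 0\<^sub>v m" using ker v by blast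
  then have "c = chain g (0\<^sub>v m)" using chain by simp
  also have "\<dots> = 0" by (auto simp: chain_def)
  finally show "c = 0" .
qed

lemma boundary_in_boundaries_iff:
  assumes g: "bij_betw g {0..<m} T" and z: "z \<in> cycles K (d - 1)"
  shows "z \<in> boundaries \<Upsilon> (d - 1) \<longleftrightarrow> coords z \<in> column_lattice (minor g)"
proof
  assume "z \<in> boundaries \<Upsilon> (d - 1)"
  then obtain c where c: "Poly_Mapping.keys c \<subseteq> T" "z = boundary c"
    by (auto simp: boundaries_sub)
  have "coords z = minor g *\<^sub>v vec m (\<lambda>j. Poly_Mapping.lookup c (g j))"
    using coords_boundary_chain[of "vec m (\<lambda>j. Poly_Mapping.lookup c (g j))" g]
      chain_of_lookup[OF g c(1)] c(2) by simp
  then show "coords z \<in> column_lattice (minor g)"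
    by (auto simp: column_lattice_def)
next
  assume "coords z \<in> column_lattice (minor g)"
  then obtain w where w: "w \<in> carrier_vec m" "coords z = minor g *\<^sub>v w"
    by (auto simp: column_lattice_def)
  have keys: "Poly_Mapping.keys (chain g w) \<subseteq> T"
    by (rule keys_chain) (use g in \<open>auto simp: bij_betw_def\<close>)
  then have "boundary (chain g w) \<in> cycles K (d - 1)"
    using T_sub by (intro boundary_in_cycles) blast
  then have "z = boundary (chain g w)"
    using w coords_boundary_chain[OF w(1), of g] by (intro coords_eqD[OF z]) auto
  then show "z \<in> boundaries \<Upsilon> (d - 1)" using keys by (auto simp: boundaries_sub)
qed

lemma minor_adj_column:
  assumes "v \<in> carrier_vec m"
  shows "det (minor g) \<cdot>\<^sub>v v \<in> column_lattice (minor g)"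
proof -
  have "adj_mat (minor g) *\<^sub>v v \<in> carrier_vec (dim_col (minor g))"
    using adj_carrier[OF assms] by simp
  then show ?thesis unfolding column_lattice_def minor_mult_adj[OF assms, symmetric] by (rule imageI)
qed

lemma betti_eq_0_of_det:
  assumes g: "bij_betw g {0..<m} T" and det: "det (minor g) \<noteq> 0"
  shows "betti \<Upsilon> (d - 1) = 0"
  unfolding betti_codim_1_eq_0_iff
proof
  fix z assume z: "z \<in> cycles K (d - 1)"
  have "frag_cmul (det (minor g)) z \<in> boundaries \<Upsilon> (d - 1)"
    using minor_adj_column[OF coords_carrier, of g z] H.Z_cmul[OF z]
    by (simp add: boundary_in_boundaries_iff[OF g] coords_cmul)
  then have "frag_cmul \<bar>det (minor g)\<bar> z \<in> boundaries \<Upsilon> (d - 1)"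
    using H.H_closed(3)[of "frag_cmul (det (minor g)) z"] by (simp add: abs_if)
  then show "\<exists>k::nat. k > 0 \<and> frag_cmul (int k) z \<in> boundaries \<Upsilon> (d - 1)"
    using det by (intro exI[of _ "nat \<bar>det (minor g)\<bar>"]) simp
qed

text \<open>With more than \<open>m\<close> facets the coordinates of their boundaries would be linearly dependent, giving a
nonzero \<open>d\<close>-cycle.  With fewer, multiples of the \<open>m\<close> unit cycles would be boundaries of linearly
dependent chains, which is impossible for independent cycles.\<close>

lemma card_T_of_betti:
  assumes inj: "\<And>c. Poly_Mapping.keys c \<subseteq> T \<Longrightarrow> boundary c = 0 \<Longrightarrow> c = 0"
    and torsion: "\<And>z. z \<in> cycles K (d - 1) \<Longrightarrow>
      \<exists>k::nat. k > 0 \<and> frag_cmul (int k) z \<in> boundaries \<Upsilon> (d - 1)"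
  shows "card T = m"
proof (rule antisym)
  show "card T \<le> m"
  proof (rule ccontr)
    assume "\<not> card T \<le> m"
    then have "card {0..<m} < card T" by simp
    from overdetermined_int_solution[OF _ finite_T this, of "\<lambda>\<tau> i. incidence (e i) \<tau>"]
    obtain a where a: "\<exists>\<tau>\<in>T. a \<tau> \<noteq> 0" "\<forall>i\<in>{0..<m}. (\<Sum>\<tau>\<in>T. a \<tau> * incidence (e i) \<tau>) = 0"
      by auto
    define c where "c = (\<Sum>\<tau>\<in>T. frag_cmul (a \<tau>) (frag_of \<tau>))"
    have c: "Poly_Mapping.lookup c \<tau> = (if \<tau> \<in> T then a \<tau> else 0)" for \<tau>
    proof -
      have "Poly_Mapping.lookup c \<tau> = (\<Sum>\<sigma>\<in>T. if \<tau> = \<sigma> then a \<sigma> else 0)"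
        unfolding c_def lookup_sum by (rule sum.cong) auto
      then show ?thesis using finite_T by simp
    qed
    have keys: "Poly_Mapping.keys c \<subseteq> T" by (auto simp: in_keys_iff c split: if_splits)
    then have "boundary c \<in> cycles K (d - 1)" using T_sub by (intro boundary_in_cycles) blast
    then have "boundary c = 0"
      by (rule coordinates_inj) (use a(2) in \<open>simp add: lookup_boundary[OF finite_T keys] c\<close>)
    then have "c = 0" using inj[OF keys] by simp
    then have "a \<tau> = 0" if "\<tau> \<in> T" for \<tau> using c[of \<tau>] that by simp
    then show False using a(1) by blast
  qed
  show "m \<le> card T"
  proof (rule ccontr)
    assume "\<not> m \<le> card T"
    then have less: "card T < card {0..<m}" by simp
    have "\<exists>z k c. z \<in> cycles K (d - 1) \<and> coords z = unit_vec m i \<and> k > (0::nat) \<and>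
        Poly_Mapping.keys c \<subseteq> T \<and> frag_cmul (int k) z = boundary c" for i
    proof -
      obtain z where z: "z \<in> boundaries K (d - 1)" "coords z = unit_vec m i"
        using ex_boundary_coords[of "unit_vec m i"] by auto
      then have zc: "z \<in> cycles K (d - 1)" by (simp add: cycles_eq_boundaries)
      then show ?thesis using torsion[OF zc] z(2) unfolding boundaries_sub by blast
    qed
    then obtain z k c where z: "\<And>i. z i \<in> cycles K (d - 1)" "\<And>i. coords (z i) = unit_vec m i"
      and k: "\<And>i. k i > (0::nat)" and c: "\<And>i. Poly_Mapping.keys (c i) \<subseteq> T"
      and zc: "\<And>i. frag_cmul (int (k i)) (z i) = boundary (c i)"
      by metis
    from overdetermined_int_solution[OF finite_T _ less, of "\<lambda>i. Poly_Mapping.lookup (c i)"]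
    obtain a where a: "\<exists>i\<in>{0..<m}. a i \<noteq> 0"
        "\<forall>\<tau>\<in>T. (\<Sum>i\<in>{0..<m}. a i * Poly_Mapping.lookup (c i) \<tau>) = 0"
      by auto
    have "(\<Sum>i\<in>{0..<m}. frag_cmul (a i) (c i)) = 0"
    proof (rule poly_mapping_eqI)
      fix \<tau>
      show "Poly_Mapping.lookup (\<Sum>i\<in>{0..<m}. frag_cmul (a i) (c i)) \<tau> = Poly_Mapping.lookup 0 \<tau>"
      proof (cases "\<tau> \<in> T")
        case False
        then have "Poly_Mapping.lookup (c i) \<tau> = 0" for i
          using c[of i] by (auto simp: in_keys_iff)
        then show ?thesis by (simp add: lookup_sum)
      qed (use a(2) in \<open>simp add: lookup_sum\<close>)
    qed
    then have "boundary (\<Sum>i\<in>{0..<m}. frag_cmul (a i) (c i)) = 0" by simp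
    then have sum0: "(\<Sum>i\<in>{0..<m}. frag_cmul (a i * int (k i)) (z i)) = 0"
      by (simp add: boundary_sum boundary_cmul zc[symmetric])
    obtain j where j: "j < m" "a j \<noteq> 0" using a(1) by auto
    have "Poly_Mapping.lookup (\<Sum>i\<in>{0..<m}. frag_cmul (a i * int (k i)) (z i)) (e j) =
        (\<Sum>i\<in>{0..<m}. if i = j then a j * int (k j) else 0)"
      unfolding lookup_sum
    proof (rule sum.cong)
      fix i assume "i \<in> {0..<m}"
      then show "Poly_Mapping.lookup (frag_cmul (a i * int (k i)) (z i)) (e j) =
          (if i = j then a j * int (k j) else 0)"
        using arg_cong[OF z(2)[of i], of "\<lambda>v. v $ j"] j(1) by (auto simp: coords_def)
    qed simp
    then have "a j * int (k j) = 0" using sum0 j(1) by simp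
    then show False using j(2) k[of j] by simp
  qed
qed

text \<open>In coordinates, homology in dimension \<open>d-1\<close> is the quotient of \<open>\<int>\<^sup>m\<close> by the column lattice of the
minor, so its order is the index of that lattice.\<close>

lemma torsion_order_eq_det:
  assumes g: "bij_betw g {0..<m} T" and det: "det (minor g) \<noteq> 0"
  shows "int (torsion_order \<Upsilon> (d - 1)) = \<bar>det (minor g)\<bar>"
proof -
  have "torsion_elements H.Q = carrier H.Q"
    using betti_eq_0_of_det[OF assms] group_rank_eq_0_iff[OF H.comm_group_Q H.card_int_independent_le]
    unfolding betti_def homology_sub by simp
  then have tor: "torsion_order \<Upsilon> (d - 1) = card (carrier H.Q)"
    by (simp add: torsion_order_def homology_sub)
  from ex_transversal_column_lattice[OF minor_carrier det] obtain R
    where "R \<subseteq> carrier_vec m \<and> finite R \<and> int (card R) = \<bar>det (minor g)\<bar> \<and>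
      (\<forall>v\<in>carrier_vec m. \<exists>!r. r \<in> R \<and> v - r \<in> column_lattice (minor g))" by (rule exE)
  then have R: "R \<subseteq> carrier_vec m" "int (card R) = \<bar>det (minor g)\<bar>"
    and ex1: "\<And>v. v \<in> carrier_vec m \<Longrightarrow> \<exists>!r. r \<in> R \<and> v - r \<in> column_lattice (minor g)" by simp_all
  have "\<forall>r\<in>R. \<exists>z. z \<in> cycles K (d - 1) \<and> coords z = r"
    using ex_boundary_coords R(1) cycles_eq_boundaries by blast
  from bchoice[OF this] obtain l where l: "\<And>r. r \<in> R \<Longrightarrow> l r \<in> cycles K (d - 1)"
      "\<And>r. r \<in> R \<Longrightarrow> coords (l r) = r" by blast
  have "card (carrier H.Q) = card (l ` R)"
  proof (rule H.card_carrier_Q)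
    show "l ` R \<subseteq> cycles K (d - 1)" using l(1) by blast
    fix z assume z: "z \<in> cycles K (d - 1)"
    have iff: "z - l r \<in> boundaries \<Upsilon> (d - 1) \<longleftrightarrow> coords z - r \<in> column_lattice (minor g)"
      if "r \<in> R" for r
      using boundary_in_boundaries_iff[OF g diff_in_cycles[OF z l(1)[OF that]]] l(2)[OF that]
      by (simp add: coords_diff)
    from ex1[OF coords_carrier, of z] obtain r where r: "r \<in> R" "coords z - r \<in> column_lattice (minor g)"
      and uniq: "\<And>s. s \<in> R \<Longrightarrow> coords z - s \<in> column_lattice (minor g) \<Longrightarrow> s = r"
      by (elim ex1E) blast
    show "\<exists>!x. x \<in> l ` R \<and> z - x \<in> boundaries \<Upsilon> (d - 1)"
    proof (rule ex1I[of _ "l r"])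
      show "l r \<in> l ` R \<and> z - l r \<in> boundaries \<Upsilon> (d - 1)" using r iff[OF r(1)] by simp
      fix x assume x: "x \<in> l ` R \<and> z - x \<in> boundaries \<Upsilon> (d - 1)"
      then obtain s where s: "s \<in> R" "x = l s" by auto
      then have "s = r" using uniq[OF s(1)] x iff[OF s(1)] by simp
      then show "x = l r" using s by simp
    qed
  qed
  also have "card (l ` R) = card R"
    using l(2) by (intro card_image inj_on_inverseI[of _ coords]) auto
  finally show ?thesis using tor R(2) by simp
qed

end

context cycle_coordinates
begin

lemma skeleton_union_complex:
  assumes T: "T \<subseteq> faces K d"
  shows "simplicial_complex (skeleton K (d - 1) \<union> T)"
  unfolding simplicial_complex_def
proof (intro conjI ballI allI impI)
  show "{} \<in> skeleton K (d - 1) \<union> T"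
    using complex d_nonneg by (auto simp: simplicial_complex_def skeleton_def face_dim_def)
  show "finite \<sigma>" if "\<sigma> \<in> skeleton K (d - 1) \<union> T" for \<sigma>
    using that T complex by (auto simp: simplicial_complex_def skeleton_def faces_def)
  fix \<sigma> \<tau> assume \<sigma>: "\<sigma> \<in> skeleton K (d - 1) \<union> T" and sub: "\<tau> \<subseteq> \<sigma>"
  have K: "\<sigma> \<in> K" "face_dim \<sigma> \<le> d" using \<sigma> T by (auto simp: skeleton_def faces_def)
  then have fin: "finite \<sigma>" and \<tau>: "\<tau> \<in> K" using sub complex by (auto simp: simplicial_complex_def)
  show "\<tau> \<in> skeleton K (d - 1) \<union> T"
  proof (cases "\<tau> = \<sigma>")
    case False
    then have "card \<tau> < card \<sigma>" using sub fin by (intro psubset_card_mono) auto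
    then show ?thesis using K(2) \<tau> by (simp add: skeleton_def face_dim_def)
  qed (use \<sigma> in simp)
qed

lemma full_skeleton_subcomplex_union:
  assumes T: "T \<subseteq> faces K d"
  shows "full_skeleton_subcomplex K d m e b (skeleton K (d - 1) \<union> T)"
    and "faces (skeleton K (d - 1) \<union> T) d = T"
proof -
  have "skeleton (skeleton K (d - 1) \<union> T) (d - 1) = skeleton K (d - 1)"
    using T by (auto simp: skeleton_def faces_def)
  then show "full_skeleton_subcomplex K d m e b (skeleton K (d - 1) \<union> T)"
    using skeleton_union_complex[OF T] T
    by unfold_locales (auto simp: skeleton_def faces_def)
  show "faces (skeleton K (d - 1) \<union> T) d = T"
    using T by (auto simp: skeleton_def faces_def)
qed

lemma spanning_tree_subcomplex:
  assumes "\<Upsilon> \<in> spanning_trees d K"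
  shows "full_skeleton_subcomplex K d m e b \<Upsilon>"
  using assms by unfold_locales (auto simp: spanning_trees_def has_dimension_def)

text \<open>Taking the top-dimensional faces is a bijection from the spanning trees onto the sets \<open>T\<close> of \<open>m\<close>
faces whose minor is nonsingular; the sets with singular minors contribute zero to the sum.\<close>

theorem weighted_tree_number_eq_sum_minors:
  assumes g: "\<And>T. T \<subseteq> faces K d \<Longrightarrow> card T = m \<Longrightarrow> bij_betw (g T) {0..<m} T"
  shows "weighted_tree_number d K =
    (\<Sum>T | T \<subseteq> faces K d \<and> card T = m. (\<Prod>\<tau>\<in>T. face_weight \<tau>) * of_int (det (minor (g T)) ^ 2))"
proof -
  let ?S = "{T. T \<subseteq> faces K d \<and> card T = m}"
  have "weighted_tree_number d K =
      (\<Sum>T | T \<in> ?S \<and> det (minor (g T)) \<noteq> 0. (\<Prod>\<tau>\<in>T. face_weight \<tau>) * of_int (det (minor (g T)) ^ 2))"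
    unfolding weighted_tree_number_def
  proof (rule sum.reindex_bij_witness[where i="\<lambda>T. skeleton K (d - 1) \<union> T" and j="\<lambda>\<Upsilon>. faces \<Upsilon> d"])
    fix \<Upsilon> assume tree: "\<Upsilon> \<in> spanning_trees d K"
    interpret Y: full_skeleton_subcomplex K d m e b \<Upsilon>
      using tree by (rule spanning_tree_subcomplex)
    show "skeleton K (d - 1) \<union> faces \<Upsilon> d = \<Upsilon>"
      using Y.skel Y.dim by (force simp: skeleton_def faces_def)
    have betti: "betti \<Upsilon> (d - 1) = 0" "betti \<Upsilon> d = 0"
      using tree betti_K by (auto simp: spanning_trees_def)
    have inj: "\<forall>c. Poly_Mapping.keys c \<subseteq> faces \<Upsilon> d \<and> boundary c = 0 \<longrightarrow> c = 0"
      using betti(2) unfolding Y.betti_top_eq_0_iff .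
    have card: "card (faces \<Upsilon> d) = m"
      using inj betti(1) unfolding Y.betti_codim_1_eq_0_iff by (intro Y.card_T_of_betti) blast+
    note bij = g[OF Y.T_sub card]
    have det: "det (minor (g (faces \<Upsilon> d))) \<noteq> 0"
      using inj unfolding Y.chain_injective_iff_det[OF bij] .
    then show "faces \<Upsilon> d \<in> {T. T \<in> ?S \<and> det (minor (g T)) \<noteq> 0}"
      using card Y.T_sub by simp
    have "int (torsion_order \<Upsilon> (d - 1)) ^ 2 = det (minor (g (faces \<Upsilon> d))) ^ 2"
      by (simp add: Y.torsion_order_eq_det[OF bij det])
    then have "(of_nat (torsion_order \<Upsilon> (d - 1)) ^ 2 :: 'v int_mpoly) =
        of_int (det (minor (g (faces \<Upsilon> d))) ^ 2)"
      by (metis of_int_of_nat_eq of_int_power)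
    then show "(\<Prod>\<tau>\<in>faces \<Upsilon> d. face_weight \<tau>) * of_int (det (minor (g (faces \<Upsilon> d))) ^ 2) =
        (\<Prod>\<tau>\<in>faces \<Upsilon> d. face_weight \<tau>) * of_nat (torsion_order \<Upsilon> (d - 1)) ^ 2" by simp
  next
    fix T assume "T \<in> {T. T \<in> ?S \<and> det (minor (g T)) \<noteq> 0}"
    then have T: "T \<subseteq> faces K d" "card T = m" and det: "det (minor (g T)) \<noteq> 0" by auto
    interpret Y: full_skeleton_subcomplex K d m e b "skeleton K (d - 1) \<union> T"
      by (rule full_skeleton_subcomplex_union[OF T(1)])
    have top: "faces (skeleton K (d - 1) \<union> T) d = T"
      by (rule full_skeleton_subcomplex_union[OF T(1)])
    have bij: "bij_betw (g T) {0..<m} (faces (skeleton K (d - 1) \<union> T) d)"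
      using g[OF T] top by simp
    show "faces (skeleton K (d - 1) \<union> T) d = T" by (rule top)
    have "T \<noteq> {}" using T(2) m_pos by auto
    then have "has_dimension (skeleton K (d - 1) \<union> T) d"
      using Y.dim T(1) by (auto simp: has_dimension_def faces_def)
    moreover have "betti (skeleton K (d - 1) \<union> T) d = 0"
      unfolding Y.betti_top_eq_0_iff Y.chain_injective_iff_det[OF bij] by (rule det)
    ultimately show "skeleton K (d - 1) \<union> T \<in> spanning_trees d K"
      using Y.sub_complex Y.sub Y.skel Y.betti_eq_0_of_det[OF bij det] betti_K
      by (simp add: spanning_trees_def)
  qed
  also have "\<dots> = (\<Sum>T\<in>?S. (\<Prod>\<tau>\<in>T. face_weight \<tau>) * of_int (det (minor (g T)) ^ 2))"
    by (rule sum.mono_neutral_left) (use finite_faces[OF finite_K] in auto)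
  finally show ?thesis .
qed

end

section \<open>An acyclic matching on color-shifted complexes\<close>

lemma ex_sorted_enumeration:
  fixes key :: "'a \<Rightarrow> nat"
  assumes "finite B"
  shows "\<exists>b. bij_betw b {0..<card B} B \<and> (\<forall>i j. i < j \<longrightarrow> j < card B \<longrightarrow> key (b i) \<le> key (b j))"
proof -
  obtain ys where ys: "set ys = B" "distinct ys" using finite_distinct_list[OF assms] by auto
  define xs where "xs = sort_key key ys"
  have xs: "set xs = B" "distinct xs" "length xs = card B" "sorted (map key xs)"
    using ys by (auto simp: xs_def distinct_card)
  have "bij_betw (\<lambda>i. xs ! i) {0..<card B} B"
    using bij_betw_nth[OF xs(2)] xs(1,3) by (simp add: atLeast0LessThan)
  moreover have "key (xs ! i) \<le> key (xs ! j)" if "i < j" "j < card B" for i j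
    using sorted_nth_mono[OF xs(4), of i j] that xs(3) by simp
  ultimately show ?thesis by (intro exI[of _ "\<lambda>i. xs ! i"]) blast
qed

lemma bij_betw_append_enumerations:
  fixes b c :: "nat \<Rightarrow> 'a"
  assumes b: "bij_betw b {0..<m} B" and c: "bij_betw c {0..<k} C" and disj: "B \<inter> C = {}"
  shows "bij_betw (\<lambda>j. if j < m then b j else c (j - m)) {0..<m+k} (B \<union> C)"
proof -
  have "bij_betw (\<lambda>j. j - m) {m..<m+k} {0..<k}"
    by (rule bij_betw_byWitness[where f'="\<lambda>j. j + m"]) auto
  from bij_betw_trans[OF this c] have c': "bij_betw (\<lambda>j. c (j - m)) {m..<m+k} C" by (simp add: comp_def)
  have "bij_betw (\<lambda>j. if j \<in> {0..<m} then b j else c (j - m)) ({0..<m} \<union> {m..<m+k}) (B \<union> C)"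
    by (rule bij_betw_disjoint_Un[OF b c' _ disj]) auto
  moreover have "{0..<m} \<union> {m..<m+k} = {0..<m+k}" by auto
  ultimately show ?thesis by (simp add: atLeast0LessThan)
qed

locale color_shifted_complex =
  fixes d :: nat and n :: "nat \<Rightarrow> nat" and \<Delta> :: "vertex set set"
  assumes color_shifted: "color_shifted d n \<Delta>" and has_dim: "has_dimension \<Delta> (int d)"
begin

lemma complex: "simplicial_complex \<Delta>"
  using color_shifted by (simp add: color_shifted_def)

lemma face_subset: "\<sigma> \<in> \<Delta> \<Longrightarrow> \<tau> \<subseteq> \<sigma> \<Longrightarrow> \<tau> \<in> \<Delta>"
  using complex by (simp add: simplicial_complex_def)

lemma finite_face: "\<sigma> \<in> \<Delta> \<Longrightarrow> finite \<sigma>"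
  using complex by (simp add: simplicial_complex_def)

lemma vertex_range:
  assumes "\<sigma> \<in> \<Delta>" "v \<in> \<sigma>"
  shows "color v \<in> {1..d+1}" "1 \<le> index v" "index v \<le> n (color v)"
  using color_shifted assms unfolding color_shifted_def color_class_def by fastforce+

lemma finite_color_class: "finite (color_class n q)"
proof -
  have "color_class n q = Vtx q ` {1..n q}" by (auto simp: color_class_def)
  then show ?thesis by simp
qed

lemma finite_complex: "finite \<Delta>"
proof (rule finite_subset)
  show "\<Delta> \<subseteq> Pow (\<Union>q\<in>{1..d+1}. color_class n q)"
    using color_shifted unfolding color_shifted_def by blast
qed (simp add: finite_color_class)

lemma ex_facet:
  assumes "\<sigma> \<in> \<Delta>"
  obtains \<tau> where "\<tau> \<in> facets \<Delta>" "\<sigma> \<subseteq> \<tau>"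
proof -
  have "finite {\<tau> \<in> \<Delta>. \<sigma> \<subseteq> \<tau>}" "{\<tau> \<in> \<Delta>. \<sigma> \<subseteq> \<tau>} \<noteq> {}" using finite_complex assms by auto
  from finite_has_maximal[OF this] obtain \<tau> where \<tau>: "\<tau> \<in> \<Delta>" "\<sigma> \<subseteq> \<tau>"
      "\<forall>\<tau>'\<in>{\<tau> \<in> \<Delta>. \<sigma> \<subseteq> \<tau>}. \<tau> \<subseteq> \<tau>' \<longrightarrow> \<tau> = \<tau>'" by auto
  have "\<tau>' = \<tau>" if "\<tau>' \<in> \<Delta>" "\<tau> \<subseteq> \<tau>'" for \<tau>'
    using \<tau>(3)[rule_format, of \<tau>'] that \<tau>(2) by simp
  then have "\<tau> \<in> facets \<Delta>" using \<tau>(1) by (simp add: facets_def)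
  then show thesis using \<tau>(2) by (rule that)
qed

lemma facet_in: "\<tau> \<in> facets \<Delta> \<Longrightarrow> \<tau> \<in> \<Delta>"
  by (simp add: facets_def)

lemma facet_color:
  assumes "\<tau> \<in> facets \<Delta>" "q \<in> {1..d+1}"
  obtains j where "1 \<le> j" "Vtx q j \<in> \<tau>" "\<And>v. v \<in> \<tau> \<Longrightarrow> color v = q \<Longrightarrow> v = Vtx q j"
proof -
  have "card (\<tau> \<inter> color_class n q) = 1"
    using color_shifted assms by (auto simp: color_shifted_def)
  then obtain u where u: "\<tau> \<inter> color_class n q = {u}" by (auto simp: card_1_singleton_iff)
  then have "u \<in> \<tau>" "u \<in> color_class n q" by blast+
  then obtain j where j: "u = Vtx q j" "1 \<le> j" "Vtx q j \<in> \<tau>" by (auto simp: color_class_def)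
  have "v = Vtx q j" if v: "v \<in> \<tau>" "color v = q" for v
  proof -
    have "v \<in> color_class n q"
      using vertex_range[OF facet_in[OF assms(1)] v(1)] v(2)
      by (cases v) (auto simp: color_class_def)
    then show ?thesis using u j(1) v(1) by blast
  qed
  then show thesis using that j by blast
qed

lemma color_inj:
  assumes "\<sigma> \<in> \<Delta>" "u \<in> \<sigma>" "v \<in> \<sigma>" "color u = color v"
  shows "u = v"
proof -
  obtain \<tau> where \<tau>: "\<tau> \<in> facets \<Delta>" "\<sigma> \<subseteq> \<tau>" using ex_facet[OF assms(1)] .
  obtain j where "\<And>v'. v' \<in> \<tau> \<Longrightarrow> color v' = color u \<Longrightarrow> v' = Vtx (color u) j"
    using facet_color[OF \<tau>(1) vertex_range(1)[OF assms(1,2)]] by blast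
  then have "u = Vtx (color u) j" "v = Vtx (color u) j" using assms \<tau>(2) by auto
  then show ?thesis by simp
qed

lemma inj_color: "\<sigma> \<in> \<Delta> \<Longrightarrow> inj_on color \<sigma>"
  using color_inj by (auto intro: inj_onI)

lemma shift:
  assumes "insert (Vtx q j) \<rho> \<in> \<Delta>" "Vtx q j \<notin> \<rho>" "1 \<le> i" "i \<le> j"
  shows "insert (Vtx q i) \<rho> \<in> \<Delta>"
proof (cases "i = j")
  case False
  then have "i < j" using assms(4) by simp
  moreover have "\<forall>\<sigma>\<in>\<Delta>. \<forall>q j j'. Vtx q j \<in> \<sigma> \<and> 1 \<le> j' \<and> j' < j \<longrightarrow>
      insert (Vtx q j') (\<sigma> - {Vtx q j}) \<in> \<Delta>"
    using color_shifted unfolding color_shifted_def by blast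
  ultimately have "insert (Vtx q i) (insert (Vtx q j) \<rho> - {Vtx q j}) \<in> \<Delta>"
    using assms(1,3) by blast
  then show ?thesis using assms(2) by simp
qed (use assms in simp)

lemma insert_first_vertex:
  assumes \<sigma>: "\<sigma> \<in> \<Delta>" and q: "q \<in> {1..d+1}" "q \<notin> color ` \<sigma>"
  shows "insert (Vtx q 1) \<sigma> \<in> \<Delta>"
proof -
  obtain \<tau> where \<tau>: "\<tau> \<in> facets \<Delta>" "\<sigma> \<subseteq> \<tau>" using ex_facet[OF \<sigma>] .
  obtain j where j: "1 \<le> j" "Vtx q j \<in> \<tau>" using facet_color[OF \<tau>(1) q(1)] by blast
  have "Vtx q j \<notin> \<sigma>" using q(2) by force
  moreover have "insert (Vtx q j) \<sigma> \<in> \<Delta>"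
    using facet_in[OF \<tau>(1)] by (rule face_subset) (use j \<tau> in auto)
  ultimately show ?thesis using shift[of q j \<sigma> 1] j(1) by simp
qed

lemma color_image_subset: "\<sigma> \<in> \<Delta> \<Longrightarrow> color ` \<sigma> \<subseteq> {1..d+1}"
  using vertex_range(1) by blast

lemma card_color_image: "\<sigma> \<in> \<Delta> \<Longrightarrow> card (color ` \<sigma>) = card \<sigma>"
  using inj_color card_image by blast

lemma top_face_iff: "\<sigma> \<in> faces \<Delta> (int d) \<longleftrightarrow> \<sigma> \<in> \<Delta> \<and> color ` \<sigma> = {1..d+1}"
proof -
  have "card \<sigma> = d + 1 \<longleftrightarrow> color ` \<sigma> = {1..d+1}" if "\<sigma> \<in> \<Delta>"
  proof
    assume "card \<sigma> = d + 1"
    then show "color ` \<sigma> = {1..d+1}"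
      using card_subset_eq[OF _ color_image_subset[OF that]] card_color_image[OF that] by simp
  next
    assume "color ` \<sigma> = {1..d+1}"
    then show "card \<sigma> = d + 1" using card_color_image[OF that] by simp
  qed
  moreover have "\<sigma> \<in> faces \<Delta> (int d) \<longleftrightarrow> \<sigma> \<in> \<Delta> \<and> card \<sigma> = d + 1"
    unfolding faces_def face_dim_def by auto
  ultimately show ?thesis by blast
qed

lemma codim_1_face:
  assumes "\<rho> \<in> faces \<Delta> (int d - 1)"
  obtains q where "q \<in> {1..d+1}" "color ` \<rho> = {1..d+1} - {q}"
proof -
  have \<rho>: "\<rho> \<in> \<Delta>" "card \<rho> = d" using assms by (auto simp: faces_def face_dim_def)
  have "card ({1..d+1} - color ` \<rho>) = 1"
    using card_color_image[OF \<rho>(1)] color_image_subset[OF \<rho>(1)] \<rho>(2)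
    by (subst card_Diff_subset) (auto intro: finite_subset)
  then obtain q where "{1..d+1} - color ` \<rho> = {q}" by (auto simp: card_1_singleton_iff)
  then show thesis using that[of q] color_image_subset[OF \<rho>(1)] by blast
qed

text \<open>The least color that is missing from the face or represented by its first vertex.  It exceeds
\<open>d+1\<close> only for the facets without any first vertex.  Toggling the first vertex of the pivot color
preserves the pivot, so it is a matching of the faces; \<open>down\<close> marks the upper member of a pair,
whose partner is one dimension down.\<close>

definition pivot :: "vertex set \<Rightarrow> nat" where
  "pivot \<sigma> = (LEAST q. 1 \<le> q \<and> (Vtx q 1 \<in> \<sigma> \<or> q \<notin> color ` \<sigma>))"

definition down :: "vertex set \<Rightarrow> bool" where
  "down \<sigma> \<longleftrightarrow> Vtx (pivot \<sigma>) 1 \<in> \<sigma>"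

lemma pivot_eqI:
  assumes "1 \<le> q" "Vtx q 1 \<in> \<sigma> \<or> q \<notin> color ` \<sigma>"
    "\<And>r. 1 \<le> r \<Longrightarrow> r < q \<Longrightarrow> Vtx r 1 \<notin> \<sigma> \<and> r \<in> color ` \<sigma>"
  shows "pivot \<sigma> = q"
  unfolding pivot_def using assms by (intro Least_equality) (auto simp: not_less[symmetric])

lemma pivot_props:
  assumes "\<sigma> \<in> \<Delta>"
  shows "1 \<le> pivot \<sigma>" "Vtx (pivot \<sigma>) 1 \<in> \<sigma> \<or> pivot \<sigma> \<notin> color ` \<sigma>"
    and "\<And>r. 1 \<le> r \<Longrightarrow> r < pivot \<sigma> \<Longrightarrow> Vtx r 1 \<notin> \<sigma> \<and> r \<in> color ` \<sigma>"
proof -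
  \<comment> \<open>The color \<open>d+2\<close> never occurs, so the minimum exists also for facets without first vertices.\<close>
  have "d + 2 \<notin> color ` \<sigma>" using color_image_subset[OF assms] by auto
  then have ex: "1 \<le> d + 2 \<and> (Vtx (d + 2) 1 \<in> \<sigma> \<or> d + 2 \<notin> color ` \<sigma>)" by simp
  from LeastI[of "\<lambda>q. 1 \<le> q \<and> (Vtx q 1 \<in> \<sigma> \<or> q \<notin> color ` \<sigma>)", OF ex]
  show "1 \<le> pivot \<sigma>" "Vtx (pivot \<sigma>) 1 \<in> \<sigma> \<or> pivot \<sigma> \<notin> color ` \<sigma>"
    unfolding pivot_def by blast+
  show "Vtx r 1 \<notin> \<sigma> \<and> r \<in> color ` \<sigma>" if "1 \<le> r" "r < pivot \<sigma>" for r
    using not_less_Least[of r "\<lambda>q. 1 \<le> q \<and> (Vtx q 1 \<in> \<sigma> \<or> q \<notin> color ` \<sigma>)"] that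
    unfolding pivot_def by blast
qed

lemma pivot_insert_first_vertex:
  assumes \<sigma>: "\<sigma> \<in> \<Delta>" and up: "pivot \<sigma> \<notin> color ` \<sigma>"
  shows "pivot (insert (Vtx (pivot \<sigma>) 1) \<sigma>) = pivot \<sigma>"
  by (rule pivot_eqI) (use pivot_props[OF \<sigma>] in auto)

text \<open>Acyclicity of the matching.  Let \<open>\<tau>'\<close> arise by adding a vertex \<open>u\<close> to the partner of \<open>\<tau>\<close>.  All colors below
the pivot \<open>q\<close> are used in the partner by later vertices, so the color of \<open>u\<close> is at least \<open>q\<close>.  If it is \<open>q\<close>, either \<open>u\<close> is the first
vertex of that color and \<open>\<tau>' = \<tau>\<close>, or the pivot has moved up.  If it is larger, \<open>q\<close> is still missing from \<open>\<tau>'\<close>,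
which then is not a \<open>down\<close> face.\<close>

lemma pivot_of_neighbor:
  assumes \<tau>: "\<tau> \<in> \<Delta>" "down \<tau>" and \<tau>': "\<tau>' \<in> \<Delta>" "down \<tau>'"
    and u: "u \<in> \<tau>'" "\<tau>' - {u} = \<tau> - {Vtx (pivot \<tau>) 1}"
  shows "\<tau>' = \<tau> \<or> pivot \<tau> < pivot \<tau>'"
proof -
  define \<rho> where "\<rho> = \<tau> - {Vtx (pivot \<tau>) 1}"
  note lv = pivot_props[OF \<tau>(1)] and lv' = pivot_props[OF \<tau>'(1)]
  have v: "Vtx (pivot \<tau>) 1 \<in> \<tau>" using \<tau>(2) by (simp add: down_def)
  have \<tau>'_eq: "\<tau>' = insert u \<rho>" using u by (auto simp: \<rho>_def)
  have q: "pivot \<tau> \<notin> color ` \<rho>" using color_inj[OF \<tau>(1) v] by (force simp: \<rho>_def)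
  have small: "Vtx r 1 \<notin> \<rho> \<and> r \<in> color ` \<rho>" if "1 \<le> r" "r < pivot \<tau>" for r
    using lv(3)[OF that] that by (force simp: \<rho>_def)
  have cu: "color u \<notin> color ` \<rho>"
  proof
    assume "color u \<in> color ` \<rho>"
    then obtain w where "w \<in> \<rho>" "color w = color u" by auto
    then have "w = u" using color_inj[OF \<tau>'(1), of w u] u(1) \<tau>'_eq by auto
    then show False using \<open>w \<in> \<rho>\<close> u(2) by (auto simp: \<rho>_def)
  qed
  then have ge: "pivot \<tau> \<le> color u"
    using small[of "color u"] vertex_range(1)[OF \<tau>'(1) u(1)] by (auto simp: not_less[symmetric])
  show ?thesis
  proof (cases "color u = pivot \<tau>")
    case True
    show ?thesis
    proof (cases "index u = 1")
      case True
      then have "u = Vtx (pivot \<tau>) 1" using \<open>color u = pivot \<tau>\<close> by (cases u) auto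
      then show ?thesis using \<tau>'_eq v by (auto simp: \<rho>_def)
    next
      case False
      have "\<not> pivot \<tau>' \<le> pivot \<tau>"
      proof
        assume le: "pivot \<tau>' \<le> pivot \<tau>"
        have w: "Vtx (pivot \<tau>') 1 \<in> insert u \<rho>" using \<tau>'(2) by (simp add: down_def \<tau>'_eq)
        show False
        proof (cases "pivot \<tau>' = pivot \<tau>")
          case True
          then show False using w \<open>index u \<noteq> 1\<close> q by force
        next
          case False
          then have "pivot \<tau>' < pivot \<tau>" using le by simp
          then show False using w small[OF lv'(1)] \<open>color u = pivot \<tau>\<close> by auto
        qed
      qed
      then show ?thesis by simp
    qed
  next
    case False
    then have gt: "pivot \<tau> < color u" using ge by simp
    have "pivot \<tau>' = pivot \<tau>"
    proof (rule pivot_eqI[OF lv(1)])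
      show "Vtx (pivot \<tau>) 1 \<in> \<tau>' \<or> pivot \<tau> \<notin> color ` \<tau>'" using q gt by (auto simp: \<tau>'_eq)
      fix r assume r: "1 \<le> r" "r < pivot \<tau>"
      show "Vtx r 1 \<notin> \<tau>' \<and> r \<in> color ` \<tau>'" using small[OF r] r gt by (auto simp: \<tau>'_eq)
    qed
    then have "Vtx (pivot \<tau>) 1 \<in> insert u \<rho>" using \<tau>'(2) by (simp add: down_def \<tau>'_eq)
    then have False using q gt by force
    then show ?thesis ..
  qed
qed

lemma incidence_down:
  assumes "\<tau> \<in> \<Delta>" "down \<tau>" "\<tau>' \<in> \<Delta>" "down \<tau>'" "incidence (\<tau> - {Vtx (pivot \<tau>) 1}) \<tau>' \<noteq> 0"
  shows "\<tau>' = \<tau> \<or> pivot \<tau> < pivot \<tau>'"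
proof -
  obtain u where "u \<in> \<tau>'" "\<tau> - {Vtx (pivot \<tau>) 1} = \<tau>' - {u}" using assms(5) by (rule incidence_nonzeroE)
  then show ?thesis using pivot_of_neighbor[OF assms(1-4)] by auto
qed

lemma incidence_down_self:
  assumes "\<tau> \<in> \<Delta>" "down \<tau>"
  shows "\<bar>incidence (\<tau> - {Vtx (pivot \<tau>) 1}) \<tau>\<bar> = 1"
  using assms finite_face by (simp add: down_def incidence_remove power_abs)

text \<open>A nonzero cycle supported on \<open>down\<close> faces is impossible: if \<open>\<tau>\<close> has the largest
pivot in the support, the partner of \<open>\<tau>\<close> occurs in the boundary of no other face of the support.\<close>

lemma cycle_vanishing_on_up_faces:
  assumes z: "z \<in> cycles \<Delta> i" and up: "\<And>\<rho>. \<rho> \<in> faces \<Delta> i \<Longrightarrow> \<not> down \<rho> \<Longrightarrow> Poly_Mapping.lookup z \<rho> = 0"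
  shows "z = 0"
proof (rule ccontr)
  assume "z \<noteq> 0"
  then have "Poly_Mapping.keys z \<noteq> {}" by simp
  then have "Max (pivot ` Poly_Mapping.keys z) \<in> pivot ` Poly_Mapping.keys z" by (intro Max_in) auto
  then obtain \<tau> where \<tau>: "\<tau> \<in> Poly_Mapping.keys z"
      "\<And>\<tau>'. \<tau>' \<in> Poly_Mapping.keys z \<Longrightarrow> pivot \<tau>' \<le> pivot \<tau>"
    using Max_ge[of "pivot ` Poly_Mapping.keys z"] by (metis finite_imageI finite_keys imageE imageI)
  have keys: "\<tau>' \<in> \<Delta> \<and> down \<tau>'" if "\<tau>' \<in> Poly_Mapping.keys z" for \<tau>'
  proof -
    have "\<tau>' \<in> faces \<Delta> i" using z that by (auto simp: cycles_def chain_group_def)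
    then show ?thesis using up[of \<tau>'] that by (auto simp: faces_def in_keys_iff)
  qed
  let ?\<rho> = "\<tau> - {Vtx (pivot \<tau>) 1}"
  have "Poly_Mapping.lookup (boundary z) ?\<rho> =
      (\<Sum>\<tau>'\<in>Poly_Mapping.keys z. Poly_Mapping.lookup z \<tau>' * incidence ?\<rho> \<tau>')"
    by (rule lookup_boundary) auto
  also have "\<dots> = (\<Sum>\<tau>'\<in>Poly_Mapping.keys z. if \<tau>' = \<tau> then Poly_Mapping.lookup z \<tau> * incidence ?\<rho> \<tau> else 0)"
  proof (rule sum.cong[OF refl])
    fix \<tau>' assume \<tau>': "\<tau>' \<in> Poly_Mapping.keys z"
    have "incidence ?\<rho> \<tau>' = 0" if "\<tau>' \<noteq> \<tau>"
      using incidence_down[of \<tau> \<tau>'] keys[OF \<tau>(1)] keys[OF \<tau>'] \<tau>(2)[OF \<tau>'] that by fastforce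
    then show "Poly_Mapping.lookup z \<tau>' * incidence ?\<rho> \<tau>' =
        (if \<tau>' = \<tau> then Poly_Mapping.lookup z \<tau> * incidence ?\<rho> \<tau> else 0)" by simp
  qed
  also have "\<dots> = Poly_Mapping.lookup z \<tau> * incidence ?\<rho> \<tau>" using \<tau>(1) by simp
  finally have "Poly_Mapping.lookup z \<tau> * incidence ?\<rho> \<tau> = 0"
    using z by (simp add: cycles_def)
  moreover have "Poly_Mapping.lookup z \<tau> \<noteq> 0" using \<tau>(1) by (simp add: in_keys_iff)
  moreover have "incidence ?\<rho> \<tau> \<noteq> 0" using incidence_down_self[of \<tau>] keys[OF \<tau>(1)] by auto
  ultimately show False by simp
qed

definition down_facets :: "vertex set set" where
  "down_facets = {\<sigma> \<in> faces \<Delta> (int d). \<exists>q. Vtx q 1 \<in> \<sigma>}"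

lemma down_facet_iff:
  assumes "\<sigma> \<in> faces \<Delta> (int d)"
  shows "down \<sigma> \<longleftrightarrow> (\<exists>q. Vtx q 1 \<in> \<sigma>)"
proof
  assume "\<exists>q. Vtx q 1 \<in> \<sigma>"
  then obtain q where q: "Vtx q 1 \<in> \<sigma>" by auto
  have \<sigma>: "\<sigma> \<in> \<Delta>" "color ` \<sigma> = {1..d+1}" using assms by (auto simp: top_face_iff)
  have "q \<in> {1..d+1}" using vertex_range(1)[OF \<sigma>(1) q] by simp
  then have "pivot \<sigma> \<le> q" using pivot_props(3)[OF \<sigma>(1), of q] q by (auto simp: not_less[symmetric])
  then have "pivot \<sigma> \<in> color ` \<sigma>" using \<open>q \<in> {1..d+1}\<close> pivot_props(1)[OF \<sigma>(1)] \<sigma>(2) by auto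
  then show "down \<sigma>" using pivot_props(2)[OF \<sigma>(1)] by (simp add: down_def)
qed (auto simp: down_def)

lemma finite_down_facets: "finite down_facets"
  using finite_faces[OF finite_complex] by (simp add: down_facets_def)

lemma down_facet_down: "\<sigma> \<in> down_facets \<Longrightarrow> \<sigma> \<in> \<Delta> \<and> down \<sigma>"
  using down_facet_iff by (auto simp: down_facets_def faces_def)

text \<open>Adding first vertices to the empty face, one color after the other, yields a facet.\<close>

lemma down_facets_nonempty: "down_facets \<noteq> {}"
proof -
  have "(\<exists>\<sigma>\<in>\<Delta>. color ` \<sigma> = {1..k} \<and> (k \<ge> 1 \<longrightarrow> Vtx 1 1 \<in> \<sigma>))" if "k \<le> d + 1" for k
    using that
  proof (induction k)
    case 0
    have "{} \<in> \<Delta>" using complex by (simp add: simplicial_complex_def)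
    then show ?case by auto
  next
    case (Suc k)
    then obtain \<sigma> where \<sigma>: "\<sigma> \<in> \<Delta>" "color ` \<sigma> = {1..k}" "k \<ge> 1 \<longrightarrow> Vtx 1 1 \<in> \<sigma>" by auto
    then have "insert (Vtx (Suc k) 1) \<sigma> \<in> \<Delta>" using Suc.prems by (intro insert_first_vertex) auto
    moreover have "color ` insert (Vtx (Suc k) 1) \<sigma> = {1..Suc k}" using \<sigma>(2) by auto
    ultimately show ?case using \<sigma>(3) by (intro bexI[of _ "insert (Vtx (Suc k) 1) \<sigma>"]) (cases k; auto)+
  qed
  from this[of "d + 1"] show ?thesis by (auto simp: down_facets_def top_face_iff)
qed

lemma up_face_eq:
  assumes \<rho>: "\<rho> \<in> faces \<Delta> (int d - 1)" and up: "\<not> down \<rho>"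
  shows "\<exists>\<sigma>\<in>down_facets. \<rho> = \<sigma> - {Vtx (pivot \<sigma>) 1}"
proof -
  obtain q where q: "q \<in> {1..d+1}" "color ` \<rho> = {1..d+1} - {q}" using \<rho> by (rule codim_1_face)
  have \<rho>\<Delta>: "\<rho> \<in> \<Delta>" using \<rho> by (simp add: faces_def)
  have pivot: "pivot \<rho> \<notin> color ` \<rho>" using pivot_props(2)[OF \<rho>\<Delta>] up by (simp add: down_def)
  have "pivot \<rho> \<le> q" using pivot_props(3)[OF \<rho>\<Delta>, of q] q by (auto simp: not_less[symmetric])
  then have eq: "pivot \<rho> = q" using pivot q pivot_props(1)[OF \<rho>\<Delta>] by auto
  define \<sigma> where "\<sigma> = insert (Vtx q 1) \<rho>"
  have "\<sigma> \<in> \<Delta>" unfolding \<sigma>_def using q by (intro insert_first_vertex[OF \<rho>\<Delta>]) auto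
  moreover have "color ` \<sigma> = {1..d+1}" using q by (auto simp: \<sigma>_def)
  ultimately have "\<sigma> \<in> down_facets" by (auto simp: down_facets_def top_face_iff \<sigma>_def)
  moreover have "pivot \<sigma> = q" using pivot_insert_first_vertex[OF \<rho>\<Delta> pivot] by (simp add: \<sigma>_def eq)
  moreover have "Vtx q 1 \<notin> \<rho>" using q by force
  then have "\<rho> = \<sigma> - {Vtx q 1}" by (simp add: \<sigma>_def)
  ultimately show ?thesis by auto
qed

text \<open>With the matched facets sorted by their pivots, the boundary matrix with respect to their partners
is triangular with diagonal entries \<open>\<plusminus>1\<close>.  The partners are all the \<open>(d-1)\<close>-faces that are not
\<open>down\<close>, so a cycle with zero coordinates vanishes.\<close>

lemma cycle_coordinates_down_facets:
  assumes b: "bij_betw b {0..<card down_facets} down_facets"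
    and sorted: "\<And>i j. i < j \<Longrightarrow> j < card down_facets \<Longrightarrow> pivot (b i) \<le> pivot (b j)"
  shows "cycle_coordinates \<Delta> (int d) (card down_facets) (\<lambda>i. b i - {Vtx (pivot (b i)) 1}) b"
proof
  let ?m = "card down_facets" and ?e = "\<lambda>i. b i - {Vtx (pivot (b i)) 1}"
  let ?A = "mat ?m ?m (\<lambda>(i,j). incidence (?e i) (b j))"
  have b_in: "b i \<in> down_facets" if "i < ?m" for i
    using b that by (auto simp: bij_betw_def)
  have b_inj: "b i = b j \<longleftrightarrow> i = j" if "i < ?m" "j < ?m" for i j
    using b that by (auto simp: bij_betw_def inj_on_def)
  show "simplicial_complex \<Delta>" "finite \<Delta>" by (rule complex, rule finite_complex)
  show "0 \<le> int d" by simp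
  show "0 < ?m" using down_facets_nonempty finite_down_facets by (simp add: card_gt_0_iff)
  show "b j \<in> faces \<Delta> (int d)" if "j < ?m" for j
    using b_in[OF that] by (simp add: down_facets_def)
  have "upper_triangular ?A"
  proof
    fix i j assume ij: "j < i" "i < dim_row ?A"
    then have "pivot (b j) \<le> pivot (b i)" by (intro sorted) auto
    then have "incidence (?e i) (b j) = 0"
      using incidence_down[of "b i" "b j"] down_facet_down[OF b_in[of i]] down_facet_down[OF b_in[of j]]
        b_inj[of i j] ij by fastforce
    then show "?A $$ (i, j) = 0" using ij by simp
  qed
  then have "det ?A = prod_list (diag_mat ?A)" by (rule det_upper_triangular[of _ ?m]) simp
  also have "\<dots> = (\<Prod>i = 0..<?m. incidence (?e i) (b i))" by (simp add: prod_list_diag_prod)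
  finally have "\<bar>det ?A\<bar> = (\<Prod>i = 0..<?m. \<bar>incidence (?e i) (b i)\<bar>)" by (simp only: abs_prod)
  also have "\<dots> = 1" using incidence_down_self down_facet_down[OF b_in] by (intro prod.neutral) auto
  finally show "\<bar>det ?A\<bar> = 1" .
  fix z assume z: "z \<in> cycles \<Delta> (int d - 1)" "\<And>i. i < ?m \<Longrightarrow> Poly_Mapping.lookup z (?e i) = 0"
  show "z = 0"
  proof (rule cycle_vanishing_on_up_faces[OF z(1)])
    fix \<rho> assume "\<rho> \<in> faces \<Delta> (int d - 1)" "\<not> down \<rho>"
    then obtain \<sigma> where \<sigma>: "\<sigma> \<in> down_facets" "\<rho> = \<sigma> - {Vtx (pivot \<sigma>) 1}" using up_face_eq by blast
    then have "\<sigma> \<in> b ` {0..<?m}" using b by (simp add: bij_betw_def)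
    then obtain i where "i < ?m" "\<sigma> = b i" by auto
    then show "Poly_Mapping.lookup z \<rho> = 0" using z(2) \<sigma>(2) by simp
  qed
qed

end

section \<open>Orthogonal fundamental cycles\<close>

context color_shifted_complex
begin

text \<open>The index of the vertex of color \<open>q\<close> in \<open>\<sigma>\<close>, so that a facet is identified with the tuple of
its positions.\<close>

definition pos :: "vertex set \<Rightarrow> nat \<Rightarrow> nat" where
  "pos \<sigma> q = (THE j. Vtx q j \<in> \<sigma>)"

definition tuple_face :: "(nat \<Rightarrow> nat) \<Rightarrow> vertex set" where
  "tuple_face f = (\<lambda>q. Vtx q (f q)) ` {1..d+1}"

lemma pos_eq: "\<sigma> \<in> \<Delta> \<Longrightarrow> Vtx q j \<in> \<sigma> \<Longrightarrow> pos \<sigma> q = j"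
  unfolding pos_def using color_inj[of \<sigma> _ "Vtx q j"] by (intro the_equality) fastforce+

lemma pos_in: "\<sigma> \<in> \<Delta> \<Longrightarrow> q \<in> color ` \<sigma> \<Longrightarrow> Vtx q (pos \<sigma> q) \<in> \<sigma>"
proof -
  assume \<sigma>: "\<sigma> \<in> \<Delta>" and "q \<in> color ` \<sigma>"
  then obtain v where "v \<in> \<sigma>" "color v = q" by auto
  then have "Vtx q (index v) \<in> \<sigma>" by (cases v) auto
  then show ?thesis using pos_eq[OF \<sigma>] by simp
qed

lemma pos_ge_1: "\<sigma> \<in> \<Delta> \<Longrightarrow> q \<in> color ` \<sigma> \<Longrightarrow> 1 \<le> pos \<sigma> q"
  using vertex_range(2)[of \<sigma> "Vtx q (pos \<sigma> q)"] pos_in by simp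

lemma pos_tuple_face: "q \<in> {1..d+1} \<Longrightarrow> pos (tuple_face f) q = f q"
  unfolding pos_def tuple_face_def by (intro the_equality) auto

lemma face_eq_pos:
  assumes "\<sigma> \<in> \<Delta>"
  shows "\<sigma> = (\<lambda>q. Vtx q (pos \<sigma> q)) ` (color ` \<sigma>)"
proof -
  have "Vtx (color v) (pos \<sigma> (color v)) = v" if "v \<in> \<sigma>" for v
    using pos_eq[OF assms, of "color v" "index v"] that by (cases v) auto
  then show ?thesis by (auto simp: image_image)
qed

lemma tuple_face_pos: "\<sigma> \<in> faces \<Delta> (int d) \<Longrightarrow> tuple_face (pos \<sigma>) = \<sigma>"
  using face_eq_pos[of \<sigma>] by (simp add: top_face_iff tuple_face_def)

lemma color_tuple_face: "color ` tuple_face f = {1..d+1}"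
  by (auto simp: tuple_face_def image_image)

lemma tuple_face_split:
  "q \<in> {1..d+1} \<Longrightarrow> tuple_face f = insert (Vtx q (f q)) ((\<lambda>r. Vtx r (f r)) ` ({1..d+1} - {q}))"
  by (auto simp: tuple_face_def)

text \<open>The facets form an order ideal of tuples: the positions are lowered one color at a time.\<close>

lemma tuple_face_shift:
  assumes \<sigma>: "\<sigma> \<in> faces \<Delta> (int d)" and f: "\<And>q. q \<in> {1..d+1} \<Longrightarrow> 1 \<le> f q \<and> f q \<le> pos \<sigma> q"
  shows "tuple_face f \<in> faces \<Delta> (int d)"
proof -
  \<comment> \<open>Colors up to \<open>k\<close> are already lowered to the target position.\<close>
  define g where "g k q = (if q \<le> k then f q else pos \<sigma> q)" for k q
  have "tuple_face (g k) \<in> \<Delta>" if "k \<le> d + 1" for k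
    using that
  proof (induction k)
    case 0
    have "tuple_face (g 0) = tuple_face (pos \<sigma>)" by (auto simp: tuple_face_def g_def)
    then show ?case using tuple_face_pos[OF \<sigma>] \<sigma> by (simp add: top_face_iff)
  next
    case (Suc k)
    define \<rho> where "\<rho> = (\<lambda>q. Vtx q (g k q)) ` ({1..d+1} - {Suc k})"
    have k: "Suc k \<in> {1..d+1}" using Suc.prems by simp
    have "tuple_face (g k) = insert (Vtx (Suc k) (pos \<sigma> (Suc k))) \<rho>"
      unfolding tuple_face_split[OF k] \<rho>_def by (simp add: g_def)
    moreover have "Vtx (Suc k) (pos \<sigma> (Suc k)) \<notin> \<rho>" by (auto simp: \<rho>_def)
    ultimately have "insert (Vtx (Suc k) (f (Suc k))) \<rho> \<in> \<Delta>"
      using shift[of "Suc k" "pos \<sigma> (Suc k)" \<rho> "f (Suc k)"] f[OF k] Suc.IH Suc.prems by simp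
    moreover have "tuple_face (g (Suc k)) = insert (Vtx (Suc k) (f (Suc k))) \<rho>"
    proof -
      have "(\<lambda>q. Vtx q (g (Suc k) q)) ` ({1..d+1} - {Suc k}) = \<rho>"
        unfolding \<rho>_def by (intro image_cong) (auto simp: g_def)
      then show ?thesis unfolding tuple_face_split[OF k] by (simp add: g_def)
    qed
    ultimately show ?case by simp
  qed
  from this[of "d + 1"] have "tuple_face (g (d + 1)) \<in> \<Delta>" by simp
  moreover have "tuple_face (g (d + 1)) = tuple_face f"
    unfolding tuple_face_def by (intro image_cong) (auto simp: g_def)
  ultimately show ?thesis using color_tuple_face by (simp add: top_face_iff)
qed

text \<open>The unmatched facets, which are the \<open>d\<close>-faces of the complex \<open>\<Gamma>\<close>.\<close>

definition core_facets :: "vertex set set" where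
  "core_facets = faces \<Delta> (int d) - down_facets"

lemma core_facet_pos:
  assumes "\<sigma> \<in> core_facets" "q \<in> {1..d+1}"
  shows "2 \<le> pos \<sigma> q"
proof -
  have \<sigma>: "\<sigma> \<in> \<Delta>" "q \<in> color ` \<sigma>" "Vtx q 1 \<notin> \<sigma>"
    using assms by (auto simp: core_facets_def down_facets_def top_face_iff)
  have "pos \<sigma> q \<noteq> 1" using pos_in[OF \<sigma>(1,2)] \<sigma>(3) by metis
  then show ?thesis using pos_ge_1[OF \<sigma>(1,2)] by simp
qed

lemma core_facet_face: "\<sigma> \<in> core_facets \<Longrightarrow> \<sigma> \<in> faces \<Delta> (int d)"
  by (simp add: core_facets_def)

lemma incidence_insert:
  assumes "\<rho> \<in> \<Delta>" "q \<notin> color ` \<rho>"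
  shows "incidence \<rho> (insert (Vtx q i) \<rho>) = (-1) ^ card {u \<in> \<rho>. color u < q}"
proof -
  have "Vtx q i \<notin> \<rho>" using assms(2) by force
  then have "incidence \<rho> (insert (Vtx q i) \<rho>) =
      (-1) ^ card {u \<in> insert (Vtx q i) \<rho>. u < Vtx q i}"
    using incidence_remove[of "insert (Vtx q i) \<rho>" "Vtx q i"] finite_face[OF assms(1)] by simp
  also have "{u \<in> insert (Vtx q i) \<rho>. u < Vtx q i} = {u \<in> \<rho>. color u < q}"
    using assms(2) by (auto simp: less_vertex_def)
  finally show ?thesis .
qed

lemma incidence_facet_cases:
  assumes \<rho>: "color ` \<rho> = {1..d+1} - {q}" and \<tau>: "\<tau> \<in> faces \<Delta> (int d)" and inc: "incidence \<rho> \<tau> \<noteq> 0"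
  shows "\<exists>i. \<tau> = insert (Vtx q i) \<rho>"
proof -
  obtain v where v: "v \<in> \<tau>" "\<rho> = \<tau> - {v}" using inc by (rule incidence_nonzeroE)
  have \<tau>\<Delta>: "\<tau> \<in> \<Delta>" using \<tau> by (simp add: top_face_iff)
  have "color v \<notin> color ` \<rho>" using v color_inj[OF \<tau>\<Delta> v(1)] by auto
  then have "color v = q" using \<rho> vertex_range(1)[OF \<tau>\<Delta> v(1)] by auto
  then have "\<tau> = insert (Vtx q (index v)) \<rho>" using v by (cases v) auto
  then show ?thesis ..
qed

end

text \<open>The weights lie in an arbitrary field; the prefix sums of the weights of a color occur as denominators.\<close>

locale weighted_color_shifted_complex = color_shifted_complex +
  fixes x :: "vertex \<Rightarrow> 'f::field"
  assumes x_nonzero: "x v \<noteq> 0"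
    and prefix_sum_nonzero: "1 \<le> j \<Longrightarrow> (\<Sum>i=1..j. x (Vtx q i)) \<noteq> 0"
begin

definition psum :: "nat \<Rightarrow> nat \<Rightarrow> 'f" where
  "psum q j = (\<Sum>i=1..j. x (Vtx q i))"

text \<open>The reduced \<open>0\<close>-cycle of color \<open>q\<close> belonging to position \<open>s\<close>: the vertex \<open>s\<close> minus the weighted
mean of the vertices before it.\<close>

definition coef :: "nat \<Rightarrow> nat \<Rightarrow> nat \<Rightarrow> 'f" where
  "coef q s i = (if i = s then 1 else if i < s then - x (Vtx q i) / psum q (s - 1) else 0)"

text \<open>The coefficient at \<open>\<tau>\<close> of the tensor product of the \<open>0\<close>-cycles of the positions of \<open>\<sigma>\<close>.\<close>

definition fund_cycle :: "vertex set \<Rightarrow> vertex set \<Rightarrow> 'f" where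
  "fund_cycle \<sigma> \<tau> = (\<Prod>q\<in>{1..d+1}. coef q (pos \<sigma> q) (pos \<tau> q))"

definition weight :: "vertex set \<Rightarrow> 'f" where
  "weight \<tau> = (\<Prod>v\<in>\<tau>. x v)"

text \<open>The norm of the cycle of \<open>\<sigma>\<close> for the inner product with weights \<open>1 / weight \<tau>\<close>.\<close>

definition norm_sq :: "vertex set \<Rightarrow> 'f" where
  "norm_sq \<sigma> = (\<Prod>q\<in>{1..d+1}. 1 / x (Vtx q (pos \<sigma> q)) + 1 / psum q (pos \<sigma> q - 1))"

lemma psum_nonzero: "1 \<le> j \<Longrightarrow> psum q j \<noteq> 0"
  using prefix_sum_nonzero by (simp add: psum_def)

lemma psum_Suc: "psum q (Suc j) = psum q j + x (Vtx q (Suc j))"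
  by (simp add: psum_def)

lemma sum_below:
  fixes s :: nat
  assumes "2 \<le> s"
  shows "(\<Sum>i=1..s. f i) = f s + (\<Sum>i=1..s-1. f i :: 'f)"
  using assms by (cases s) (simp_all add: add.commute)

lemma sum_coef:
  assumes "2 \<le> s"
  shows "(\<Sum>i=1..s. coef q s i) = 0"
proof -
  have "(\<Sum>i=1..s-1. coef q s i) = (\<Sum>i=1..s-1. - x (Vtx q i) / psum q (s - 1))"
    using assms by (intro sum.cong) (auto simp: coef_def)
  also have "\<dots> = - 1"
    using psum_nonzero[of "s - 1" q] assms
    by (simp add: psum_def sum_negf flip: sum_divide_distrib)
  finally show ?thesis using sum_below[OF assms, of "coef q s"] by (simp add: coef_def)
qed

text \<open>Below position \<open>t\<close> the second coefficient divided by the weight is constant, so the sum is a multiple of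
the augmentation of the first \<open>0\<close>-cycle.\<close>

lemma sum_coef_less:
  assumes "2 \<le> s" "s < t"
  shows "(\<Sum>i=1..s. coef q s i * coef q t i / x (Vtx q i)) = 0"
proof -
  have "(\<Sum>i=1..s. coef q s i * coef q t i / x (Vtx q i)) = (\<Sum>i=1..s. - (coef q s i / psum q (t - 1)))"
    using assms x_nonzero by (intro sum.cong) (auto simp: coef_def[of q t])
  also have "\<dots> = - ((\<Sum>i=1..s. coef q s i) / psum q (t - 1))"
    by (simp add: sum_negf sum_divide_distrib)
  finally show ?thesis using sum_coef[OF assms(1)] by simp
qed

lemma sum_coef_mult:
  assumes s: "2 \<le> s" and t: "2 \<le> t"
  shows "(\<Sum>i=1..s. coef q s i * coef q t i / x (Vtx q i)) =
    (if s = t then 1 / x (Vtx q s) + 1 / psum q (s - 1) else 0)"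
proof (cases s t rule: linorder_cases)
  case less
  then show ?thesis using sum_coef_less[OF s less] by simp
next
  case greater
  have "(\<Sum>i=1..s. coef q s i * coef q t i / x (Vtx q i)) = (\<Sum>i=1..t. coef q t i * coef q s i / x (Vtx q i))"
    using greater by (intro sum.mono_neutral_cong_right) (auto simp: coef_def[of q t])
  then show ?thesis using sum_coef_less[OF t greater] greater by simp
next
  case equal
  have "(\<Sum>i=1..s-1. coef q s i * coef q s i / x (Vtx q i)) =
      (\<Sum>i=1..s-1. x (Vtx q i) / (psum q (s - 1) * psum q (s - 1)))"
    using s x_nonzero by (intro sum.cong) (auto simp: coef_def)
  also have "\<dots> = psum q (s - 1) / (psum q (s - 1) * psum q (s - 1))"
    by (simp add: psum_def flip: sum_divide_distrib)
  also have "\<dots> = 1 / psum q (s - 1)"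
    using psum_nonzero[of "s - 1" q] s by simp
  finally show ?thesis
    using equal sum_below[OF s, of "\<lambda>i. coef q s i * coef q s i / x (Vtx q i)"] by (simp add: coef_def)
qed

lemma fund_cycle_support:
  assumes "fund_cycle \<sigma> \<tau> \<noteq> 0" "q \<in> {1..d+1}"
  shows "pos \<tau> q \<le> pos \<sigma> q"
proof -
  have "coef q (pos \<sigma> q) (pos \<tau> q) \<noteq> 0"
    using assms prod_zero[of "{1..d+1}" "\<lambda>q. coef q (pos \<sigma> q) (pos \<tau> q)"]
    unfolding fund_cycle_def by blast
  then show ?thesis by (auto simp: coef_def split: if_splits)
qed

lemma fund_cycle_self: "fund_cycle \<sigma> \<sigma> = 1"
  by (simp add: fund_cycle_def coef_def)

text \<open>The facets containing \<open>\<rho>\<close> differ only in the vertex of the missing color \<open>m\<close>, and their incidence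
numbers with \<open>\<rho>\<close> agree because vertices are ordered by color first.  If the factors of the other colors do not vanish,
the positions of \<open>\<rho>\<close> are bounded by those of \<open>\<sigma>\<close>.  Then the complex contains all extensions of
\<open>\<rho>\<close> up to the position of \<open>\<sigma>\<close>, and the coefficients of color \<open>m\<close> add up to zero.\<close>

lemma fund_cycle_boundary:
  assumes \<rho>: "\<rho> \<in> faces \<Delta> (int d - 1)" and \<sigma>: "\<sigma> \<in> core_facets"
  shows "(\<Sum>\<tau>\<in>faces \<Delta> (int d). of_int (incidence \<rho> \<tau>) * fund_cycle \<sigma> \<tau>) = 0"
proof -
  obtain m where m: "m \<in> {1..d+1}" "color ` \<rho> = {1..d+1} - {m}" using \<rho> by (rule codim_1_face)
  have \<rho>\<Delta>: "\<rho> \<in> \<Delta>" using \<rho> by (simp add: faces_def)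
  have m\<rho>: "m \<notin> color ` \<rho>" using m by simp
  let ?ins = "\<lambda>i. insert (Vtx m i) \<rho>"
  define I where "I = {i. ?ins i \<in> \<Delta>}"
  define P where "P = (\<Prod>q\<in>{1..d+1} - {m}. coef q (pos \<sigma> q) (pos \<rho> q))"
  define \<epsilon> where "\<epsilon> = (of_int ((-1) ^ card {u \<in> \<rho>. color u < m}) :: 'f)"
  have inj: "inj_on ?ins I"
  proof (rule inj_onI)
    fix i j assume "?ins i = ?ins j"
    moreover have "Vtx m i \<notin> \<rho>" using m\<rho> by force
    ultimately show "i = j" by (metis insertE insertI1 vertex.inject)
  qed
  have top: "?ins i \<in> faces \<Delta> (int d)" if "i \<in> I" for i
    using that m by (auto simp: I_def top_face_iff)
  have finI: "finite I"
    using finite_imageD[OF finite_subset[OF _ finite_complex] inj] by (auto simp: I_def)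
  have cyc: "fund_cycle \<sigma> (?ins i) = coef m (pos \<sigma> m) i * P" if "i \<in> I" for i
  proof -
    have "pos (?ins i) m = i" using pos_eq[of "?ins i" m i] that by (simp add: I_def)
    moreover have "pos (?ins i) q = pos \<rho> q" if "q \<noteq> m" for q using that by (simp add: pos_def)
    then have "(\<Prod>q\<in>{1..d+1} - {m}. coef q (pos \<sigma> q) (pos (?ins i) q)) = P"
      unfolding P_def by (intro prod.cong) auto
    ultimately show ?thesis unfolding fund_cycle_def by (subst prod.remove[OF _ m(1)]) auto
  qed
  have "(\<Sum>\<tau>\<in>faces \<Delta> (int d). of_int (incidence \<rho> \<tau>) * fund_cycle \<sigma> \<tau>) =
      (\<Sum>\<tau>\<in>?ins ` I. of_int (incidence \<rho> \<tau>) * fund_cycle \<sigma> \<tau>)"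
  proof (rule sum.mono_neutral_right[OF finite_faces[OF finite_complex]])
    show "?ins ` I \<subseteq> faces \<Delta> (int d)" using top by blast
    show "\<forall>\<tau>\<in>faces \<Delta> (int d) - ?ins ` I. of_int (incidence \<rho> \<tau>) * fund_cycle \<sigma> \<tau> = 0"
    proof
      fix \<tau> assume \<tau>: "\<tau> \<in> faces \<Delta> (int d) - ?ins ` I"
      have "incidence \<rho> \<tau> = 0"
      proof (rule ccontr)
        assume "incidence \<rho> \<tau> \<noteq> 0"
        then obtain i where i: "\<tau> = ?ins i" using incidence_facet_cases[OF m(2)] \<tau> by blast
        then have "i \<in> I" using \<tau> by (simp add: I_def top_face_iff)
        then show False using \<tau> i by blast
      qed
      then show "of_int (incidence \<rho> \<tau>) * fund_cycle \<sigma> \<tau> = 0" by simp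
    qed
  qed
  also have "\<dots> = (\<Sum>i\<in>I. \<epsilon> * (coef m (pos \<sigma> m) i * P))"
    unfolding sum.reindex[OF inj] comp_def
    by (intro sum.cong refl) (simp add: incidence_insert[OF \<rho>\<Delta> m\<rho>] cyc \<epsilon>_def)
  also have "\<dots> = \<epsilon> * ((\<Sum>i\<in>I. coef m (pos \<sigma> m) i) * P)"
    by (simp add: sum_distrib_left sum_distrib_right)
  also have "\<dots> = 0"
  proof (cases "P = 0")
    case False
    have le: "1 \<le> pos \<rho> q \<and> pos \<rho> q \<le> pos \<sigma> q" if q: "q \<in> {1..d+1} - {m}" for q
    proof
      show "1 \<le> pos \<rho> q" using pos_ge_1[OF \<rho>\<Delta>, of q] q m(2) by simp
      have "coef q (pos \<sigma> q) (pos \<rho> q) \<noteq> 0" using False q by (auto simp: P_def)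
      then show "pos \<rho> q \<le> pos \<sigma> q" by (auto simp: coef_def split: if_splits)
    qed
    have "{1..pos \<sigma> m} \<subseteq> I"
    proof
      fix i assume i: "i \<in> {1..pos \<sigma> m}"
      have "tuple_face (\<lambda>q. if q = m then i else pos \<rho> q) \<in> faces \<Delta> (int d)"
        by (rule tuple_face_shift[OF core_facet_face[OF \<sigma>]]) (use le i in auto)
      moreover have "tuple_face (\<lambda>q. if q = m then i else pos \<rho> q) = ?ins i"
      proof -
        have "(\<lambda>q. Vtx q (if q = m then i else pos \<rho> q)) ` ({1..d+1} - {m}) =
            (\<lambda>q. Vtx q (pos \<rho> q)) ` ({1..d+1} - {m})" by (intro image_cong) auto
        then show ?thesis unfolding tuple_face_split[OF m(1)] using face_eq_pos[OF \<rho>\<Delta>] m(2) by simp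
      qed
      ultimately show "i \<in> I" by (simp add: I_def top_face_iff)
    qed
    moreover have "I \<subseteq> {1..}"
    proof
      fix i assume "i \<in> I"
      then show "i \<in> {1..}" using vertex_range(2)[of "?ins i" "Vtx m i"] by (simp add: I_def)
    qed
    ultimately have "(\<Sum>i\<in>I. coef m (pos \<sigma> m) i) = (\<Sum>i=1..pos \<sigma> m. coef m (pos \<sigma> m) i)"
      using finI by (intro sum.mono_neutral_right) (auto simp: coef_def)
    also have "\<dots> = 0" using core_facet_pos[OF \<sigma> m(1)] by (rule sum_coef)
    finally show ?thesis by simp
  qed simp
  finally show ?thesis .
qed

lemma weight_tuple_face: "weight (tuple_face f) = (\<Prod>q\<in>{1..d+1}. x (Vtx q (f q)))"
  unfolding weight_def tuple_face_def by (subst prod.reindex) (auto simp: inj_on_def)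

text \<open>The sum may be restricted to the box of positions below \<open>\<sigma>\<close>, where it factors into one sum for each color.\<close>

lemma fund_cycle_orthogonal:
  assumes \<sigma>: "\<sigma> \<in> core_facets" and \<sigma>': "\<sigma>' \<in> core_facets"
  shows "(\<Sum>\<tau>\<in>faces \<Delta> (int d). fund_cycle \<sigma> \<tau> * fund_cycle \<sigma>' \<tau> / weight \<tau>) =
    (if \<sigma> = \<sigma>' then norm_sq \<sigma> else 0)"
proof -
  let ?Q = "{1..d+1}"
  let ?box = "{\<tau> \<in> faces \<Delta> (int d). \<forall>q\<in>?Q. pos \<tau> q \<le> pos \<sigma> q}"
  let ?t = "\<lambda>q i. coef q (pos \<sigma> q) i * coef q (pos \<sigma>' q) i / x (Vtx q i)"
  have "(\<Sum>\<tau>\<in>faces \<Delta> (int d). fund_cycle \<sigma> \<tau> * fund_cycle \<sigma>' \<tau> / weight \<tau>) =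
      (\<Sum>\<tau>\<in>?box. fund_cycle \<sigma> \<tau> * fund_cycle \<sigma>' \<tau> / weight \<tau>)"
    using fund_cycle_support[of \<sigma>] finite_faces[OF finite_complex]
    by (intro sum.mono_neutral_right) auto
  also have "\<dots> = (\<Sum>f\<in>PiE ?Q (\<lambda>q. {1..pos \<sigma> q}). \<Prod>q\<in>?Q. ?t q (f q))"
  proof (rule sum.reindex_bij_witness[where i=tuple_face and j="\<lambda>\<tau>. restrict (pos \<tau>) ?Q"])
    fix \<tau> assume \<tau>: "\<tau> \<in> ?box"
    then have \<tau>_top: "\<tau> \<in> faces \<Delta> (int d)" by simp
    have eq: "tuple_face (restrict (pos \<tau>) ?Q) = tuple_face (pos \<tau>)"
      unfolding tuple_face_def by (intro image_cong) auto
    then show "tuple_face (restrict (pos \<tau>) ?Q) = \<tau>" using tuple_face_pos[OF \<tau>_top] by simp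
    have "1 \<le> pos \<tau> q" if "q \<in> ?Q" for q using \<tau>_top that pos_ge_1 by (simp add: top_face_iff)
    then show "restrict (pos \<tau>) ?Q \<in> PiE ?Q (\<lambda>q. {1..pos \<sigma> q})" using \<tau> by auto
    have "weight \<tau> = (\<Prod>q\<in>?Q. x (Vtx q (pos \<tau> q)))"
      using weight_tuple_face[of "pos \<tau>"] tuple_face_pos[OF \<tau>_top] by simp
    then show "(\<Prod>q\<in>?Q. ?t q (restrict (pos \<tau>) ?Q q)) =
        fund_cycle \<sigma> \<tau> * fund_cycle \<sigma>' \<tau> / weight \<tau>"
      by (simp add: fund_cycle_def prod.distrib prod_dividef)
  next
    fix f assume f: "f \<in> PiE ?Q (\<lambda>q. {1..pos \<sigma> q})"
    then show "restrict (pos (tuple_face f)) ?Q = f"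
      by (auto simp: fun_eq_iff pos_tuple_face PiE_def extensional_def)
    have "tuple_face f \<in> faces \<Delta> (int d)"
      by (rule tuple_face_shift[OF core_facet_face[OF \<sigma>]]) (use f in \<open>auto simp: PiE_iff\<close>)
    then show "tuple_face f \<in> ?box" using f by (auto simp: pos_tuple_face PiE_iff)
  qed
  also have "\<dots> = (\<Prod>q\<in>?Q. \<Sum>i=1..pos \<sigma> q. ?t q i)"
    by (rule prod_sum_PiE[symmetric]) auto
  also have "\<dots> = (\<Prod>q\<in>?Q. if pos \<sigma> q = pos \<sigma>' q
      then 1 / x (Vtx q (pos \<sigma> q)) + 1 / psum q (pos \<sigma> q - 1) else 0)"
    using sum_coef_mult core_facet_pos \<sigma> \<sigma>' by (intro prod.cong refl) blast
  also have "\<dots> = (if \<sigma> = \<sigma>' then norm_sq \<sigma> else 0)"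
  proof (cases "\<sigma> = \<sigma>'")
    case False
    have ex: "\<exists>q\<in>?Q. pos \<sigma> q \<noteq> pos \<sigma>' q"
    proof (rule ccontr)
      assume "\<not> (\<exists>q\<in>?Q. pos \<sigma> q \<noteq> pos \<sigma>' q)"
      then have "tuple_face (pos \<sigma>) = tuple_face (pos \<sigma>')"
        unfolding tuple_face_def by (intro image_cong) auto
      then show False using False tuple_face_pos core_facet_face \<sigma> \<sigma>' by simp
    qed
    have "(\<Prod>q\<in>?Q. if pos \<sigma> q = pos \<sigma>' q
        then 1 / x (Vtx q (pos \<sigma> q)) + 1 / psum q (pos \<sigma> q - 1) else 0) = 0"
      by (rule prod_zero) (use ex in auto)
    then show ?thesis using False by simp
  qed (simp add: norm_sq_def)
  finally show ?thesis .
qed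

lemma norm_sq_eq:
  assumes "\<sigma> \<in> core_facets"
  shows "norm_sq \<sigma> * weight \<sigma> = (\<Prod>q\<in>{1..d+1}. psum q (pos \<sigma> q) / psum q (pos \<sigma> q - 1))"
proof -
  have "weight \<sigma> = (\<Prod>q\<in>{1..d+1}. x (Vtx q (pos \<sigma> q)))"
    using weight_tuple_face[of "pos \<sigma>"] tuple_face_pos[OF core_facet_face[OF assms]] by simp
  moreover have "(1 / x (Vtx q (pos \<sigma> q)) + 1 / psum q (pos \<sigma> q - 1)) * x (Vtx q (pos \<sigma> q)) =
      psum q (pos \<sigma> q) / psum q (pos \<sigma> q - 1)" if "q \<in> {1..d+1}" for q
  proof -
    have 2: "2 \<le> pos \<sigma> q" using core_facet_pos[OF assms that] .
    then have "psum q (pos \<sigma> q) = psum q (pos \<sigma> q - 1) + x (Vtx q (pos \<sigma> q))"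
      using psum_Suc[of q "pos \<sigma> q - 1"] by simp
    moreover have "psum q (pos \<sigma> q - 1) \<noteq> 0" using 2 by (intro psum_nonzero) simp
    ultimately show ?thesis using x_nonzero by (simp add: field_simps)
  qed
  ultimately show ?thesis
    unfolding norm_sq_def by (simp only: prod.distrib[symmetric] cong: prod.cong)
qed

lemma norm_sq_nonzero:
  assumes "\<sigma> \<in> core_facets"
  shows "norm_sq \<sigma> \<noteq> 0"
proof -
  have "norm_sq \<sigma> * weight \<sigma> \<noteq> 0"
    unfolding norm_sq_eq[OF assms] using core_facet_pos[OF assms] psum_nonzero
    by (fastforce simp: prod_zero_iff)
  then show ?thesis by auto
qed

end

context weighted_color_shifted_complex
begin

lemma weight_nonzero: "\<tau> \<in> \<Delta> \<Longrightarrow> weight \<tau> \<noteq> 0"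
  using x_nonzero finite_face by (simp add: weight_def)

text \<open>The support of a cycle lies componentwise below its core facet, so sorting the core facets by the sum of their
positions makes the matrix of the cycles triangular.\<close>

lemma fund_cycle_later_eq_0:
  assumes "\<sigma> \<in> core_facets" "\<tau> \<in> core_facets" "\<tau> \<noteq> \<sigma>"
    and le: "(\<Sum>q\<in>{1..d+1}. pos \<sigma> q) \<le> (\<Sum>q\<in>{1..d+1}. pos \<tau> q)"
  shows "fund_cycle \<sigma> \<tau> = 0"
proof (rule ccontr)
  assume "fund_cycle \<sigma> \<tau> \<noteq> 0"
  then have pointwise: "\<And>q. q \<in> {1..d+1} \<Longrightarrow> pos \<tau> q \<le> pos \<sigma> q" by (rule fund_cycle_support)
  have "\<not> (\<exists>q\<in>{1..d+1}. pos \<tau> q < pos \<sigma> q)"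
  proof
    assume "\<exists>q\<in>{1..d+1}. pos \<tau> q < pos \<sigma> q"
    then have "(\<Sum>q\<in>{1..d+1}. pos \<tau> q) < (\<Sum>q\<in>{1..d+1}. pos \<sigma> q)"
      using pointwise by (intro sum_strict_mono_ex1) auto
    then show False using le by simp
  qed
  then have "pos \<tau> q = pos \<sigma> q" if "q \<in> {1..d+1}" for q
    using pointwise[OF that] that by (meson le_neq_implies_less)
  then have "tuple_face (pos \<tau>) = tuple_face (pos \<sigma>)"
    unfolding tuple_face_def by (intro image_cong) auto
  then show False using assms(1-3) core_facet_face by (simp add: tuple_face_pos)
qed

text \<open>The determinant of \<open>M X M\<^sup>T\<close>, expanded by Cauchy--Binet on one side and evaluated through the orthogonal
cycles on the other.  The columns are ordered with the matched facets first, whose minor is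
unimodular.\<close>

lemma sum_squared_minors:
  assumes b: "bij_betw b {0..<card down_facets} down_facets"
    and b_sorted: "\<And>i j. i < j \<Longrightarrow> j < card down_facets \<Longrightarrow> pivot (b i) \<le> pivot (b j)"
    and g: "\<And>T. T \<subseteq> faces \<Delta> (int d) \<Longrightarrow> card T = card down_facets \<Longrightarrow>
      bij_betw (g T) {0..<card down_facets} T"
  shows "(\<Sum>T | T \<subseteq> faces \<Delta> (int d) \<and> card T = card down_facets. (\<Prod>\<tau>\<in>T. weight \<tau>) *
      of_int (det (mat (card down_facets) (card down_facets)
        (\<lambda>(i,j). incidence (b i - {Vtx (pivot (b i)) 1}) (g T j))) ^ 2)) =
    (\<Prod>\<tau>\<in>faces \<Delta> (int d). weight \<tau>) * (\<Prod>\<sigma>\<in>core_facets. norm_sq \<sigma>)"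
proof -
  let ?S = "faces \<Delta> (int d)" and ?m = "card down_facets" and ?k = "card core_facets"
  define e where "e i = b i - {Vtx (pivot (b i)) 1}" for i
  interpret cycle_coordinates \<Delta> "int d" ?m "\<lambda>i. b i - {Vtx (pivot (b i)) 1}" b
    using b b_sorted by (rule cycle_coordinates_down_facets)
  have fin: "finite ?S" by (rule finite_faces[OF finite_complex])
  have fin_core: "finite core_facets" using fin by (simp add: core_facets_def)
  obtain c where c: "bij_betw c {0..<?k} core_facets"
    and c_sorted: "\<And>r s. r < s \<Longrightarrow> s < ?k \<Longrightarrow>
      (\<Sum>q\<in>{1..d+1}. pos (c r) q) \<le> (\<Sum>q\<in>{1..d+1}. pos (c s) q)"
    using ex_sorted_enumeration[OF fin_core, of "\<lambda>\<sigma>. \<Sum>q\<in>{1..d+1}. pos \<sigma> q"] by blast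
  have c_in: "c r \<in> core_facets" if "r < ?k" for r using c that by (auto simp: bij_betw_def)
  have c_inj: "c r = c s \<longleftrightarrow> r = s" if "r < ?k" "s < ?k" for r s
    using c that by (auto simp: bij_betw_def inj_on_def)
  \<comment> \<open>All facets, the matched ones first.\<close>
  define h where "h j = (if j < ?m then b j else c (j - ?m))" for j
  have "down_facets \<inter> core_facets = {}" "down_facets \<union> core_facets = ?S"
    by (auto simp: core_facets_def down_facets_def)
  then have h: "bij_betw h {0..<?m + ?k} ?S"
    using bij_betw_append_enumerations[OF b c] unfolding h_def by simp
  have h_in: "h j \<in> ?S" if "j < ?m + ?k" for j using h that by (auto simp: bij_betw_def)
  have e_face: "e i \<in> faces \<Delta> (int d - 1)" if "i < ?m" for i
  proof -
    have "b i \<in> down_facets" using b that by (auto simp: bij_betw_def)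
    then have \<sigma>: "b i \<in> \<Delta>" "Vtx (pivot (b i)) 1 \<in> b i" "face_dim (b i) = int d"
      using down_facet_down[of "b i"] by (auto simp: down_def down_facets_def faces_def)
    have "e i \<in> \<Delta>" using \<sigma>(1) unfolding e_def by (rule face_subset) auto
    moreover have "card (b i) = Suc (card (e i))"
      unfolding e_def by (rule card.remove[OF finite_face[OF \<sigma>(1)] \<sigma>(2)])
    ultimately show ?thesis using \<sigma>(3) by (simp add: faces_def face_dim_def)
  qed
  have "det (mat ?m ?m (\<lambda>(i,i'). \<Sum>j = 0..<?m + ?k.
        of_int (incidence (e i) (h j)) * weight (h j) * of_int (incidence (e i') (h j)))) =
      det (mat ?m ?m (\<lambda>(i,j). of_int (incidence (e i) (h j)))) ^ 2 *
      (\<Prod>j = 0..<?m + ?k. weight (h j)) * (\<Prod>r = 0..<?k. norm_sq (c r))"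
  proof (rule det_weighted_gram[where W="\<lambda>r j. fund_cycle (c r) (h j)"])
    show "weight (h j) \<noteq> 0" if "j < ?m + ?k" for j
      using weight_nonzero[of "h j"] h_in[OF that] by (simp add: faces_def)
    show "norm_sq (c r) \<noteq> 0" if "r < ?k" for r using norm_sq_nonzero[OF c_in[OF that]] .
    show "(\<Sum>j = 0..<?m + ?k. of_int (incidence (e i) (h j)) * fund_cycle (c r) (h j)) = 0"
      if "i < ?m" "r < ?k" for i r
      using fund_cycle_boundary[OF e_face[OF that(1)] c_in[OF that(2)]]
        sum.reindex_bij_betw[OF h, of "\<lambda>\<tau>. of_int (incidence (e i) \<tau>) * fund_cycle (c r) \<tau>"] by simp
    show "(\<Sum>j = 0..<?m + ?k. fund_cycle (c r) (h j) * fund_cycle (c s) (h j) / weight (h j)) =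
        (if r = s then norm_sq (c r) else 0)" if "r < ?k" "s < ?k" for r s
      using fund_cycle_orthogonal[OF c_in[OF that(1)] c_in[OF that(2)]] c_inj[OF that]
        sum.reindex_bij_betw[OF h, of "\<lambda>\<tau>. fund_cycle (c r) \<tau> * fund_cycle (c s) \<tau> / weight \<tau>"] by simp
    show "fund_cycle (c r) (h (?m + r)) = 1" if "r < ?k" for r by (simp add: h_def fund_cycle_self)
    show "fund_cycle (c r) (h (?m + s)) = 0" if "r < s" "s < ?k" for r s
      using fund_cycle_later_eq_0[OF c_in c_in _ c_sorted[OF that]] c_inj[of s r] that
      by (simp add: h_def)
  qed
  also have "(\<Prod>j = 0..<?m + ?k. weight (h j)) = (\<Prod>\<tau>\<in>?S. weight \<tau>)"
    by (rule prod.reindex_bij_betw[OF h])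
  also have "(\<Prod>r = 0..<?k. norm_sq (c r)) = (\<Prod>\<sigma>\<in>core_facets. norm_sq \<sigma>)"
    by (rule prod.reindex_bij_betw[OF c])
  also have "det (mat ?m ?m (\<lambda>(i,j). of_int (incidence (e i) (h j)) :: 'f)) ^ 2 = 1"
  proof -
    have "mat ?m ?m (\<lambda>(i,j). incidence (e i) (h j)) =
        mat ?m ?m (\<lambda>(i,j). incidence (b i - {Vtx (pivot (b i)) 1}) (b j))"
      by (rule eq_matI) (auto simp: h_def e_def)
    then have "\<bar>det (mat ?m ?m (\<lambda>(i,j). incidence (e i) (h j)))\<bar> = 1" using unimodular by simp
    then have "det (mat ?m ?m (\<lambda>(i,j). incidence (e i) (h j))) ^ 2 = 1"
      by (metis power2_abs one_power2)
    then show ?thesis unfolding det_of_int by (metis of_int_1 of_int_power)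
  qed
  also have "mat ?m ?m (\<lambda>(i,i'). \<Sum>j = 0..<?m + ?k.
        of_int (incidence (e i) (h j)) * weight (h j) * of_int (incidence (e i') (h j))) =
      mat ?m ?m (\<lambda>(i,i'). \<Sum>\<tau>\<in>?S. of_int (incidence (e i) \<tau>) * weight \<tau> * of_int (incidence (e i') \<tau>))"
    by (rule eq_matI)
      (auto simp: sum.reindex_bij_betw[OF h, of "\<lambda>\<tau>. of_int (incidence (e _) \<tau>) * weight \<tau> * of_int (incidence (e _) \<tau>)"])
  finally show ?thesis
    using squared_minor_expansion[OF fin g, of "\<lambda>i. incidence (e i)" weight] by (simp add: e_def)
qed

end

section \<open>Collecting the weights\<close>

context color_shifted_complex
begin

text \<open>The index set of the second product in the formula: the \<open>(d-1)\<close>-faces of \<open>\<Gamma>\<close>.\<close>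

definition core_ridges :: "vertex set set" where
  "core_ridges = faces (Gamma_complex d \<Delta>) (int d - 1)"

lemma core_ridge_iff:
  "\<rho> \<in> core_ridges \<longleftrightarrow> \<rho> \<in> faces \<Delta> (int d - 1) \<and> (\<forall>q. Vtx q 1 \<notin> \<rho>)"
proof -
  have "(\<forall>q\<in>{1..d+1}. Vtx q 1 \<notin> \<rho>) \<longleftrightarrow> (\<forall>q. Vtx q 1 \<notin> \<rho>)" if "\<rho> \<in> \<Delta>"
    using vertex_range(1)[OF that, of "Vtx _ 1"] by (metis vertex.sel(1))
  then show ?thesis unfolding core_ridges_def faces_def Gamma_complex_def by blast
qed

lemma core_ridge_face: "\<rho> \<in> core_ridges \<Longrightarrow> \<rho> \<in> faces \<Delta> (int d - 1)"
  by (simp add: core_ridge_iff)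

lemma ridge_in: "\<rho> \<in> faces \<Delta> (int d - 1) \<Longrightarrow> \<rho> \<in> \<Delta>"
  by (simp add: faces_def)

lemma missing_color_eqI:
  assumes "q \<in> {1..d+1}" "color ` \<rho> = {1..d+1} - {q}"
  shows "missing_color d \<rho> = q"
  unfolding missing_color_def
proof (rule the_equality)
  show "q \<in> {1..d+1} \<and> (\<forall>v\<in>\<rho>. color v \<noteq> q)" using assms by auto
  fix r assume r: "r \<in> {1..d+1} \<and> (\<forall>v\<in>\<rho>. color v \<noteq> r)"
  then have "r \<notin> color ` \<rho>" by auto
  then show "r = q" using r assms(2) by blast
qed

lemma missing_color:
  assumes "\<rho> \<in> faces \<Delta> (int d - 1)"
  shows "missing_color d \<rho> \<in> {1..d+1}" "color ` \<rho> = {1..d+1} - {missing_color d \<rho>}"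
proof -
  obtain q where "q \<in> {1..d+1}" "color ` \<rho> = {1..d+1} - {q}" using assms by (rule codim_1_face)
  then show "missing_color d \<rho> \<in> {1..d+1}" "color ` \<rho> = {1..d+1} - {missing_color d \<rho>}"
    using missing_color_eqI[of q \<rho>] by auto
qed

text \<open>The positions that extend a \<open>(d-1)\<close>-face to a facet form an initial segment, by
shiftedness, and it is nonempty because the first vertex of the missing color can always be added.\<close>

lemma extension_iff:
  assumes \<rho>: "\<rho> \<in> faces \<Delta> (int d - 1)"
  shows "insert (Vtx (missing_color d \<rho>) j) \<rho> \<in> \<Delta> \<longleftrightarrow> 1 \<le> j \<and> j \<le> max_extension d \<Delta> \<rho>"
    and "1 \<le> max_extension d \<Delta> \<rho>"
proof -
  let ?q = "missing_color d \<rho>"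
  define I where "I = {j. insert (Vtx ?q j) \<rho> \<in> \<Delta>}"
  note q = missing_color[OF \<rho>]
  have notin: "Vtx ?q j \<notin> \<rho>" for j using q(2) by force
  have range: "1 \<le> j \<and> j \<le> n ?q" if "j \<in> I" for j
    using that vertex_range(2,3)[of "insert (Vtx ?q j) \<rho>" "Vtx ?q j"] by (simp add: I_def)
  have "finite I" by (rule finite_subset[of _ "{..n ?q}"]) (use range in auto)
  moreover have 1: "1 \<in> I"
    using insert_first_vertex[OF ridge_in[OF \<rho>] q(1)] q(2) by (simp add: I_def)
  ultimately have Max: "Max I \<in> I" "\<And>j. j \<in> I \<Longrightarrow> j \<le> Max I" by (auto intro: Max_in)
  have k: "max_extension d \<Delta> \<rho> = Max I" by (simp add: max_extension_def I_def)
  show "1 \<le> max_extension d \<Delta> \<rho>" unfolding k using Max(2)[OF 1] .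
  show "insert (Vtx ?q j) \<rho> \<in> \<Delta> \<longleftrightarrow> 1 \<le> j \<and> j \<le> max_extension d \<Delta> \<rho>"
  proof
    assume "insert (Vtx ?q j) \<rho> \<in> \<Delta>"
    then have "j \<in> I" by (simp add: I_def)
    then show "1 \<le> j \<and> j \<le> max_extension d \<Delta> \<rho>" using range Max(2) by (simp add: k)
  next
    assume "1 \<le> j \<and> j \<le> max_extension d \<Delta> \<rho>"
    then show "insert (Vtx ?q j) \<rho> \<in> \<Delta>"
      using shift[of ?q "Max I" \<rho> j] Max(1) notin by (simp add: k I_def)
  qed
qed

lemma ridge_of_facet:
  assumes \<sigma>: "\<sigma> \<in> faces \<Delta> (int d)" and v: "v \<in> \<sigma>"
  shows "\<sigma> - {v} \<in> faces \<Delta> (int d - 1)" "missing_color d (\<sigma> - {v}) = color v"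
proof -
  have \<sigma>\<Delta>: "\<sigma> \<in> \<Delta>" "color ` \<sigma> = {1..d+1}" using \<sigma> by (auto simp: top_face_iff)
  have "card \<sigma> = Suc (card (\<sigma> - {v}))" by (rule card.remove[OF finite_face[OF \<sigma>\<Delta>(1)] v])
  then show "\<sigma> - {v} \<in> faces \<Delta> (int d - 1)"
    using \<sigma> face_subset[OF \<sigma>\<Delta>(1), of "\<sigma> - {v}"] by (auto simp: faces_def face_dim_def)
  have "color ` (\<sigma> - {v}) = color ` \<sigma> - color ` {v}"
    using v by (intro inj_on_image_set_diff[OF inj_color[OF \<sigma>\<Delta>(1)]]) auto
  then show "missing_color d (\<sigma> - {v}) = color v"
    using \<sigma>\<Delta> vertex_range(1)[OF \<sigma>\<Delta>(1) v] by (intro missing_color_eqI) auto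
qed

lemma facet_of_ridge:
  assumes \<rho>: "\<rho> \<in> faces \<Delta> (int d - 1)" and j: "1 \<le> j" "j \<le> max_extension d \<Delta> \<rho>"
  defines "v \<equiv> Vtx (missing_color d \<rho>) j"
  shows "insert v \<rho> \<in> faces \<Delta> (int d)" "v \<notin> \<rho>" "pos (insert v \<rho>) (missing_color d \<rho>) = j"
proof -
  have in\<Delta>: "insert v \<rho> \<in> \<Delta>" using extension_iff(1)[OF \<rho>] j by (simp add: v_def)
  then show "insert v \<rho> \<in> faces \<Delta> (int d)"
    using missing_color[OF \<rho>] by (auto simp: top_face_iff v_def)
  show "v \<notin> \<rho>" using missing_color(2)[OF \<rho>] by (force simp: v_def)
  show "pos (insert v \<rho>) (missing_color d \<rho>) = j"
    using pos_eq[OF in\<Delta>] by (simp add: v_def)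
qed

lemma core_facet_iff: "\<sigma> \<in> core_facets \<longleftrightarrow> \<sigma> \<in> faces \<Delta> (int d) \<and> (\<forall>q. Vtx q 1 \<notin> \<sigma>)"
  by (auto simp: core_facets_def down_facets_def)

text \<open>Removing the vertex of color \<open>q\<close> from a core facet and recording its position is a bijection from pairs of a
core facet and a color onto pairs of a core ridge and a position from \<open>2\<close> up to its largest extension.\<close>

lemma prod_core_facets_eq_prod_core_ridges:
  fixes r :: "nat \<Rightarrow> nat \<Rightarrow> 'a::comm_monoid_mult"
  shows "(\<Prod>\<sigma>\<in>core_facets. \<Prod>q\<in>{1..d+1}. r q (pos \<sigma> q)) =
    (\<Prod>\<rho>\<in>core_ridges. \<Prod>j\<in>{2..max_extension d \<Delta> \<rho>}. r (missing_color d \<rho>) j)"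
proof -
  let ?Q = "{1..d+1}" and ?m = "missing_color d" and ?k = "max_extension d \<Delta>"
  have fin: "finite core_facets" "finite core_ridges"
    using finite_faces[OF finite_complex] core_ridge_face
    by (auto simp: core_facets_def intro: finite_subset[of core_ridges "faces \<Delta> (int d - 1)"])
  have "(\<Prod>\<sigma>\<in>core_facets. \<Prod>q\<in>?Q. r q (pos \<sigma> q)) = (\<Prod>(\<sigma>,q)\<in>core_facets \<times> ?Q. r q (pos \<sigma> q))"
    by (rule prod.cartesian_product)
  also have "\<dots> = (\<Prod>(\<rho>,j)\<in>Sigma core_ridges (\<lambda>\<rho>. {2..?k \<rho>}). r (?m \<rho>) j)"
  proof (rule prod.reindex_bij_witness[where
        i="\<lambda>(\<rho>,j). (insert (Vtx (?m \<rho>) j) \<rho>, ?m \<rho>)" and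
        j="\<lambda>(\<sigma>,q). (\<sigma> - {Vtx q (pos \<sigma> q)}, pos \<sigma> q)"])
    fix a assume "a \<in> core_facets \<times> ?Q"
    then obtain \<sigma> q where a: "a = (\<sigma>, q)" and \<sigma>: "\<sigma> \<in> core_facets" and q: "q \<in> ?Q" by auto
    let ?v = "Vtx q (pos \<sigma> q)"
    have top: "\<sigma> \<in> faces \<Delta> (int d)" using \<sigma> by (rule core_facet_face)
    have v: "?v \<in> \<sigma>" using pos_in[of \<sigma> q] top q by (simp add: top_face_iff)
    note ridge = ridge_of_facet[OF top v]
    show "(case (case a of (\<sigma>, q) \<Rightarrow> (\<sigma> - {Vtx q (pos \<sigma> q)}, pos \<sigma> q)) of
        (\<rho>, j) \<Rightarrow> (insert (Vtx (?m \<rho>) j) \<rho>, ?m \<rho>)) = a"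
      using ridge(2) v by (auto simp: a)
    have "\<sigma> - {?v} \<in> core_ridges" using ridge(1) \<sigma> by (simp add: core_ridge_iff core_facet_iff)
    moreover have "pos \<sigma> q \<le> ?k (\<sigma> - {?v})"
      using extension_iff(1)[OF ridge(1), of "pos \<sigma> q"] ridge(2) v top
      by (simp add: insert_absorb top_face_iff)
    ultimately show "(case a of (\<sigma>, q) \<Rightarrow> (\<sigma> - {Vtx q (pos \<sigma> q)}, pos \<sigma> q)) \<in>
        Sigma core_ridges (\<lambda>\<rho>. {2..?k \<rho>})"
      using core_facet_pos[OF \<sigma> q] by (simp add: a)
    show "(case (case a of (\<sigma>, q) \<Rightarrow> (\<sigma> - {Vtx q (pos \<sigma> q)}, pos \<sigma> q)) of
        (\<rho>, j) \<Rightarrow> r (?m \<rho>) j) = (case a of (\<sigma>, q) \<Rightarrow> r q (pos \<sigma> q))"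
      using ridge(2) by (simp add: a)
  next
    fix a assume "a \<in> Sigma core_ridges (\<lambda>\<rho>. {2..?k \<rho>})"
    then obtain \<rho> j where a: "a = (\<rho>, j)" and \<rho>: "\<rho> \<in> core_ridges" and j: "2 \<le> j" "j \<le> ?k \<rho>" by auto
    note face = core_ridge_face[OF \<rho>]
    have j1: "1 \<le> j" using j by simp
    note facet = facet_of_ridge[OF face j1 j(2)]
    show "(case (case a of (\<rho>, j) \<Rightarrow> (insert (Vtx (?m \<rho>) j) \<rho>, ?m \<rho>)) of
        (\<sigma>, q) \<Rightarrow> (\<sigma> - {Vtx q (pos \<sigma> q)}, pos \<sigma> q)) = a"
      using facet(2,3) by (simp add: a)
    show "(case a of (\<rho>, j) \<Rightarrow> (insert (Vtx (?m \<rho>) j) \<rho>, ?m \<rho>)) \<in> core_facets \<times> ?Q"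
      using facet(1) \<rho> j(1) missing_color(1)[OF face] by (auto simp: a core_facet_iff core_ridge_iff)
  qed
  also have "\<dots> = (\<Prod>\<rho>\<in>core_ridges. \<Prod>j\<in>{2..?k \<rho>}. r (?m \<rho>) j)"
    using fin(2) by (intro prod.Sigma[symmetric]) auto
  finally show ?thesis .
qed

text \<open>In the product over pairs of a matched facet and one of its vertices \<open>v\<close>, the pairs where a first vertex of
another color is present are counted by the exponents.  In the remaining pairs \<open>v\<close> is the only first vertex
of the facet, and removing it gives a core ridge.\<close>

lemma prod_down_facets:
  fixes x :: "vertex \<Rightarrow> 'a::comm_monoid_mult"
  shows "(\<Prod>\<tau>\<in>down_facets. \<Prod>v\<in>\<tau>. x v) =
    (\<Prod>q=1..d+1. \<Prod>i=1..n q. x (Vtx q i) ^ e_exponent d \<Delta> q i) *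
    (\<Prod>\<rho>\<in>core_ridges. x (Vtx (missing_color d \<rho>) 1))"
proof -
  let ?Q = "{1..d+1}"
  define E where "E q i = {\<sigma> \<in> faces \<Delta> (int d). Vtx q i \<in> \<sigma> \<and> (\<exists>r\<in>?Q. r \<noteq> q \<and> Vtx r 1 \<in> \<sigma>)}" for q i
  define S where "S = Sigma down_facets (\<lambda>\<tau>. \<tau>)"
  \<comment> \<open>The pairs counted by the exponents.\<close>
  define S1 where "S1 = {(\<tau>,v) \<in> S. \<exists>r\<in>?Q. r \<noteq> color v \<and> Vtx r 1 \<in> \<tau>}"
  have finE: "finite (E q i)" for q i
    using finite_faces[OF finite_complex] by (simp add: E_def)
  have finS: "finite S"
    unfolding S_def using finite_down_facets down_facet_down finite_face by (intro finite_SigmaI) blast+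
  have S: "\<tau> \<in> down_facets \<and> \<tau> \<in> faces \<Delta> (int d) \<and> \<tau> \<in> \<Delta> \<and> v \<in> \<tau>" if "(\<tau>,v) \<in> S" for \<tau> v
    using that by (auto simp: S_def down_facets_def faces_def)
  have "(\<Prod>\<tau>\<in>down_facets. \<Prod>v\<in>\<tau>. x v) = (\<Prod>(\<tau>,v)\<in>S. x v)"
    unfolding S_def using finite_down_facets down_facet_down finite_face by (intro prod.Sigma) blast+
  also have "\<dots> = (\<Prod>(\<tau>,v)\<in>S - S1. x v) * (\<Prod>(\<tau>,v)\<in>S1. x v)"
    by (rule prod.subset_diff[OF _ finS]) (auto simp: S1_def)
  also have "(\<Prod>(\<tau>,v)\<in>S1. x v) =
      (\<Prod>((q,i),\<sigma>)\<in>Sigma (Sigma ?Q (\<lambda>q. {1..n q})) (\<lambda>(q,i). E q i). x (Vtx q i))"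
  proof (rule prod.reindex_bij_witness[where
        i="\<lambda>((q,i),\<sigma>). (\<sigma>, Vtx q i)" and j="\<lambda>(\<tau>,v). ((color v, index v), \<tau>)"])
    fix a assume "a \<in> S1"
    then obtain \<tau> v where a: "a = (\<tau>, v)" "(\<tau>, v) \<in> S" "\<exists>r\<in>?Q. r \<noteq> color v \<and> Vtx r 1 \<in> \<tau>"
      by (auto simp: S1_def)
    note * = S[OF a(2)]
    show "(\<lambda>((q,i),\<sigma>). (\<sigma>, Vtx q i)) ((\<lambda>(\<tau>,v). ((color v, index v), \<tau>)) a) = a"
      by (simp add: a)
    show "(case a of (\<tau>, v) \<Rightarrow> ((color v, index v), \<tau>)) \<in>
        Sigma (Sigma ?Q (\<lambda>q. {1..n q})) (\<lambda>(q,i). E q i)"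
      using * a(3) vertex_range[of \<tau> v] by (simp add: a(1) E_def)
    show "(\<lambda>((q,i),\<sigma>). x (Vtx q i)) ((\<lambda>(\<tau>,v). ((color v, index v), \<tau>)) a) =
        (case a of (\<tau>, v) \<Rightarrow> x v)" by (simp add: a)
  next
    fix a assume "a \<in> Sigma (Sigma ?Q (\<lambda>q. {1..n q})) (\<lambda>(q,i). E q i)"
    then obtain q i \<sigma> where a: "a = ((q, i), \<sigma>)" "\<sigma> \<in> E q i" by auto
    show "(\<lambda>(\<tau>,v). ((color v, index v), \<tau>)) ((\<lambda>((q,i),\<sigma>). (\<sigma>, Vtx q i)) a) = a"
      by (simp add: a)
    show "(\<lambda>((q,i),\<sigma>). (\<sigma>, Vtx q i)) a \<in> S1"
      using a(2) by (auto simp: a(1) S1_def S_def E_def down_facets_def)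
  qed
  also have "\<dots> = (\<Prod>(q,i)\<in>Sigma ?Q (\<lambda>q. {1..n q}). \<Prod>\<sigma>\<in>E q i. x (Vtx q i))"
    using finE by (subst prod.Sigma[symmetric]) (auto simp: case_prod_unfold)
  also have "\<dots> = (\<Prod>q\<in>?Q. \<Prod>i=1..n q. \<Prod>\<sigma>\<in>E q i. x (Vtx q i))"
    by (rule prod.Sigma[symmetric]) auto
  also have "\<dots> = (\<Prod>q\<in>?Q. \<Prod>i=1..n q. x (Vtx q i) ^ e_exponent d \<Delta> q i)"
    by (simp only: prod_constant E_def e_exponent_def)
  also have "(\<Prod>(\<tau>,v)\<in>S - S1. x v) = (\<Prod>\<rho>\<in>core_ridges. x (Vtx (missing_color d \<rho>) 1))"
  proof (rule prod.reindex_bij_witness[where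
        i="\<lambda>\<rho>. (insert (Vtx (missing_color d \<rho>) 1) \<rho>, Vtx (missing_color d \<rho>) 1)" and
        j="\<lambda>(\<tau>,v). \<tau> - {v}"])
    fix a assume "a \<in> S - S1"
    then obtain \<tau> v where a: "a = (\<tau>, v)" "(\<tau>, v) \<in> S" "\<not> (\<exists>r\<in>?Q. r \<noteq> color v \<and> Vtx r 1 \<in> \<tau>)"
      by (auto simp: S1_def)
    note * = S[OF a(2)]
    obtain r where r: "Vtx r 1 \<in> \<tau>" using * by (auto simp: down_facets_def)
    have only: "q = color v" if "Vtx q 1 \<in> \<tau>" for q
      using a(3) that vertex_range(1)[of \<tau> "Vtx q 1"] * by auto
    have "color v = color (Vtx r 1)" using only[OF r] by simp
    with * r have v: "v = Vtx r 1" by (intro color_inj[of \<tau> v]) blast+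
    note ridge = ridge_of_facet[of \<tau> v]
    show "(\<lambda>\<rho>. (insert (Vtx (missing_color d \<rho>) 1) \<rho>, Vtx (missing_color d \<rho>) 1))
        (case a of (\<tau>, v) \<Rightarrow> \<tau> - {v}) = a"
      using ridge(2) * v by (auto simp: a(1))
    have "Vtx q 1 \<notin> \<tau> - {v}" for q using only[of q] v by auto
    then show "(case a of (\<tau>, v) \<Rightarrow> \<tau> - {v}) \<in> core_ridges"
      using ridge(1) * by (simp add: a(1) core_ridge_iff)
    show "x (Vtx (missing_color d (case a of (\<tau>, v) \<Rightarrow> \<tau> - {v})) 1) = (case a of (\<tau>, v) \<Rightarrow> x v)"
      using ridge(2) * v by (simp add: a(1))
  next
    fix \<rho> assume \<rho>: "\<rho> \<in> core_ridges"
    let ?v = "Vtx (missing_color d \<rho>) 1"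
    note face = core_ridge_face[OF \<rho>]
    note facet = facet_of_ridge[OF face order_refl extension_iff(2)[OF face]]
    show "(case (insert ?v \<rho>, ?v) of (\<tau>, v) \<Rightarrow> \<tau> - {v}) = \<rho>" using facet(2) by simp
    have "(insert ?v \<rho>, ?v) \<in> S" using facet(1) by (auto simp: S_def down_facets_def)
    moreover have "(insert ?v \<rho>, ?v) \<notin> S1" using \<rho> by (auto simp: S1_def core_ridge_iff)
    ultimately show "(insert ?v \<rho>, ?v) \<in> S - S1" by simp
  qed
  finally show ?thesis by (simp only: mult.commute)
qed

end

context weighted_color_shifted_complex
begin

lemma telescope_psum:
  assumes "1 \<le> k"
  shows "x (Vtx q 1) * (\<Prod>j\<in>{2..k}. psum q j / psum q (j - 1)) = psum q k"
  using assms
proof (induction k rule: dec_induct)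
  case base
  then show ?case by (simp add: psum_def)
next
  case (step k)
  have "{2..Suc k} = insert (Suc k) {2..k}" using step.hyps by auto
  then show ?case using step psum_nonzero[of k q] by (simp add: mult.left_commute)
qed

text \<open>For a core ridge with missing color \<open>q\<close> and largest extension \<open>k\<close>, the ratios of consecutive prefix sums
telescope to the prefix sum up to \<open>k\<close> divided by the weight of the first vertex of color \<open>q\<close>.  These weights
are supplied by the matched facets that contain only one first vertex.\<close>

lemma product_formula:
  "(\<Prod>\<tau>\<in>faces \<Delta> (int d). weight \<tau>) * (\<Prod>\<sigma>\<in>core_facets. norm_sq \<sigma>) =
    (\<Prod>q=1..d+1. \<Prod>i=1..n q. x (Vtx q i) ^ e_exponent d \<Delta> q i) *
    (\<Prod>\<rho>\<in>core_ridges. psum (missing_color d \<rho>) (max_extension d \<Delta> \<rho>))"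
proof -
  have fin: "finite (faces \<Delta> (int d))" by (rule finite_faces[OF finite_complex])
  have "(\<Prod>\<tau>\<in>faces \<Delta> (int d). weight \<tau>) = (\<Prod>\<tau>\<in>core_facets. weight \<tau>) * (\<Prod>\<tau>\<in>down_facets. weight \<tau>)"
    unfolding core_facets_def by (rule prod.subset_diff[OF _ fin]) (auto simp: down_facets_def)
  then have "(\<Prod>\<tau>\<in>faces \<Delta> (int d). weight \<tau>) * (\<Prod>\<sigma>\<in>core_facets. norm_sq \<sigma>) =
      (\<Prod>\<tau>\<in>down_facets. weight \<tau>) * (\<Prod>\<sigma>\<in>core_facets. norm_sq \<sigma> * weight \<sigma>)"
    by (simp add: prod.distrib mult_ac)
  also have "(\<Prod>\<sigma>\<in>core_facets. norm_sq \<sigma> * weight \<sigma>) =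
      (\<Prod>\<rho>\<in>core_ridges. \<Prod>j\<in>{2..max_extension d \<Delta> \<rho>}.
        psum (missing_color d \<rho>) j / psum (missing_color d \<rho>) (j - 1))"
    using norm_sq_eq prod_core_facets_eq_prod_core_ridges[of "\<lambda>q j. psum q j / psum q (j - 1)"]
    by (simp only: cong: prod.cong)
  also have "(\<Prod>\<tau>\<in>down_facets. weight \<tau>) * \<dots> =
      (\<Prod>q=1..d+1. \<Prod>i=1..n q. x (Vtx q i) ^ e_exponent d \<Delta> q i) *
      (\<Prod>\<rho>\<in>core_ridges. x (Vtx (missing_color d \<rho>) 1) * (\<Prod>j\<in>{2..max_extension d \<Delta> \<rho>}.
        psum (missing_color d \<rho>) j / psum (missing_color d \<rho>) (j - 1)))"
    unfolding weight_def prod_down_facets prod.distrib by (simp only: mult.assoc)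
  also have "(\<Prod>\<rho>\<in>core_ridges. x (Vtx (missing_color d \<rho>) 1) * (\<Prod>j\<in>{2..max_extension d \<Delta> \<rho>}.
        psum (missing_color d \<rho>) j / psum (missing_color d \<rho>) (j - 1))) =
      (\<Prod>\<rho>\<in>core_ridges. psum (missing_color d \<rho>) (max_extension d \<Delta> \<rho>))"
    by (intro prod.cong refl telescope_psum extension_iff(2) core_ridge_face)
  finally show ?thesis .
qed

end

section \<open>The weighted tree-number of a color-shifted complex\<close>

lemma lookup_indet:
  "Poly_Mapping.lookup (indet u) (Poly_Mapping.single v 1) = (if u = v then 1 else 0)"
proof -
  have "u = v" if "Poly_Mapping.single u (1::nat) = Poly_Mapping.single v 1"
    using arg_cong[OF that, of Poly_Mapping.keys] by simp
  then show ?thesis by (auto simp: indet_def lookup_single when_def)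
qed

lemma lookup_D_poly:
  assumes "1 \<le> j"
  shows "Poly_Mapping.lookup (D_poly q j) (Poly_Mapping.single (Vtx q 1) 1) = 1"
  using assms by (simp add: D_poly_def lookup_sum lookup_indet[simplified])

text \<open>Prefix sums of indeterminates may be used as denominators: the coefficient of the first one is \<open>1\<close>.\<close>

lemma D_poly_nonzero: "1 \<le> j \<Longrightarrow> D_poly q j \<noteq> 0"
  using lookup_D_poly[of j q] by auto

theorem theorem5p6:
  fixes d :: nat and n :: "nat \<Rightarrow> nat" and \<Delta> :: "vertex set set"
  assumes "d \<ge> 1"
    and "color_shifted d n \<Delta>"
    and "has_dimension \<Delta> (int d)"
  shows "weighted_tree_number (int d) \<Delta> =
    (\<Prod>q=1..d+1. \<Prod>i=1..n q. indet (Vtx q i) ^ e_exponent d \<Delta> q i) *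
    (\<Prod>\<rho>\<in>faces (Gamma_complex d \<Delta>) (int d - 1).
       D_poly (missing_color d \<rho>) (max_extension d \<Delta> \<rho>))"
proof -
  let ?F = "to_fract :: vertex int_mpoly \<Rightarrow> vertex int_mpoly fract"
  have F_prod: "?F (prod f A) = (\<Prod>a\<in>A. ?F (f a))" for f :: "'b \<Rightarrow> vertex int_mpoly" and A
    by (induction A rule: infinite_finite_induct) simp_all
  have F_power: "?F (p ^ k) = ?F p ^ k" for p k by (induction k) simp_all
  have F_nat: "?F (of_nat k) = of_nat k" for k by (induction k) simp_all
  have F_int: "?F (of_int k) = of_int k" for k
    by (cases k) (simp_all add: F_nat)
  have F_D: "?F (D_poly q j) = (\<Sum>i=1..j. ?F (indet (Vtx q i)))" for q j
    unfolding D_poly_def to_fract_sum ..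
  interpret color_shifted_complex d n \<Delta> by unfold_locales (use assms in auto)
  interpret weighted_color_shifted_complex d n \<Delta> "\<lambda>v. ?F (indet v)"
  proof
    show "?F (indet v) \<noteq> 0" for v by (simp add: indet_def)
    show "(\<Sum>i=1..j. ?F (indet (Vtx q i))) \<noteq> 0" if "1 \<le> j" for j q
      unfolding F_D[symmetric] using D_poly_nonzero[OF that] by simp
  qed
  from ex_sorted_enumeration[OF finite_down_facets, of pivot] obtain b
    where "bij_betw b {0..<card down_facets} down_facets \<and>
      (\<forall>i j. i < j \<longrightarrow> j < card down_facets \<longrightarrow> pivot (b i) \<le> pivot (b j))" by (rule exE)
  then have b: "bij_betw b {0..<card down_facets} down_facets"
    and b_sorted: "\<And>i j. i < j \<Longrightarrow> j < card down_facets \<Longrightarrow> pivot (b i) \<le> pivot (b j)"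
    by simp_all
  interpret cycle_coordinates \<Delta> "int d" "card down_facets" "\<lambda>i. b i - {Vtx (pivot (b i)) 1}" b
    using b b_sorted by (rule cycle_coordinates_down_facets)
  have "\<exists>h. bij_betw h {0..<card T} T" if "T \<subseteq> faces \<Delta> (int d)" for T
    using finite_subset[OF that finite_faces[OF finite_complex]] by (rule ex_bij_betw_nat_finite)
  then obtain g where g: "\<And>T. T \<subseteq> faces \<Delta> (int d) \<Longrightarrow> bij_betw (g T) {0..<card T} T" by metis
  then have g': "\<And>T. T \<subseteq> faces \<Delta> (int d) \<Longrightarrow> card T = card down_facets \<Longrightarrow>
      bij_betw (g T) {0..<card down_facets} T" by metis
  have "?F (weighted_tree_number (int d) \<Delta>) =
      (\<Sum>T | T \<subseteq> faces \<Delta> (int d) \<and> card T = card down_facets.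
        (\<Prod>\<tau>\<in>T. weight \<tau>) * of_int (det (minor (g T)) ^ 2))"
    using weighted_tree_number_eq_sum_minors[OF g']
    by (simp add: to_fract_sum F_prod F_power F_int face_weight_def weight_def)
  also have "\<dots> = (\<Prod>\<tau>\<in>faces \<Delta> (int d). weight \<tau>) * (\<Prod>\<sigma>\<in>core_facets. norm_sq \<sigma>)"
    unfolding minor_def by (rule sum_squared_minors[OF b b_sorted g'])
  also have "\<dots> = ?F ((\<Prod>q=1..d+1. \<Prod>i=1..n q. indet (Vtx q i) ^ e_exponent d \<Delta> q i) *
      (\<Prod>\<rho>\<in>faces (Gamma_complex d \<Delta>) (int d - 1).
        D_poly (missing_color d \<rho>) (max_extension d \<Delta> \<rho>)))"
    unfolding product_formula core_ridges_def
    by (simp only: to_fract_mult F_prod F_power F_D psum_def)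
  finally show ?thesis by (simp only: to_fract_eq_iff)
qed

end
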